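(* Let $A,B\in\mathbb{R}^{n\times n}$ be symmetric positive definite matrices of quasiseparable rank $k_A$ and $k_B$, respectively, and suppose that the spectra of $A$ and $B$ are both contained in the interval $[a,b]$, where $0<a<b<\infty$. Let $C\in\mathbb{R}^{n\times n}$ have quasiseparable rank $k_C$, and let $X\in\mathbb{R}^{n\times n}$ solve the Sylvester equation $AX+XB=C$. Then every nonzero off-diagonal block $Y$ of $X$ satisfies $$\frac{\sigma_{1+k\ell}(Y)}{\sigma_1(Y)}\le 4\rho^{-2\ell}\qquad\text{for all integers }\ell\ge 1,$$ where $k:=k_A+k_B+k_C$, $\rho:=\exp\left(\frac{\pi^2}{2\mu(a/b)}\right)$, and $\mu$ is the Grötzsch ring function.
   Context: The quasiseparable rank of a square matrix is the maximum of the ranks of all its submatrices contained in its strictly upper or strictly lower triangular part. An off-diagonal block of an $n\times n$ matrix $X$ is one of the two off-diagonal blocks $X_{12},X_{21}$ of a $2\times2$ block partitioning $X=\begin{bmatrix} X_{11} & X_{12} \\ X_{21} & X_{22} \end{bmatrix}$ with square diagonal blocks, i.e. the submatrix with rows $p+1,\dots,n$ and columns $1,\dots,p$, or rows $1,\dots,p$ and columns $p+1,\dots,n$, for some $1\le p\le n-1$. $\sigma_1(M)\ge\sigma_2(M)\ge\cdots$ denote the singular values of $M$ in non-increasing order, with $\sigma_j(M)=0$ if $j$ exceeds the smaller dimension of $M$. The Grötzsch ring function is $\mu(\lambda):=\frac{\pi}{2}\frac{K(\sqrt{1-\lambda^2})}{K(\lambda)}$ for $0<\lambda<1$, where $K(\lambda):=\int_0^1\frac{dt}{\sqrt{(1-t^2)(1-\lambda^2t^2)}}$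 is the complete elliptic integral of the first kind. *)

theory Defs
  imports
    "HOL-Analysis.Analysis"
    "Jordan_Normal_Form.DL_Rank"
    "Jordan_Normal_Form.DL_Submatrix"
    "Jordan_Normal_Form.Spectral_Radius"
begin

definition mat_rank :: "real mat \<Rightarrow> nat" where
  "mat_rank M = vec_space.rank (dim_row M) M"

definition sym_pos_def :: "real mat \<Rightarrow> bool" where
  "sym_pos_def A \<longleftrightarrow> square_mat A \<and> transpose_mat A = A \<and>
     (\<forall>v \<in> carrier_vec (dim_row A). v \<noteq> 0\<^sub>v (dim_row A) \<longrightarrow> scalar_prod v (A *\<^sub>v v) > 0)"

(* The index sets may be empty, so the maximum is over a nonempty finite set
   also for 1 x 1 matrices, whose quasiseparable rank is therefore 0. *)
definition quasiseparable_rank :: "real mat \<Rightarrow> nat" where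
  "quasiseparable_rank A = Max {mat_rank (submatrix A I J) | I J.
     I \<subseteq> {..<dim_row A} \<and> J \<subseteq> {..<dim_col A} \<and>
     ((\<forall>i\<in>I. \<forall>j\<in>J. i < j) \<or> (\<forall>i\<in>I. \<forall>j\<in>J. j < i))}"

definition off_diagonal_block :: "real mat \<Rightarrow> real mat \<Rightarrow> bool" where
  "off_diagonal_block X Y \<longleftrightarrow> (\<exists>p X11 X12 X21 X22. 1 \<le> p \<and> p < dim_row X \<and>
     split_block X p p = (X11, X12, X21, X22) \<and> (Y = X12 \<or> Y = X21))"

(* proots counts the eigenvalues of the symmetric matrix M^T M with multiplicity.
   If M has more columns than rows, the superfluous entries at the end of the
   list are zero. *)
definition singular_value_list :: "real mat \<Rightarrow> real list" where
  "singular_value_list M =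
     rev (sorted_list_of_multiset (image_mset sqrt (proots (char_poly (transpose_mat M * M)))))"

(* The index j starts at 1. *)
definition singular_value :: "nat \<Rightarrow> real mat \<Rightarrow> real" where
  "singular_value j M =
     (if 1 \<le> j \<and> j \<le> min (dim_row M) (dim_col M) then singular_value_list M ! (j - 1) else 0)"

(* The integrand is unbounded near t = 1 but absolutely integrable for 0 <= x < 1;
   its junk value 1 / 0 = 0 at t = 1 does not affect the integral. *)
definition elliptic_K :: "real \<Rightarrow> real" where
  "elliptic_K x = integral {0..1} (\<lambda>t. 1 / sqrt ((1 - t\<^sup>2) * (1 - x\<^sup>2 * t\<^sup>2)))"

definition groetzsch_mu :: "real \<Rightarrow> real" where
  "groetzsch_mu x = pi / 2 * (elliptic_K (sqrt (1 - x\<^sup>2)) / elliptic_K x)"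

end

theory Submission
  imports Defs
begin

text \<open>
The block \<open>Y\<close> with row window \<open>I\<close> and column window \<open>J\<close> solves a Sylvester equation of its own:
reading \<open>A X + X B = C\<close> on \<open>I \<times> J\<close> and moving the terms with the off-diagonal blocks of \<open>A\<close> and
\<open>B\<close> to the right gives \<open>A' Y + Y B' = F\<close>, where \<open>A'\<close> and \<open>B'\<close> are principal submatrices of \<open>A\<close> and \<open>B\<close>,
with eigenvalues still in \<open>[a, b]\<close>, and \<open>F\<close> has rank at most \<open>k = k_A + k_B + k_C\<close>
(\<open>sylvester_block_singular_value_decay\<close>).

For positive \<open>p_0, \<dots>, p_(l-1)\<close> put \<open>r(x) = \<Prod> (x - p_j) / (x + p_j)\<close>. In eigenbases of \<open>A'\<close> and \<open>B'\<close>,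
with eigenvalues \<open>d_i\<close> and \<open>e_j\<close>, the equation is \<open>(d_i + e_j) Y_ij = F_ij\<close>, and the matrix with entries
\<open>Y_ij (1 - r(d_i) r(e_j))\<close> telescopes into \<open>l\<close> terms of rank at most \<open>k\<close> each
(\<open>separable_rational_residual\<close>). The remainder \<open>r(d_i) Y_ij r(e_j)\<close> has spectral norm at most
\<open>(max |r|)\<^sup>2 \<sigma>_1(Y)\<close>, so the easy half of the Eckart-Young theorem bounds \<open>\<sigma>_(1+kl)(Y)\<close> by the same
number. It remains to choose the \<open>p_j\<close> with \<open>|r| \<le> 2 \<rho>^(-l)\<close> on \<open>[a, b]\<close>: this is Zolotarev's
third problem for \<open>[a, b]\<close> and \<open>[-b, -a]\<close> (\<open>zolotarev_upper_bound\<close>).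

Zolotarev's extremal function comes from theta series. For a suitable nome \<open>q\<close> the interval is
parametrised as \<open>x = sqrt (a b) \<tau>(u)\<close>, where \<open>\<tau>(u)\<close> is the quotient of the theta value at \<open>z = exp (i u)\<close>
by the value at \<open>-z\<close>, a multiple of Jacobi's function dn. The product formula for
theta series (\<open>theta_product\<close>) writes \<open>(\<tau>(u) - \<tau>(v)) / (\<tau>(u) + \<tau>(v))\<close> as a quotient of theta values of
nome \<open>q\<^sup>2\<close> at \<open>u + v\<close> and \<open>u - v\<close>. If the \<open>v_j\<close> are equally spaced, the product over \<open>j\<close> runs
through all shifts of \<open>u\<close> by the arguments of the \<open>2l\<close>-th roots of \<open>-1\<close>, and the Jacobi triple product collapses it to
a single quotient, of nome \<open>q^(4l)\<close> (\<open>theta_multiplication\<close>), whose modulus is at most \<open>2\<close>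
(\<open>theta_shift_le_two\<close>). Hence \<open>|r| \<le> 2 q^l\<close>.

The inequality \<open>q \<le> 1 / \<rho>\<close> compares the nome with elliptic integrals (\<open>nome_le_exp_K_ratio\<close>). Squaring the
nome is Landen's transformation of the modulus \<open>\<lambda>\<close>, and Landen's transformation doubles \<open>K(\<lambda>) / K(\<lambda>')\<close>
with \<open>\<lambda>' = sqrt (1 - \<lambda>\<^sup>2)\<close>. Along the orbit \<open>\<lambda>\<close> tends to \<open>1\<close>, where \<open>K(\<lambda>)\<close> grows like \<open>ln (1 / \<lambda>')\<close>, \<open>K(\<lambda>')\<close>
stays above \<open>\<pi> / 2\<close>, and \<open>\<lambda>'\<close> decays no faster than the square root of the nome. Dividing by the
powers of \<open>2\<close> and passing to the limit gives \<open>\<pi> K(\<lambda>) / K(\<lambda>') \<le> ln (1 / q)\<close>.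
\<close>


section \<open>Complete elliptic integrals\<close>

definition K_integrand :: "real \<Rightarrow> real \<Rightarrow> real" where
  "K_integrand x t = 1 / sqrt ((1 - t\<^sup>2) * (1 - x\<^sup>2 * t\<^sup>2))"

lemma has_integral_inverse_sqrt: "((\<lambda>t. 1 / sqrt (1 - t\<^sup>2)) has_integral pi / 2) {0..1::real}"
proof -
  have "((\<lambda>t. 1 / sqrt (1 - t\<^sup>2)) has_integral arcsin 1 - arcsin 0) {0..1::real}"
  proof (rule fundamental_theorem_of_calculus_interior)
    show "continuous_on {0..1} arcsin"
      by (rule continuous_on_subset[OF continuous_on_arcsin']) auto
    fix t :: real assume "t \<in> {0<..<1}"
    then show "(arcsin has_vector_derivative 1 / sqrt (1 - t\<^sup>2)) (at t)"
      using DERIV_arcsin[of t]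
      by (simp add: has_real_derivative_iff_has_vector_derivative[symmetric] divide_inverse)
  qed simp
  then show ?thesis by simp
qed

lemma square_lt_1: "0 \<le> x \<Longrightarrow> x < 1 \<Longrightarrow> x\<^sup>2 < (1::real)"
  by (simp add: abs_square_less_1)

lemma modulus_factor_bounds:
  assumes "0 \<le> x" "x < 1" "t \<in> {0..1::real}"
  shows "1 - x\<^sup>2 \<le> 1 - x\<^sup>2 * t\<^sup>2" "1 - x\<^sup>2 * t\<^sup>2 \<le> 1" "0 < 1 - x\<^sup>2 * t\<^sup>2"
proof -
  have "t\<^sup>2 \<le> 1" using assms by (simp add: abs_square_le_1)
  then show 1: "1 - x\<^sup>2 \<le> 1 - x\<^sup>2 * t\<^sup>2" by (simp add: mult_left_le)
  show "1 - x\<^sup>2 * t\<^sup>2 \<le> 1" by simp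
  show "0 < 1 - x\<^sup>2 * t\<^sup>2" using 1 square_lt_1[OF assms(1,2)] by linarith
qed

text \<open>
The singularity at \<open>t = 1\<close> is that of \<open>1 / sqrt (1 - t\<^sup>2)\<close>, which is integrated by the arcsine; the
other factor is bounded because \<open>x < 1\<close>.
\<close>
lemma K_integrand_abs_integrable:
  assumes "0 \<le> x" "x < 1"
  shows "K_integrand x absolutely_integrable_on {0..1}"
proof -
  have 1: "(\<lambda>t. 1 / sqrt (1 - t\<^sup>2)) absolutely_integrable_on {0..1::real}"
    by (rule nonnegative_absolutely_integrable_1)
      (use has_integral_inverse_sqrt in \<open>auto simp: has_integral_integrable abs_square_le_1\<close>)
  have c: "continuous_on {0..1::real} (\<lambda>t. 1 / sqrt (1 - x\<^sup>2 * t\<^sup>2))"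
    using modulus_factor_bounds(3)[OF assms] by (intro continuous_intros) force+
  have "(\<lambda>t. (1 / sqrt (1 - x\<^sup>2 * t\<^sup>2)) * (1 / sqrt (1 - t\<^sup>2))) absolutely_integrable_on {0..1}"
  proof (rule absolutely_integrable_bounded_measurable_product_real[OF _ _ _ 1])
    show "(\<lambda>t. 1 / sqrt (1 - x\<^sup>2 * t\<^sup>2)) \<in> borel_measurable (lebesgue_on {0..1})"
      using c by (intro continuous_imp_measurable_on_sets_lebesgue) auto
    show "bounded ((\<lambda>t. 1 / sqrt (1 - x\<^sup>2 * t\<^sup>2)) ` {0..1})"
      using c by (intro compact_imp_bounded compact_continuous_image) auto
  qed auto
  then show ?thesis
    by (simp add: K_integrand_def[abs_def] real_sqrt_mult mult.commute)
qed

lemma K_integrand_has_integral: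
  assumes "0 \<le> x" "x < 1"
  shows "(K_integrand x has_integral elliptic_K x) {0..1}"
  using K_integrand_abs_integrable[OF assms]
  unfolding elliptic_K_def K_integrand_def[abs_def]
  by (simp add: absolutely_integrable_on_def integrable_integral)

lemma elliptic_K_ge_half_pi:
  assumes "0 \<le> x" "x < 1"
  shows "pi / 2 \<le> elliptic_K x"
proof (rule has_integral_le[OF has_integral_inverse_sqrt K_integrand_has_integral[OF assms]])
  fix t :: real assume t: "t \<in> {0..1}"
  show "1 / sqrt (1 - t\<^sup>2) \<le> K_integrand x t"
  proof (cases "t = 1")
    case False
    then have "0 < 1 - t\<^sup>2" using t square_lt_1[of t] by auto
    then show ?thesis unfolding K_integrand_def
      using modulus_factor_bounds[OF assms t]
      by (intro divide_left_mono) (auto intro!: mult_left_le)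
  qed (simp add: K_integrand_def)
qed

text \<open>
The singular part of the integrand is \<open>t * K_integrand x t\<close>, which has an elementary antiderivative; the rest
is at most \<open>1\<close>. The coefficient \<open>1 / x\<close> of the logarithm tends to \<open>1\<close> as \<open>x\<close> does, and this is what makes the
limit in \<open>K_ratio_le_via_landen_orbit\<close> sharp.
\<close>
lemma elliptic_K_le_log:
  assumes "0 < x" "x < 1"
  shows "elliptic_K x \<le> 1 + (ln 2 - ln (sqrt (1 - x\<^sup>2))) / x"
proof -
  define G where "G t = - ln (x * sqrt (1 - t\<^sup>2) + sqrt (1 - x\<^sup>2 * t\<^sup>2)) / x" for t
  have pos: "0 < x * sqrt (1 - t\<^sup>2) + sqrt (1 - x\<^sup>2 * t\<^sup>2)" if "t \<in> {0..1}" for t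
    using modulus_factor_bounds(3)[of x t] that assms
    by (intro add_nonneg_pos mult_nonneg_nonneg) (auto simp: abs_square_le_1)
  have "((\<lambda>t. t * K_integrand x t) has_integral G 1 - G 0) {0..1}"
  proof (rule fundamental_theorem_of_calculus_interior)
    show "continuous_on {0..1} G" unfolding G_def
      using pos assms by (intro continuous_intros) force+
    fix t :: real assume t: "t \<in> {0<..<1}"
    define u v where "u = sqrt (1 - t\<^sup>2)" and "v = sqrt (1 - x\<^sup>2 * t\<^sup>2)"
    have p: "0 < 1 - t\<^sup>2" "0 < 1 - x\<^sup>2 * t\<^sup>2"
      using t square_lt_1[of t] modulus_factor_bounds(3)[of x t] assms by auto
    then have uv: "0 < u" "0 < v" by (auto simp: u_def v_def)
    have du: "((\<lambda>t. sqrt (1 - t\<^sup>2)) has_real_derivative - (t / u)) (at t)"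
      using p unfolding u_def by (auto intro!: derivative_eq_intros simp: field_simps)
    have dv: "((\<lambda>t. sqrt (1 - x\<^sup>2 * t\<^sup>2)) has_real_derivative - (x\<^sup>2 * t / v)) (at t)"
      using p unfolding v_def by (auto intro!: derivative_eq_intros simp: field_simps)
    have "((\<lambda>t. x * sqrt (1 - t\<^sup>2) + sqrt (1 - x\<^sup>2 * t\<^sup>2)) has_real_derivative
        (x * - (t / u) + - (x\<^sup>2 * t / v))) (at t)"
      by (intro DERIV_add DERIV_cmult du dv)
    from DERIV_chain2[where f = ln and g = "\<lambda>t. x * sqrt (1 - t\<^sup>2) + sqrt (1 - x\<^sup>2 * t\<^sup>2)",
        OF DERIV_ln_divide this] pos[of t] t
    have "((\<lambda>t. ln (x * sqrt (1 - t\<^sup>2) + sqrt (1 - x\<^sup>2 * t\<^sup>2))) has_real_derivative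
        (x * - (t / u) + - (x\<^sup>2 * t / v)) / (x * u + v)) (at t)"
      by (simp add: u_def v_def)
    then have "(G has_real_derivative - ((x * - (t / u) + - (x\<^sup>2 * t / v)) / (x * u + v)) / x) (at t)"
      unfolding G_def by (intro DERIV_cdivide DERIV_minus)
    moreover have "- ((x * - (t / u) + - (x\<^sup>2 * t / v)) / (x * u + v)) / x = t * K_integrand x t"
    proof -
      have "x * - (t / u) + - (x\<^sup>2 * t / v) = - (x * t / (u * v)) * (x * u + v)"
        using uv by (simp add: field_simps power2_eq_square)
      moreover have "x * u + v > 0" using uv assms by (simp add: add_pos_pos)
      ultimately show ?thesis using assms
        by (simp add: K_integrand_def real_sqrt_mult u_def v_def)
    qed
    ultimately show "(G has_vector_derivative t * K_integrand x t) (at t)"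
      by (simp add: has_real_derivative_iff_has_vector_derivative)
  qed simp
  moreover have "((\<lambda>_::real. 1) has_integral (1::real)) {0..1}"
    using has_integral_const_real[of "1::real" 0 1] by simp
  ultimately have int: "((\<lambda>t. 1 + t * K_integrand x t) has_integral 1 + (G 1 - G 0)) {0..1}"
    by (intro has_integral_add)
  have "elliptic_K x \<le> 1 + (G 1 - G 0)"
  proof (rule has_integral_le[OF K_integrand_has_integral int])
    fix t :: real assume t: "t \<in> {0..1}"
    \<comment> \<open>Both factors under the root are at least \<open>1 - t\<close>.\<close>
    have "(1 - t) * K_integrand x t \<le> 1"
    proof (cases "t = 1")
      case False
      with t have t1: "0 \<le> t" "t < 1" by auto
      have xt: "x * t \<le> t" using assms t by (simp add: mult_left_le_one_le)
      have "(1 - t)\<^sup>2 \<le> (1 - t\<^sup>2) * (1 - x\<^sup>2 * t\<^sup>2)"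
      proof -
        have "(1 - t) * (1 - t) \<le> (1 - t\<^sup>2) * (1 - x\<^sup>2 * t\<^sup>2)"
        proof (rule mult_mono)
          have "t * t \<le> t * 1" using t by (intro mult_left_mono) auto
          then show "1 - t \<le> 1 - t\<^sup>2" by (simp add: power2_eq_square)
          have "(x * t) * (x * t) \<le> t * 1" using t xt assms by (intro mult_mono) auto
          then show "1 - t \<le> 1 - x\<^sup>2 * t\<^sup>2" by (simp add: power2_eq_square mult_ac)
        qed (use t1 square_lt_1[of t] in auto)
        then show ?thesis by (simp add: power2_eq_square)
      qed
      then have "1 - t \<le> sqrt ((1 - t\<^sup>2) * (1 - x\<^sup>2 * t\<^sup>2))"
        by (rule real_le_rsqrt)
      moreover from this have "0 < sqrt ((1 - t\<^sup>2) * (1 - x\<^sup>2 * t\<^sup>2))" using t1 by linarith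
      ultimately show ?thesis by (simp add: K_integrand_def)
    qed simp
    then show "K_integrand x t \<le> 1 + t * K_integrand x t" by (simp add: algebra_simps)
  qed (use assms in auto)
  also have "G 1 - G 0 = (ln (1 + x) - ln (sqrt (1 - x\<^sup>2))) / x"
    by (simp add: G_def add.commute diff_divide_distrib)
  also have "\<dots> \<le> (ln 2 - ln (sqrt (1 - x\<^sup>2))) / x"
    using assms by (intro divide_right_mono) auto
  finally show ?thesis by simp
qed

text \<open>
Gauss's substitution \<open>t = (1 + k) s / (1 + k s\<^sup>2)\<close> is an increasing bijection of the unit interval that
turns \<open>1 - t\<^sup>2\<close> into a multiple of \<open>(1 - s\<^sup>2) (1 - k\<^sup>2 s\<^sup>2)\<close> and \<open>1 - m\<^sup>2 t\<^sup>2\<close> into a perfect square, where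
\<open>m = 2 sqrt k / (1 + k)\<close>.
\<close>
lemma elliptic_K_landen:
  assumes k: "0 < k" "k < 1"
  shows "elliptic_K (2 * sqrt k / (1 + k)) = (1 + k) * elliptic_K k"
proof -
  define m where "m = 2 * sqrt k / (1 + k)"
  define g where "g s = (1 + k) * s / (1 + k * s\<^sup>2)" for s
  define g' where "g' s = (1 + k) * (1 - k * s\<^sup>2) / (1 + k * s\<^sup>2)\<^sup>2" for s
  have ks: "0 < 1 + k * s\<^sup>2" for s
    using k by (intro add_pos_nonneg) auto
  have der: "(g has_real_derivative g' s) (at s within S)" for s S
    unfolding g_def g'_def using ks[of s]
    by (auto intro!: derivative_eq_intros simp: field_simps power2_eq_square)
  have m2: "m\<^sup>2 = 4 * k / (1 + k)\<^sup>2"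
    using k by (simp add: m_def power_divide power_mult_distrib)
  have m: "0 \<le> m" "m < 1"
  proof -
    show "0 \<le> m" using k by (simp add: m_def)
    have "(1 - sqrt k)\<^sup>2 > 0" using k by (simp add: real_sqrt_eq_1_iff)
    then have "2 * sqrt k < 1 + k" using k by (simp add: power2_diff)
    then show "m < 1" using k by (simp add: m_def)
  qed
  have g'pos: "0 < g' s" if "s \<in> {0..1}" for s
    using modulus_factor_bounds(3)[of "sqrt k" s] that k ks[of s] by (simp add: g'_def)
  have sub: "\<bar>g' s\<bar> * K_integrand m (g s) = (1 + k) * K_integrand k s" if s: "s \<in> {0<..<1}" for s
  proof -
    have p: "0 < 1 - s\<^sup>2" "0 < 1 - k\<^sup>2 * s\<^sup>2" "0 < 1 - k * s\<^sup>2"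
      using s k square_lt_1[of s] modulus_factor_bounds(3)[of k s]
        modulus_factor_bounds(3)[of "sqrt k" s] by auto
    define D where "D = 1 + k * s\<^sup>2"
    have D: "0 < D" using ks by (simp add: D_def)
    have e1: "1 - (g s)\<^sup>2 = (1 - s\<^sup>2) * (1 - k\<^sup>2 * s\<^sup>2) / D\<^sup>2"
    proof -
      have "1 - (g s)\<^sup>2 = (D\<^sup>2 - ((1 + k) * s)\<^sup>2) / D\<^sup>2"
        using D by (simp add: g_def D_def[symmetric] power_divide diff_divide_distrib)
      also have "D\<^sup>2 - ((1 + k) * s)\<^sup>2 = (1 - s\<^sup>2) * (1 - k\<^sup>2 * s\<^sup>2)"
        unfolding D_def by (simp add: power2_eq_square algebra_simps)
      finally show ?thesis .
    qed
    have e2: "1 - m\<^sup>2 * (g s)\<^sup>2 = (1 - k * s\<^sup>2)\<^sup>2 / D\<^sup>2"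
    proof -
      have "m\<^sup>2 * (g s)\<^sup>2 = 4 * k * s\<^sup>2 / D\<^sup>2"
        using k by (simp add: m2 g_def D_def[symmetric] power_divide power_mult_distrib)
      then have "1 - m\<^sup>2 * (g s)\<^sup>2 = (D\<^sup>2 - 4 * k * s\<^sup>2) / D\<^sup>2"
        using D by (simp add: diff_divide_distrib)
      also have "D\<^sup>2 - 4 * k * s\<^sup>2 = (1 - k * s\<^sup>2)\<^sup>2"
        unfolding D_def by (simp add: power2_eq_square algebra_simps)
      finally show ?thesis .
    qed
    have "(1 - (g s)\<^sup>2) * (1 - m\<^sup>2 * (g s)\<^sup>2)
        = ((1 - s\<^sup>2) * (1 - k\<^sup>2 * s\<^sup>2)) * ((1 - k * s\<^sup>2) / D\<^sup>2)\<^sup>2"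
      unfolding e1 e2 by (simp add: power_divide power2_eq_square)
    then have "sqrt ((1 - (g s)\<^sup>2) * (1 - m\<^sup>2 * (g s)\<^sup>2))
        = sqrt ((1 - s\<^sup>2) * (1 - k\<^sup>2 * s\<^sup>2)) * ((1 - k * s\<^sup>2) / D\<^sup>2)"
      using p by (simp only: real_sqrt_mult real_sqrt_abs) simp
    moreover have "g' s = (1 + k) * ((1 - k * s\<^sup>2) / D\<^sup>2)"
      by (simp add: g'_def D_def)
    moreover have "0 < (1 - k * s\<^sup>2) / D\<^sup>2" using p D by simp
    moreover have "\<bar>g' s\<bar> = g' s" using g'pos[of s] s by simp
    ultimately have eqs: "sqrt ((1 - (g s)\<^sup>2) * (1 - m\<^sup>2 * (g s)\<^sup>2))
        = sqrt ((1 - s\<^sup>2) * (1 - k\<^sup>2 * s\<^sup>2)) * E" "\<bar>g' s\<bar> = (1 + k) * E" "0 < E"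
      if "E = (1 - k * s\<^sup>2) / D\<^sup>2" for E
      unfolding that by metis+
    obtain E where E: "E = (1 - k * s\<^sup>2) / D\<^sup>2" by blast
    show ?thesis using eqs(3)[OF E] unfolding K_integrand_def eqs(1,2)[OF E] by simp
  qed
  have mono: "g s < g t" if "0 \<le> s" "s < t" "t \<le> 1" for s t
    using that g'pos by (intro DERIV_pos_imp_increasing[OF that(2)]) (force intro: der)+
  \<comment> \<open>The change of variables is made on the open interval; the endpoints have measure zero.\<close>
  have img: "g ` {0<..<1} = {0<..<1}"
  proof -
    have g01: "g 0 = 0" "g 1 = 1" using k by (auto simp: g_def)
    have cont: "continuous_on {0..1} g"
      by (rule DERIV_continuous_on[OF der])
    have "y \<in> g ` {0<..<1}" if "y \<in> {0<..<1}" for y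
    proof -
      have "\<exists>s\<ge>0. s \<le> 1 \<and> g s = y"
        by (rule IVT') (use that g01 cont in auto)
      then obtain s where "0 \<le> s" "s \<le> 1" "g s = y" by blast
      then show ?thesis using that g01 by (cases "s = 0 \<or> s = 1") (auto simp: image_def)
    qed
    moreover have "g s \<in> {0<..<1}" if "s \<in> {0<..<1}" for s
      using mono[of 0 s] mono[of s 1] that g01 by auto
    ultimately show ?thesis by blast
  qed
  have inj: "inj_on g {0<..<1}"
  proof (rule linorder_inj_onI)
    show "g x \<noteq> g y" if "x < y" "x \<in> {0<..<1}" "y \<in> {0<..<1}" for x y
      using mono[of x y] that by auto
  qed auto
  have open_int: "integral {0<..<1} f = integral {0..1} f" for f :: "real \<Rightarrow> real"
    by (simp add: integral_open_interval_real)
  have "K_integrand m absolutely_integrable_on g ` {0<..<1} \<and>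
      integral (g ` {0<..<1}) (K_integrand m) = integral {0<..<1} (K_integrand m)"
    unfolding img using K_integrand_abs_integrable[OF m] by (auto intro: set_integrable_subset)
  then have "(\<lambda>s. \<bar>g' s\<bar> * K_integrand m (g s)) absolutely_integrable_on {0<..<1} \<and>
      integral {0<..<1} (\<lambda>s. \<bar>g' s\<bar> * K_integrand m (g s)) = integral {0<..<1} (K_integrand m)"
    by (rule has_absolute_integral_change_of_variables_1'[THEN iffD2, rotated -1]) (simp_all add: der inj)
  then have "integral {0<..<1} (\<lambda>s. \<bar>g' s\<bar> * K_integrand m (g s)) = integral {0<..<1} (K_integrand m)"
    by simp
  moreover have "integral {0<..<1} (\<lambda>s. \<bar>g' s\<bar> * K_integrand m (g s))
      = integral {0<..<1} (\<lambda>s. (1 + k) * K_integrand k s)"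
    using sub by (intro integral_cong) auto
  ultimately have "integral {0<..<1} (K_integrand m) = integral {0<..<1} (\<lambda>s. (1 + k) * K_integrand k s)"
    by simp
  then have "integral {0..1} (K_integrand m) = (1 + k) * integral {0..1} (K_integrand k)"
    by (simp add: open_int)
  then show ?thesis
    by (simp add: elliptic_K_def K_integrand_def[abs_def] m_def)
qed

section \<open>The quotient of complementary elliptic integrals\<close>

text \<open>
In terms of the Groetzsch ring function, \<open>pi * K_ratio x = pi\<^sup>2 / (2 * groetzsch_mu x)\<close>.
\<close>
definition K_ratio :: "real \<Rightarrow> real" where
  "K_ratio x = elliptic_K x / elliptic_K (sqrt (1 - x\<^sup>2))"

text \<open>
The ascent \<open>k \<mapsto> 2 sqrt k / (1 + k)\<close> multiplies \<open>K\<close> by \<open>1 + k\<close>. On the complementary moduli it acts as the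
descent to \<open>h = (1 - k) / (1 + k)\<close>, which the same ascent undoes, so that \<open>K\<close> is divided by
\<open>1 + h = 2 / (1 + k)\<close> there. The two factors combine to \<open>2\<close>.
\<close>
lemma K_ratio_landen:
  assumes k: "0 < k" "k < 1"
  shows "K_ratio (2 * sqrt k / (1 + k)) = 2 * K_ratio k"
proof -
  define k' where "k' = sqrt (1 - k\<^sup>2)"
  define h where "h = (1 - k) / (1 + k)"
  \<comment> \<open>The complement of the new modulus is \<open>h\<close>, and the ascent of \<open>h\<close> is the complement of \<open>k\<close>.\<close>
  have h: "0 < h" "h < 1" using k by (auto simp: h_def)
  have h1: "1 + h = 2 / (1 + k)" using k by (simp add: h_def field_simps)
  have "sqrt (1 - (2 * sqrt k / (1 + k))\<^sup>2) = h"
  proof -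
    have "1 - (2 * sqrt k / (1 + k))\<^sup>2 = ((1 + k)\<^sup>2 - 4 * k) / (1 + k)\<^sup>2"
      using k by (simp add: power_divide power_mult_distrib diff_divide_distrib)
    also have "(1 + k)\<^sup>2 - 4 * k = (1 - k)\<^sup>2" by (simp add: power2_eq_square algebra_simps)
    finally have "1 - (2 * sqrt k / (1 + k))\<^sup>2 = h\<^sup>2" by (simp add: h_def power_divide)
    then show ?thesis using h by simp
  qed
  moreover have "2 * sqrt h / (1 + h) = k'"
  proof -
    have "2 * sqrt h / (1 + h) = (1 + k) * sqrt h" using k unfolding h1 by simp
    also have "\<dots> = sqrt ((1 + k)\<^sup>2 * h)" using k by (simp add: real_sqrt_mult)
    also have "(1 + k)\<^sup>2 * h = (1 + k) * (1 - k)" using k by (simp add: h_def power2_eq_square)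
    also have "\<dots> = 1 - k\<^sup>2" by (simp add: power2_eq_square algebra_simps)
    finally show ?thesis by (simp add: k'_def)
  qed
  moreover from this have "elliptic_K k' = 2 / (1 + k) * elliptic_K h" 
    using elliptic_K_landen[OF h] unfolding h1 by metis
  ultimately show ?thesis
    using elliptic_K_landen[OF k] k
    unfolding K_ratio_def k'_def[symmetric] by simp
qed

text \<open>
Each step doubles \<open>K_ratio\<close>, so \<open>K_ratio (k 0)\<close> is \<open>K_ratio (k (Suc n)) / 2 ^ Suc n\<close>. There the denominator of
\<open>K_ratio\<close> is at least \<open>pi / 2\<close> and the numerator is at most \<open>1 + (ln 2 - ln c - 2 ^ n * ln q) / k (Suc n)\<close>,
by \<open>elliptic_K_le_log\<close>. In the limit only the term with \<open>2 ^ n * ln q\<close> survives.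
\<close>
lemma K_ratio_le_via_landen_orbit:
  assumes q: "0 < q" "q < (1::real)" and c: "0 < c"
    and k: "\<And>n. 0 < k n" "\<And>n. k n < 1"
    and step: "\<And>n. k (Suc n) = 2 * sqrt (k n) / (1 + k n)"
    and compl: "\<And>n. c * q ^ 2 ^ n \<le> sqrt (1 - (k (Suc n))\<^sup>2)"
    and lim: "k \<longlonglongrightarrow> 1"
  shows "pi * K_ratio (k 0) \<le> - ln q"
proof -
  have ratio: "K_ratio (k n) = 2 ^ n * K_ratio (k 0)" for n
    by (induction n) (simp_all add: step K_ratio_landen[OF k])
  define E where "E n = (1 + (ln 2 - ln c - 2 ^ n * ln q) / k (Suc n)) / 2 ^ n / pi" for n
  have bound: "K_ratio (k 0) \<le> E n" for n
  proof -
    define x where "x = k (Suc n)"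
    have x: "0 < x" "x < 1" using k by (auto simp: x_def)
    have x1: "0 < 1 - x\<^sup>2" using square_lt_1[of x] x by simp
    have y: "0 \<le> sqrt (1 - x\<^sup>2)" "sqrt (1 - x\<^sup>2) < 1" using x x1 by auto
    have "ln c + 2 ^ n * ln q = ln (c * q ^ 2 ^ n)" 
      using c q by (simp add: ln_mult ln_realpow)
    also have "\<dots> \<le> ln (sqrt (1 - x\<^sup>2))"
      using compl[of n] c q by (intro ln_mono) (auto simp: x_def)
    finally have "(ln 2 - ln (sqrt (1 - x\<^sup>2))) / x \<le> (ln 2 - ln c - 2 ^ n * ln q) / x"
      using x by (intro divide_right_mono) auto
    then have "elliptic_K x \<le> 1 + (ln 2 - ln c - 2 ^ n * ln q) / x"
      using elliptic_K_le_log[OF x] by linarith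
    moreover have "K_ratio x * elliptic_K (sqrt (1 - x\<^sup>2)) = elliptic_K x"
    proof -
      have "elliptic_K (sqrt (1 - x\<^sup>2)) \<noteq> 0"
        using elliptic_K_ge_half_pi[OF y] pi_gt_zero by linarith
      then show ?thesis by (simp add: K_ratio_def)
    qed
    moreover have "K_ratio x * (pi / 2) \<le> K_ratio x * elliptic_K (sqrt (1 - x\<^sup>2))"
    proof (rule mult_left_mono[OF elliptic_K_ge_half_pi[OF y]])
      show "0 \<le> K_ratio x" unfolding K_ratio_def
        using elliptic_K_ge_half_pi[OF y] elliptic_K_ge_half_pi[of x] x pi_gt_zero
        by (intro divide_nonneg_nonneg) linarith+
    qed
    ultimately have "K_ratio x * (pi / 2) \<le> 1 + (ln 2 - ln c - 2 ^ n * ln q) / x" by linarith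
    then have "2 ^ n * K_ratio (k 0) * pi \<le> 1 + (ln 2 - ln c - 2 ^ n * ln q) / x"
      by (simp add: x_def ratio[of "Suc n"])
    then show ?thesis by (simp add: E_def x_def pos_le_divide_eq mult_ac)
  qed
  \<comment> \<open>The sequence \<open>E\<close>, with the division by \<open>2 ^ n\<close> carried out.\<close>
  have "(\<lambda>n. ((1/2) ^ n + ((ln 2 - ln c) * (1/2) ^ n - ln q) / k (Suc n)) / pi) \<longlonglongrightarrow> (0 + ((ln 2 - ln c) * 0 - ln q) / 1) / pi"
    by (intro tendsto_intros LIMSEQ_Suc[OF lim] LIMSEQ_realpow_zero) auto
  moreover have "(\<lambda>n. ((1/2) ^ n + ((ln 2 - ln c) * (1/2) ^ n - ln q) / k (Suc n)) / pi) = E"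
  proof
    fix n show "((1/2) ^ n + ((ln 2 - ln c) * (1/2) ^ n - ln q) / k (Suc n)) / pi = E n"
      by (simp add: E_def power_one_over add_divide_distrib diff_divide_distrib mult_ac)
  qed
  ultimately have "E \<longlonglongrightarrow> - ln q / pi" by simp
  then have "K_ratio (k 0) \<le> - ln q / pi"
    by (rule LIMSEQ_le_const) (use bound in auto)
  then show ?thesis using pi_gt_zero by (simp add: pos_le_minus_divide_eq mult.commute)
qed

section \<open>Theta series\<close>

lemma summable_on_int_split:
  fixes f :: "int \<Rightarrow> real"
  assumes "\<And>n. 0 \<le> f n" "summable (\<lambda>n. f (int n))" "summable (\<lambda>n. f (- int n))"
  shows "f summable_on UNIV"
proof -
  have "f summable_on range int" "f summable_on range (\<lambda>n. - int n)"
    using assms by (auto simp: summable_on_reindex inj_def o_def summable_on_UNIV_nonneg_real_iff)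
  then have "f summable_on (range int \<union> range (\<lambda>n. - int n))" by (rule summable_on_union)
  moreover have "range int \<union> range (\<lambda>n. - int n) = UNIV"
    by (auto simp: image_iff) (metis int_cases2)
  ultimately show ?thesis by simp
qed

definition theta_term :: "real \<Rightarrow> complex \<Rightarrow> int \<Rightarrow> complex" where
  "theta_term q z n = of_real (q powi n\<^sup>2) * z powi n"

text \<open>
Jacobi's \<open>\<theta>\<^sub>3\<close> in the variable \<open>z = exp (2 i v)\<close>; the value at \<open>-z\<close> is \<open>\<theta>\<^sub>4\<close>. Shifting by half a period
shows that \<open>\<theta>\<^sub>1\<close> and \<open>\<theta>\<^sub>2\<close> are the values at \<open>-q z\<close> and \<open>q z\<close> up to elementary factors, so this one series
serves for all four functions.
\<close>
definition theta :: "real \<Rightarrow> complex \<Rightarrow> complex" where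
  "theta q z = (\<Sum>\<^sub>\<infinity>n. theta_term q z n)"

lemma gaussian_power_summable:
  assumes "0 \<le> q" "q < 1" "0 < (r::real)"
  shows "summable (\<lambda>n. q ^ n\<^sup>2 * r ^ n)"
proof -
  have "(\<lambda>n. q ^ n * r) \<longlonglongrightarrow> 0 * r"
    using assms by (intro tendsto_intros LIMSEQ_realpow_zero) auto
  then have "eventually (\<lambda>n. q ^ n * r < 1 / 2) sequentially"
    by (rule order_tendstoD) simp
  then have "eventually (\<lambda>n. norm (q ^ n\<^sup>2 * r ^ n) \<le> (1 / 2) ^ n) sequentially"
  proof eventually_elim
    case (elim n)
    have "q ^ n\<^sup>2 * r ^ n = (q ^ n * r) ^ n"
      by (simp add: power_mult_distrib power2_eq_square power_mult)
    also have "\<dots> \<le> (1 / 2) ^ n" using elim assms by (intro power_mono) auto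
    finally show ?case using assms by (simp add: abs_mult)
  qed
  then show ?thesis
    by (rule summable_comparison_test_ev) (simp add: summable_geometric)
qed

lemma norm_theta_term: "0 \<le> q \<Longrightarrow> norm (theta_term q z n) = q powi n\<^sup>2 * norm z powi n"
  by (simp add: theta_term_def norm_mult norm_power_int)

lemma theta_term_abs_summable:
  assumes q: "0 \<le> q" "q < 1" and z: "z \<noteq> 0"
  shows "(\<lambda>n. norm (theta_term q z n)) summable_on UNIV"
proof (rule summable_on_int_split)
  have e: "q powi (int n)\<^sup>2 = q ^ n\<^sup>2" for n
    by (metis of_nat_power power_int_of_nat)
  show "summable (\<lambda>n. norm (theta_term q z (int n)))"
    using gaussian_power_summable[OF q, of "norm z"] q z by (simp add: norm_theta_term e)
  have "norm z powi - int n = inverse (norm z) ^ n" for n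
    by (simp add: power_int_minus power_inverse)
  then show "summable (\<lambda>n. norm (theta_term q z (- int n)))"
    using gaussian_power_summable[OF q, of "inverse (norm z)"] q z by (simp add: norm_theta_term e)
qed auto

lemma theta_term_summable:
  assumes "0 \<le> q" "q < 1" "z \<noteq> 0"
  shows "theta_term q z summable_on UNIV"
  using theta_term_abs_summable[OF assms] by (rule Infinite_Sum.abs_summable_summable)

lemma has_sum_theta:
  assumes "0 \<le> q" "q < 1" "z \<noteq> 0"
  shows "(theta_term q z has_sum theta q z) UNIV"
  unfolding theta_def using theta_term_summable[OF assms] by (rule has_sum_infsum)

lemma has_sum_product:
  fixes f :: "'a \<Rightarrow> complex" and g :: "'b \<Rightarrow> complex"
  assumes f: "(\<lambda>x. norm (f x)) summable_on UNIV" and g: "(\<lambda>x. norm (g x)) summable_on UNIV"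
  shows "((\<lambda>(x, y). f x * g y) has_sum (infsum f UNIV * infsum g UNIV)) UNIV"
proof -
  have "(\<lambda>p. norm ((\<lambda>(x, y). f x * g y) p)) summable_on UNIV \<times> UNIV"
    by (rule Infinite_Sum.abs_summable_on_Sigma_iff[THEN iffD2])
       (use f g in \<open>auto simp: norm_mult abs_mult infsum_cmult_right' intro: summable_on_cmult_right summable_on_cmult_left\<close>)
  then have s: "(\<lambda>(x, y). f x * g y) summable_on UNIV \<times> UNIV"
    by (rule Infinite_Sum.abs_summable_summable)
  have "infsum (\<lambda>(x, y). f x * g y) (UNIV \<times> UNIV) = infsum f UNIV * infsum g UNIV"
    by (subst infsum_Sigma'_banach[symmetric, OF s]) (simp add: infsum_cmult_right' infsum_cmult_left')
  with s show ?thesis by (metis UNIV_Times_UNIV has_sum_infsum)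
qed

lemma theta_product_term_even:
  assumes q: "0 < q" and xy: "x \<noteq> 0" "y \<noteq> 0"
  shows "theta_term q x (j + k) * theta_term q y (j - k)
       = theta_term (q\<^sup>2) (x * y) j * theta_term (q\<^sup>2) (x / y) k"
proof -
  have "q powi (j + k)\<^sup>2 * q powi (j - k)\<^sup>2 = q\<^sup>2 powi j\<^sup>2 * q\<^sup>2 powi k\<^sup>2"
  proof -
    have "q\<^sup>2 powi j\<^sup>2 * q\<^sup>2 powi k\<^sup>2 = q powi (2 * j\<^sup>2 + 2 * k\<^sup>2)"
      using q by (simp add: power_int_power power_int_add)
    also have "2 * j\<^sup>2 + 2 * k\<^sup>2 = (j + k)\<^sup>2 + (j - k)\<^sup>2"
      by (simp add: power2_eq_square algebra_simps)
    finally show ?thesis using power_int_add[of q "(j + k)\<^sup>2" "(j - k)\<^sup>2"] q by simp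
  qed
  moreover have "x powi (j + k) * y powi (j - k) = (x * y) powi j * (x / y) powi k"
    using xy by (simp add: power_int_add power_int_diff power_int_mult_distrib power_int_divide_distrib)
  ultimately have "of_real (q powi (j + k)\<^sup>2 * q powi (j - k)\<^sup>2) * (x powi (j + k) * y powi (j - k))
    = of_real (q\<^sup>2 powi j\<^sup>2 * q\<^sup>2 powi k\<^sup>2) * ((x * y) powi j * (x / y) powi k)"
    by simp
  then show ?thesis unfolding theta_term_def of_real_mult by (simp only: mult_ac)
qed

lemma theta_product_term_odd:
  assumes q: "0 < q" and xy: "x \<noteq> 0" "y \<noteq> 0"
  shows "theta_term q x (j + k + 1) * theta_term q y (j - k)
       = q * x * (theta_term (q\<^sup>2) (q\<^sup>2 * (x * y)) j * theta_term (q\<^sup>2) (q\<^sup>2 * (x / y)) k)"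
proof -
  have "q powi (j + k + 1)\<^sup>2 * q powi (j - k)\<^sup>2
      = q * (q\<^sup>2 powi j\<^sup>2 * q\<^sup>2 powi k\<^sup>2) * (q\<^sup>2 powi j * q\<^sup>2 powi k)"
  proof -
    have "q * (q\<^sup>2 powi j\<^sup>2 * q\<^sup>2 powi k\<^sup>2) * (q\<^sup>2 powi j * q\<^sup>2 powi k)
       = q powi 1 * q powi (2 * j\<^sup>2) * q powi (2 * k\<^sup>2) * q powi (2 * j) * q powi (2 * k)"
      by (simp add: power_int_power)
    also have "\<dots> = q powi (1 + 2 * j\<^sup>2 + 2 * k\<^sup>2 + 2 * j + 2 * k)"
      using q by (simp add: power_int_add)
    also have "1 + 2 * j\<^sup>2 + 2 * k\<^sup>2 + 2 * j + 2 * k = (j + k + 1)\<^sup>2 + (j - k)\<^sup>2"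
      by (simp add: power2_eq_square algebra_simps)
    finally show ?thesis using power_int_add[of q "(j + k + 1)\<^sup>2" "(j - k)\<^sup>2"] q by simp
  qed
  moreover have "x powi (j + k + 1) * y powi (j - k) = x * ((x * y) powi j * (x / y) powi k)"
    using xy by (simp add: power_int_add power_int_diff power_int_mult_distrib power_int_divide_distrib)
  ultimately have "of_real (q powi (j + k + 1)\<^sup>2 * q powi (j - k)\<^sup>2) * (x powi (j + k + 1) * y powi (j - k))
    = of_real (q * (q\<^sup>2 powi j\<^sup>2 * q\<^sup>2 powi k\<^sup>2) * (q\<^sup>2 powi j * q\<^sup>2 powi k)) * (x * ((x * y) powi j * (x / y) powi k))"
    by simp
  then show ?thesis
    unfolding theta_term_def power_int_mult_distrib of_real_mult of_real_power_int of_real_power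
    by (simp only: mult_ac)
qed

text \<open>
The double series over \<open>(n, m)\<close> is split by the parity of \<open>n + m\<close>. Writing \<open>(n, m) = (j + k, j - k)\<close> on the even
part and \<open>(n, m) = (j + k + 1, j - k)\<close> on the odd part makes \<open>n\<^sup>2 + m\<^sup>2\<close> a sum of a function of \<open>j\<close> and a
function of \<open>k\<close>, with leading terms \<open>2 j\<^sup>2 + 2 k\<^sup>2\<close>, so that both parts factor into series of nome \<open>q\<^sup>2\<close>.
\<close>
lemma theta_product:
  assumes q: "0 < q" "q < 1" and Q: "Q = q\<^sup>2" and xy: "x \<noteq> 0" "y \<noteq> 0"
  shows "theta q x * theta q y = theta Q (x * y) * theta Q (x / y)
       + q * x * (theta Q (Q * (x * y)) * theta Q (Q * (x / y)))"
proof -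
  define F where "F = (\<lambda>(n, m). theta_term q x n * theta_term q y m)"
  define E where "E = range (\<lambda>(j, k). (j + k, j - k :: int))"
  define odd_pairs where "odd_pairs = range (\<lambda>(j, k). (j + k + 1, j - k :: int))"
  have q2: "0 < q\<^sup>2" "q\<^sup>2 < 1" using q by (auto simp: abs_square_less_1)
  have S: "(F has_sum (theta q x * theta q y)) UNIV"
    unfolding F_def theta_def using q xy by (intro has_sum_product theta_term_abs_summable) auto
  have inj: "inj (\<lambda>(j, k). (j + k, j - k :: int))" "inj (\<lambda>(j, k). (j + k + 1, j - k :: int))"
    by (auto simp: inj_def)
  have "((\<lambda>(j, k). theta_term (q\<^sup>2) (x * y) j * theta_term (q\<^sup>2) (x / y) k) has_sum
      (theta (q\<^sup>2) (x * y) * theta (q\<^sup>2) (x / y))) UNIV"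
    unfolding theta_def using q2 xy by (intro has_sum_product theta_term_abs_summable) auto
  then have SE: "(F has_sum (theta (q\<^sup>2) (x * y) * theta (q\<^sup>2) (x / y))) E"
    unfolding E_def has_sum_reindex[OF inj(1)]
    by (rule has_sum_cong[THEN iffD1, rotated])
       (auto simp: F_def theta_product_term_even[OF q(1) xy])
  have "((\<lambda>p. (q * x) * (case p of (j, k) \<Rightarrow> theta_term (q\<^sup>2) (q\<^sup>2 * (x * y)) j * theta_term (q\<^sup>2) (q\<^sup>2 * (x / y)) k))
     has_sum (q * x * (theta (q\<^sup>2) (q\<^sup>2 * (x * y)) * theta (q\<^sup>2) (q\<^sup>2 * (x / y))))) UNIV"
    unfolding theta_def using q2 xy by (intro has_sum_cmult_right has_sum_product theta_term_abs_summable) auto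
  then have SO: "(F has_sum (q * x * (theta (q\<^sup>2) (q\<^sup>2 * (x * y)) * theta (q\<^sup>2) (q\<^sup>2 * (x / y))))) odd_pairs"
    unfolding odd_pairs_def has_sum_reindex[OF inj(2)]
    by (rule has_sum_cong[THEN iffD1, rotated])
       (auto simp: F_def theta_product_term_odd[OF q(1) xy])
  have "E \<inter> odd_pairs = {}"
  proof -
    have "even (n + m)" if "(n, m) \<in> E" for n m using that by (auto simp: E_def)
    moreover have "odd (n + m)" if "(n, m) \<in> odd_pairs" for n m using that by (auto simp: odd_pairs_def)
    ultimately show ?thesis by fastforce
  qed
  moreover have "E \<union> odd_pairs = UNIV"
  proof -
    have "(n, m) \<in> E \<union> odd_pairs" for n m
    proof (cases "even (n + m)")
      case True
      then obtain j where "n + m = 2 * j" by (elim evenE)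
      then have "(n, m) = (\<lambda>(j, k). (j + k, j - k)) (j, n - j)" by auto
      then show ?thesis unfolding E_def by blast
    next
      case False
      then obtain j where "n + m = 2 * j + 1" by (elim oddE)
      then have "(n, m) = (\<lambda>(j, k). (j + k + 1, j - k)) (j, j - m)" by auto
      then show ?thesis unfolding odd_pairs_def by blast
    qed
    then show ?thesis by auto
  qed
  ultimately have "(F has_sum (theta (q\<^sup>2) (x * y) * theta (q\<^sup>2) (x / y)
       + q * x * (theta (q\<^sup>2) (q\<^sup>2 * (x * y)) * theta (q\<^sup>2) (q\<^sup>2 * (x / y))))) UNIV"
    using has_sum_Un_disjoint[OF SE SO] by simp
  from has_sum_unique[OF S this] show ?thesis by (simp add: Q)
qed

lemma theta_continuous:
  assumes "r < 1"
  shows "continuous_on ({0..r} \<times> sphere 0 1) (\<lambda>(q, z). theta q z)"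
proof (cases "0 \<le> r")
  case True
  have "uniform_limit ({0..r} \<times> sphere 0 1)
      (\<lambda>X p. \<Sum>n\<in>X. theta_term (fst p) (snd p) n) (\<lambda>p. \<Sum>\<^sub>\<infinity>n\<in>UNIV. theta_term (fst p) (snd p) n)
      (finite_subsets_at_top UNIV)"
  proof (rule Weierstrass_m_test_general)
    show "norm (theta_term (fst p) (snd p) n) \<le> norm (theta_term r 1 n)" if "p \<in> {0..r} \<times> sphere 0 1" for n p
      using that True by (auto simp: norm_theta_term intro!: power_int_mono)
    show "(\<lambda>n. norm (theta_term r 1 n)) summable_on UNIV"
      by (intro theta_term_abs_summable) (use assms True in auto)
  qed
  moreover have "continuous_on ({0..r} \<times> sphere 0 1) (\<lambda>p. \<Sum>n\<in>X. theta_term (fst p) (snd p) n)" for X :: "int set"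
    unfolding theta_term_def power_int_nonneg_exp[OF zero_le_power2]
    by (intro continuous_intros) auto
  ultimately have "continuous_on ({0..r} \<times> sphere 0 1) (\<lambda>p. \<Sum>\<^sub>\<infinity>n\<in>UNIV. theta_term (fst p) (snd p) n)"
    by (intro uniform_limit_theorem) auto
  then show ?thesis by (simp add: theta_def case_prod_unfold)
qed simp

section \<open>The Jacobi triple product\<close>

text \<open>
The partial products decrease, and summability of \<open>a\<close> keeps their limit away from zero.
\<close>
lemma prod_one_minus_tendsto_pos:
  fixes a :: "nat \<Rightarrow> real"
  assumes a: "\<And>i. 0 \<le> a i" "\<And>i. a i < 1" and s: "summable a"
  obtains L where "0 < L" "(\<lambda>n. \<Prod>i<n. 1 - a i) \<longlonglongrightarrow> L" "\<And>n. L \<le> (\<Prod>i<n. 1 - a i)"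
proof -
  define P where "P n = (\<Prod>i<n. 1 - a i)" for n
  have conv: "convergent_prod (\<lambda>i. 1 + - a i)"
    using a s by (intro summable_imp_convergent_prod_real) (auto simp: less_imp_neq)
  define L where "L = prodinf (\<lambda>i. 1 + - a i)"
  have "(\<lambda>n. \<Prod>i\<le>n. 1 + - a i) \<longlonglongrightarrow> L"
    unfolding L_def by (rule convergent_prod_LIMSEQ[OF conv])
  then have "(\<lambda>n. P (Suc n)) \<longlonglongrightarrow> L"
    by (simp add: P_def lessThan_Suc_atMost del: prod.lessThan_Suc)
  then have lim: "P \<longlonglongrightarrow> L" by (simp add: filterlim_sequentially_Suc)
  have "1 + - a i \<noteq> 0" for i using a(2)[of i] by simp
  then have "L \<noteq> 0" unfolding L_def by (rule prodinf_nonzero[OF conv])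
  have pos: "0 \<le> P n" for n unfolding P_def by (intro prod_nonneg) (use a in \<open>simp add: less_imp_le\<close>)
  have "decseq P"
  proof (rule decseq_SucI)
    show "P (Suc n) \<le> P n" for n
      using pos[of n] a[of n] by (simp add: P_def mult_left_le)
  qed
  then have le: "L \<le> P n" for n using lim by (rule decseq_ge)
  have "0 \<le> L" using lim pos by (intro LIMSEQ_le_const) auto
  then have "0 < L" using \<open>L \<noteq> 0\<close> by simp
  from that[OF this] lim le show ?thesis unfolding P_def by blast
qed

definition jacobi_prod :: "real \<Rightarrow> complex \<Rightarrow> nat \<Rightarrow> complex" where
  "jacobi_prod q z N = (\<Prod>i<N. (1 + of_real (q ^ (2 * i + 1)) * z) * (1 + of_real (q ^ (2 * i + 1)) / z))"

definition q_factorial :: "real \<Rightarrow> nat \<Rightarrow> real" where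
  "q_factorial Q n = (\<Prod>i<n. 1 - Q ^ Suc i)"

text \<open>
Extended by zero to negative arguments, in accordance with the recursion
\<open>inv_q_factorial Q (k - 1) = (1 - Q powi k) * inv_q_factorial Q k\<close>, which then holds for every integer \<open>k\<close>. The
Gaussian binomial coefficients built from it vanish outside their range by themselves.
\<close>
definition inv_q_factorial :: "real \<Rightarrow> int \<Rightarrow> real" where
  "inv_q_factorial Q k = (if 0 \<le> k then 1 / q_factorial Q (nat k) else 0)"

lemma inv_q_factorial_pred:
  assumes Q: "0 < Q" "Q < 1"
  shows "inv_q_factorial Q (k - 1) = (1 - Q powi k) * inv_q_factorial Q k"
proof -
  consider "k < 0" | "k = 0" | n where "k = int (Suc n)"
    by (metis int_cases neg_less_0_iff_less nat_int not0_implies_Suc of_nat_0 of_nat_0_less_iff zero_less_Suc)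
  then show ?thesis
  proof cases
    case 3
    have "1 - Q ^ Suc n \<noteq> 0" using Q power_Suc_less_one[of Q n] by simp
    then show ?thesis 
      using 3 by (simp add: inv_q_factorial_def q_factorial_def nat_add_distrib power_int_def del: power_Suc)
  qed (auto simp: inv_q_factorial_def)
qed

text \<open>
Here \<open>c N m\<close> is the Gaussian binomial coefficient \<open>2N\<close> over \<open>N + m\<close>. With \<open>a = N + 1 - m\<close> and \<open>b = N + 1 + m\<close>, all four
coefficients are multiples of \<open>inv_q_factorial Q a * inv_q_factorial Q b\<close>, and what remains is a polynomial
identity in \<open>A = Q powi a\<close> and \<open>B = Q powi b\<close>, whose product is \<open>Q ^ (2 * N + 2)\<close>.
\<close>
lemma gauss_binomial_step:
  fixes Q :: real
  assumes Q: "0 < Q" "Q < 1"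
  defines "c \<equiv> \<lambda>N m. q_factorial Q (2 * N) * inv_q_factorial Q (int N - m) * inv_q_factorial Q (int N + m)"
  shows "c (Suc N) m = (1 + Q ^ (2 * N + 1)) * c N m
     + Q powi (int N + 1 - m) * c N (m - 1) + Q powi (int N + 1 + m) * c N (m + 1)"
proof -
  define a b where "a = int N + 1 - m" and "b = int N + 1 + m"
  define x y where "x = inv_q_factorial Q a" and "y = inv_q_factorial Q b"
  define A B where "A = Q powi a" and "B = Q powi b"
  note p = inv_q_factorial_pred[OF Q]
  have pa: "inv_q_factorial Q (a - 1) = (1 - A) * x" "inv_q_factorial Q (b - 1) = (1 - B) * y"
    by (simp_all add: p A_def B_def x_def y_def)
  have pa2: "inv_q_factorial Q (a - 2) = (1 - A / Q) * ((1 - A) * x)" 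
            "inv_q_factorial Q (b - 2) = (1 - B / Q) * ((1 - B) * y)"
    using p[of "a - 1"] p[of "b - 1"] pa Q by (simp_all add: A_def B_def power_int_diff)
  have AB: "A * B = Q ^ (2 * N + 2)"
  proof -
    have "A * B = Q powi (a + b)" using Q by (simp add: A_def B_def power_int_add)
    also have "a + b = int (2 * N + 2)" by (simp add: a_def b_def)
    finally show ?thesis by (simp only: power_int_of_nat)
  qed
  have AB1: "Q ^ (2 * N + 1) = A * B / Q" unfolding AB using Q by simp
  have f: "q_factorial Q (2 * Suc N) = q_factorial Q (2 * N) * (1 - A * B / Q) * (1 - A * B)"
    unfolding AB1[symmetric] unfolding AB by (simp add: q_factorial_def)
  have idx: "int N - m = a - 1" "int N + m = b - 1" "int N - (m - 1) = a" "int N + (m - 1) = b - 2"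
    "int N - (m + 1) = a - 2" "int N + (m + 1) = b" "int (Suc N) - m = a" "int (Suc N) + m = b"
    by (simp_all add: a_def b_def)
  have poly: "(1 - A * B / Q) * (1 - A * B) = (1 + A * B / Q) * ((1 - A) * (1 - B))
     + A * ((1 - B / Q) * (1 - B)) + B * ((1 - A / Q) * (1 - A))"
    using Q by (simp add: field_simps)
  show ?thesis
    unfolding c_def idx pa pa2 f AB1 A_def[symmetric] B_def[symmetric] a_def[symmetric] b_def[symmetric]
      x_def[symmetric] y_def[symmetric]
    using arg_cong[OF poly, of "\<lambda>t. q_factorial Q (2 * N) * x * y * t"]
    by (simp only: distrib_left distrib_right mult_ac)
qed

lemma power_int_add_nat:
  fixes q :: real
  assumes "q \<noteq> 0"
  shows "q powi (k + int n) = q powi k * q ^ n"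
  using assms by (simp add: power_int_add)

text \<open>
Both equations compare exponents: \<open>(m - 1)\<^sup>2 + 2N + 1 = m\<^sup>2 + 2 (N + 1 - m)\<close>, and the same with \<open>-m\<close> for \<open>m\<close>.
\<close>
lemma theta_term_shift:
  assumes q: "0 < q" and z: "z \<noteq> 0"
  shows "theta_term q z (m - 1) * (of_real (q ^ (2 * N + 1)) * z) = of_real ((q\<^sup>2) powi (int N + 1 - m)) * theta_term q z m"
    and "theta_term q z (m + 1) * (of_real (q ^ (2 * N + 1)) / z) = of_real ((q\<^sup>2) powi (int N + 1 + m)) * theta_term q z m"
proof -
  have "q powi (m - 1)\<^sup>2 * q ^ (2 * N + 1) = q powi ((m - 1)\<^sup>2 + int (2 * N + 1))"
    using q by (intro power_int_add_nat[symmetric]) simp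
  also have "(m - 1)\<^sup>2 + int (2 * N + 1) = 2 * (int N + 1 - m) + m\<^sup>2"
    by (simp add: power2_eq_square algebra_simps)
  also have "q powi \<dots> = (q\<^sup>2) powi (int N + 1 - m) * q powi m\<^sup>2"
    using q power_int_add[of q "2 * (int N + 1 - m)" "m\<^sup>2"] by (simp add: power_int_power)
  finally have 1: "q powi (m - 1)\<^sup>2 * q ^ (2 * N + 1) = (q\<^sup>2) powi (int N + 1 - m) * q powi m\<^sup>2" .
  have z1: "z powi (m - 1) * z = z powi m" using z by (simp add: power_int_minus_mult)
  show "theta_term q z (m - 1) * (of_real (q ^ (2 * N + 1)) * z) = of_real ((q\<^sup>2) powi (int N + 1 - m)) * theta_term q z m"
    unfolding theta_term_def z1[symmetric]
    using arg_cong[OF 1, of "\<lambda>t. complex_of_real t * (z powi (m - 1) * z)"]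
    unfolding of_real_mult by (simp only: mult_ac)
  have "q powi (m + 1)\<^sup>2 * q ^ (2 * N + 1) = q powi ((m + 1)\<^sup>2 + int (2 * N + 1))"
    using q by (intro power_int_add_nat[symmetric]) simp
  also have "(m + 1)\<^sup>2 + int (2 * N + 1) = 2 * (int N + 1 + m) + m\<^sup>2"
    by (simp add: power2_eq_square algebra_simps)
  also have "q powi \<dots> = (q\<^sup>2) powi (int N + 1 + m) * q powi m\<^sup>2"
    using q power_int_add[of q "2 * (int N + 1 + m)" "m\<^sup>2"] by (simp add: power_int_power)
  finally have 2: "q powi (m + 1)\<^sup>2 * q ^ (2 * N + 1) = (q\<^sup>2) powi (int N + 1 + m) * q powi m\<^sup>2" .
  have z2: "z powi (m + 1) * inverse z = z powi m" using z by (simp add: power_int_add_1)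
  show "theta_term q z (m + 1) * (of_real (q ^ (2 * N + 1)) / z) = of_real ((q\<^sup>2) powi (int N + 1 + m)) * theta_term q z m"
    unfolding theta_term_def z2[symmetric] divide_inverse
    using arg_cong[OF 2, of "\<lambda>t. complex_of_real t * (z powi (m + 1) * inverse z)"]
    unfolding of_real_mult by (simp only: mult_ac)
qed

text \<open>
Multiplying by the next two factors combines the series with its shifts by one in either direction, and
\<open>gauss_binomial_step\<close> collects the coefficients. As these vanish for \<open>|m| > N\<close>, the sum may run over all
integers, where shifting is a bijection.
\<close>
lemma finite_jacobi_triple_product:
  assumes q: "0 < q" "q < 1" and z: "z \<noteq> 0"
  shows "((\<lambda>m. of_real (q_factorial (q\<^sup>2) (2 * N) * inv_q_factorial (q\<^sup>2) (int N - m)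
     * inv_q_factorial (q\<^sup>2) (int N + m)) * theta_term q z m) has_sum jacobi_prod q z N) UNIV"
proof -
  have q2: "0 < q\<^sup>2" "q\<^sup>2 < 1" using q by (auto simp: abs_square_less_1)
  define c where "c = (\<lambda>N m. q_factorial (q\<^sup>2) (2 * N) * inv_q_factorial (q\<^sup>2) (int N - m)
     * inv_q_factorial (q\<^sup>2) (int N + m))"
  have "((\<lambda>m. of_real (c N m) * theta_term q z m) has_sum jacobi_prod q z N) UNIV"
  proof (induction N)
    case 0
    show ?case
      by (rule has_sum_finite_neutralI[where B = "{0}"])
         (auto simp: c_def inv_q_factorial_def q_factorial_def jacobi_prod_def theta_term_def)
  next
    case (Suc N)
    define E where "E = complex_of_real (q ^ (2 * N + 1))"
    define f where "f m = of_real (c N m) * theta_term q z m" for m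
    have f: "(f has_sum jacobi_prod q z N) UNIV" using Suc by (simp add: f_def[abs_def])
    have b: "bij_betw (\<lambda>m. m - 1) UNIV (UNIV :: int set)" "bij_betw (\<lambda>m. m + 1) UNIV (UNIV :: int set)"
      by (intro bij_betwI[where g = "\<lambda>m. m + 1"] bij_betwI[where g = "\<lambda>m. m - 1"]; simp)+
    have f1: "((\<lambda>m. f (m - 1)) has_sum jacobi_prod q z N) UNIV"
     and f2: "((\<lambda>m. f (m + 1)) has_sum jacobi_prod q z N) UNIV"
      using f by (simp_all add: has_sum_reindex_bij_betw[OF b(1)] has_sum_reindex_bij_betw[OF b(2)])
    have "((\<lambda>m. f m * (1 + E\<^sup>2) + f (m - 1) * (E * z) + f (m + 1) * (E / z)) has_sum
        (jacobi_prod q z N * (1 + E\<^sup>2) + jacobi_prod q z N * (E * z) + jacobi_prod q z N * (E / z))) UNIV"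
      by (intro has_sum_add has_sum_cmult_left f f1 f2)
    moreover have "jacobi_prod q z N * (1 + E\<^sup>2) + jacobi_prod q z N * (E * z) + jacobi_prod q z N * (E / z)
       = jacobi_prod q z (Suc N)"
    proof -
      have "(1 + E * z) * (1 + E / z) = (1 + E\<^sup>2) + E * z + E / z"
        using z by (simp add: field_simps power2_eq_square)
      then show ?thesis unfolding jacobi_prod_def prod.lessThan_Suc E_def[symmetric]
        by (simp add: algebra_simps)
    qed
    moreover have "f m * (1 + E\<^sup>2) + f (m - 1) * (E * z) + f (m + 1) * (E / z)
       = of_real (c (Suc N) m) * theta_term q z m" for m
    proof -
      have E2: "1 + E\<^sup>2 = of_real (1 + (q\<^sup>2) ^ (2 * N + 1))"
        unfolding E_def by (simp add: power_mult_distrib power2_eq_square flip: power_mult)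
      have "f (m - 1) * (E * z) = of_real (c N (m - 1)) * (of_real ((q\<^sup>2) powi (int N + 1 - m)) * theta_term q z m)"
        unfolding f_def E_def theta_term_shift(1)[OF q(1) z, symmetric] by (simp only: mult_ac)
      moreover have "f (m + 1) * (E / z) = of_real (c N (m + 1)) * (of_real ((q\<^sup>2) powi (int N + 1 + m)) * theta_term q z m)"
        unfolding f_def E_def theta_term_shift(2)[OF q(1) z, symmetric] by (simp only: mult_ac)
      moreover have "c (Suc N) m = (1 + (q\<^sup>2) ^ (2 * N + 1)) * c N m
        + (q\<^sup>2) powi (int N + 1 - m) * c N (m - 1) + (q\<^sup>2) powi (int N + 1 + m) * c N (m + 1)"
        using gauss_binomial_step[OF q2] unfolding c_def by blast
      ultimately show ?thesis unfolding E2 f_def of_real_add of_real_mult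
        by (simp only: of_real_add of_real_mult distrib_left distrib_right mult_ac)
    qed
    ultimately show ?case by simp
  qed
  then show ?thesis by (simp add: c_def)
qed

text \<open>
In \<open>finite_jacobi_triple_product\<close> every coefficient tends to \<open>1 / L\<close>, where \<open>L\<close> is the limit of \<open>q_factorial (q\<^sup>2)\<close>,
and all of them are bounded by \<open>(1 / L)\<^sup>2\<close>; hence the limit may be taken term by term. The constant \<open>c\<close>
does not depend on \<open>z\<close> and cancels in quotients of theta values of the same nome.
\<close>
lemma jacobi_prod_tendsto_theta:
  assumes q: "0 < q" "q < 1"
  obtains c where "0 < c" "\<And>z. z \<noteq> 0 \<Longrightarrow> jacobi_prod q z \<longlonglongrightarrow> of_real c * theta q z"
proof -
  have q2: "0 < q\<^sup>2" "q\<^sup>2 < 1" using q by (auto simp: abs_square_less_1)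
  have "\<exists>L>0. q_factorial (q\<^sup>2) \<longlonglongrightarrow> L \<and> (\<forall>n. L \<le> q_factorial (q\<^sup>2) n)"
  proof (rule prod_one_minus_tendsto_pos[of "\<lambda>i. (q\<^sup>2) ^ Suc i"])
    show "(q\<^sup>2) ^ Suc i < 1" for i using power_Suc_less_one[of "q\<^sup>2" i] q2 by simp
    show "summable (\<lambda>i. (q\<^sup>2) ^ Suc i)" using q2 by (simp add: summable_geometric)
    fix L :: real
    assume "0 < L" "(\<lambda>n. \<Prod>i<n. 1 - (q\<^sup>2) ^ Suc i) \<longlonglongrightarrow> L" "\<And>n. L \<le> (\<Prod>i<n. 1 - (q\<^sup>2) ^ Suc i)"
    then show ?thesis unfolding q_factorial_def[abs_def] by blast
  qed simp
  then obtain L where L: "0 < L" "q_factorial (q\<^sup>2) \<longlonglongrightarrow> L" "\<And>n. L \<le> q_factorial (q\<^sup>2) n" by blast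
  have le1: "q_factorial (q\<^sup>2) n \<le> 1" for n
    unfolding q_factorial_def using q2 power_Suc_less_one[of "q\<^sup>2"]
    by (intro prod_le_1) (auto simp: less_imp_le)
  \<comment> \<open>The coefficients of the finite product, bounded by \<open>(1 / L)\<^sup>2\<close> and convergent to \<open>L * (1 / L)\<^sup>2\<close>.\<close>
  define c where "c N m = q_factorial (q\<^sup>2) (2 * N) * inv_q_factorial (q\<^sup>2) (int N - m)
     * inv_q_factorial (q\<^sup>2) (int N + m)" for N m
  have inv_bound: "0 \<le> inv_q_factorial (q\<^sup>2) k" "inv_q_factorial (q\<^sup>2) k \<le> 1 / L" for k
    using L(1) L(3)[of "nat k"] by (auto simp: inv_q_factorial_def frac_le)
  have c_bound: "\<bar>c N m\<bar> \<le> 1 / L * (1 / L)" for N m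
  proof -
    have "0 \<le> q_factorial (q\<^sup>2) (2 * N)" using L(1) L(3)[of "2 * N"] by linarith
    then have "\<bar>c N m\<bar> = q_factorial (q\<^sup>2) (2 * N) * (inv_q_factorial (q\<^sup>2) (int N - m) * inv_q_factorial (q\<^sup>2) (int N + m))"
      using inv_bound by (simp add: c_def abs_mult)
    also have "\<dots> \<le> 1 * (1 / L * (1 / L))"
      using le1 inv_bound L(1) by (intro mult_mono) auto
    finally show ?thesis by simp
  qed
  have inv_lim: "(\<lambda>N. inv_q_factorial (q\<^sup>2) (int N + m)) \<longlonglongrightarrow> 1 / L" for m
  proof -
    have "filterlim (\<lambda>N. nat (int N + m)) at_top sequentially"
      unfolding filterlim_at_top eventually_sequentially
    proof
      show "\<exists>N. \<forall>n\<ge>N. Z \<le> nat (int n + m)" for Z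
        by (rule exI[of _ "Z + nat (- m)"]) auto
    qed
    then have "(\<lambda>N. 1 / q_factorial (q\<^sup>2) (nat (int N + m))) \<longlonglongrightarrow> 1 / L"
      using L by (intro tendsto_intros filterlim_compose[OF L(2)]) auto
    moreover have "eventually (\<lambda>N. 1 / q_factorial (q\<^sup>2) (nat (int N + m)) = inv_q_factorial (q\<^sup>2) (int N + m)) sequentially"
      using eventually_ge_at_top[of "nat (- m)"]
      by eventually_elim (auto simp: inv_q_factorial_def)
    ultimately show ?thesis by (rule Lim_transform_eventually)
  qed
  have c_lim: "(\<lambda>N. c N m) \<longlonglongrightarrow> 1 / L" for m
  proof -
    have "filterlim (\<lambda>N::nat. 2 * N) at_top sequentially"
      by (intro filterlim_subseq strict_monoI) simp
    then have "(\<lambda>N. c N m) \<longlonglongrightarrow> L * (1 / L) * (1 / L)"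
      unfolding c_def using inv_lim[of m] inv_lim[of "- m"]
      by (intro tendsto_mult filterlim_compose[OF L(2)]) auto
    then show ?thesis using L by simp
  qed
  show ?thesis
  proof
    show "0 < 1 / L" using L by simp
    fix z :: complex assume z: "z \<noteq> 0"
    have jp: "jacobi_prod q z N = (\<Sum>\<^sub>\<infinity>m. of_real (c N m) * theta_term q z m)" for N
      using finite_jacobi_triple_product[OF q z, of N] unfolding c_def[symmetric]
      by (rule infsumI[symmetric])
    have "(\<lambda>N. \<Sum>\<^sub>\<infinity>m. of_real (c N m) * theta_term q z m) \<longlonglongrightarrow> of_real (1 / L) * theta q z"
    proof (rule swap_uniform_limit'[where F = "finite_subsets_at_top UNIV" and S = UNIV])
      show "uniform_limit UNIV (\<lambda>X N. \<Sum>m\<in>X. of_real (c N m) * theta_term q z m)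
         (\<lambda>N. \<Sum>\<^sub>\<infinity>m\<in>UNIV. of_real (c N m) * theta_term q z m) (finite_subsets_at_top UNIV)"
      proof (rule Weierstrass_m_test_general)
        show "norm (of_real (c N m) * theta_term q z m) \<le> 1 / L * (1 / L) * norm (theta_term q z m)" for N m
          unfolding norm_mult using c_bound[of N m] by (intro mult_right_mono) auto
        show "(\<lambda>m. 1 / L * (1 / L) * norm (theta_term q z m)) summable_on UNIV"
          using q z by (intro summable_on_cmult_right theta_term_abs_summable) auto
      qed
      show "\<forall>\<^sub>F X in finite_subsets_at_top UNIV.
          ((\<lambda>N. \<Sum>m\<in>X. of_real (c N m) * theta_term q z m) \<longlongrightarrow>
           (\<Sum>m\<in>X. of_real (1 / L) * theta_term q z m)) sequentially"
        by (intro always_eventually allI tendsto_sum tendsto_mult tendsto_const tendsto_of_real c_lim)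
      have "((\<lambda>m. of_real (1 / L) * theta_term q z m) has_sum (of_real (1 / L) * theta q z)) UNIV"
        using q z by (intro has_sum_cmult_right has_sum_theta) auto
      then show "((\<lambda>X. \<Sum>m\<in>X. of_real (1 / L) * theta_term q z m) \<longlongrightarrow> of_real (1 / L) * theta q z)
          (finite_subsets_at_top UNIV)"
        by (simp add: has_sum_def)
    qed auto
    then show "jacobi_prod q z \<longlonglongrightarrow> of_real (1 / L) * theta q z"
      unfolding jp[abs_def] .
  qed
qed

section \<open>Theta values on the unit circle\<close>

text \<open>
On the unit circle \<open>jacobi_prod\<close> is real, and this is its value there.
\<close>
definition unit_prod :: "real \<Rightarrow> complex \<Rightarrow> nat \<Rightarrow> real" where
  "unit_prod q z N = (\<Prod>i<N. (norm (1 + of_real (q ^ (2 * i + 1)) * z))\<^sup>2)"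

lemma jacobi_prod_unit_circle:
  assumes "norm z = 1"
  shows "jacobi_prod q z N = of_real (unit_prod q z N)"
proof -
  have "z * cnj z = 1" using assms by (simp add: complex_norm_square[symmetric])
  then have "of_real e / z = of_real e * cnj z" for e
    using assms by (metis divide_inverse inverse_unique mult.commute)
  then have "(1 + of_real e * z) * (1 + of_real e / z) = of_real ((norm (1 + of_real e * z))\<^sup>2)" for e
    by (simp only: complex_norm_square complex_cnj_add complex_cnj_mult
        complex_cnj_complex_of_real complex_cnj_one)
  then show ?thesis
    unfolding jacobi_prod_def unit_prod_def of_real_prod by (simp only:)
qed

lemma unit_prod_bounds:
  assumes q: "0 < q" "q < 1" and z: "norm z = 1"
  shows "unit_prod q (- 1) N \<le> unit_prod q z N" "unit_prod q z N \<le> unit_prod q 1 N"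
proof -
  have e: "0 < q ^ (2 * i + 1)" "q ^ (2 * i + 1) < 1" for i
    using q power_Suc_less_one[of q "2 * i"] by auto
  have n1: "norm (1 + complex_of_real x * - 1) = 1 - x" if "x < 1" for x
  proof -
    have "1 + complex_of_real x * - 1 = of_real (1 - x)" by simp
    then show ?thesis using that by (simp only: norm_of_real)
  qed
  have n2: "norm (1 + complex_of_real x * 1) = 1 + x" if "0 < x" for x
  proof -
    have "1 + complex_of_real x * 1 = of_real (1 + x)" by simp
    then show ?thesis using that by (simp only: norm_of_real)
  qed
  have "1 - x \<le> norm (1 + complex_of_real x * z)" if "0 < x" for x
    using norm_triangle_ineq2[of 1 "- (complex_of_real x * z)"] that z by (simp add: norm_mult)
  then show "unit_prod q (- 1) N \<le> unit_prod q z N"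
    unfolding unit_prod_def using e
    by (intro prod_mono conjI power_mono) (simp_all only: n1 zero_le_power2 diff_ge_0_iff_ge less_imp_le norm_ge_zero)
  have "norm (1 + complex_of_real x * z) \<le> 1 + x" if "0 < x" for x
    using norm_triangle_ineq[of 1 "complex_of_real x * z"] that z by (simp add: norm_mult)
  then show "unit_prod q z N \<le> unit_prod q 1 N"
    unfolding unit_prod_def using e
    by (intro prod_mono conjI power_mono) (simp_all only: n2 zero_le_power2 norm_ge_zero)
qed

text \<open>
For \<open>|z| = 1\<close> the two factors with the same index in the triple product are conjugate, so the partial
products are real, and \<open>1 - e \<le> |1 + e z| \<le> 1 + e\<close> places them between their values at \<open>-1\<close> and at \<open>1\<close>.
The last bound, which controls the limit \<open>q \<rightarrow> 1\<close>, comes from the first factor at \<open>-1\<close>; all other factors are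
at most \<open>1\<close> at \<open>-1\<close>, and all are at least \<open>1\<close> at \<open>1\<close>.
\<close>
lemma theta_unit_circle:
  assumes q: "0 < q" "q < 1" and z: "norm z = 1"
  shows "theta q z = of_real (Re (theta q z))"
    and "0 < Re (theta q (- 1))" "Re (theta q (- 1)) \<le> Re (theta q z)" "Re (theta q z) \<le> Re (theta q 1)"
    and "Re (theta q (- 1)) \<le> (1 - q) * Re (theta q 1)"
proof -
  obtain c where c: "0 < c" and lim: "\<And>z. z \<noteq> 0 \<Longrightarrow> jacobi_prod q z \<longlonglongrightarrow> of_real c * theta q z"
    using jacobi_prod_tendsto_theta[OF q] by blast
  have lim1: "(\<lambda>N. of_real (unit_prod q z N)) \<longlonglongrightarrow> of_real c * theta q z" if "norm z = 1" for z :: complex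
  proof -
    have "jacobi_prod q z = (\<lambda>N. of_real (unit_prod q z N))"
      by (rule ext) (rule jacobi_prod_unit_circle[OF that])
    moreover have "z \<noteq> 0" using that by auto
    ultimately show ?thesis using lim[of z] by simp
  qed
  have limR: "unit_prod q z \<longlonglongrightarrow> c * Re (theta q z)" if "norm z = 1" for z
    using tendsto_Re[OF lim1[OF that]] by simp
  have "Im (theta q z) = 0"
    using LIMSEQ_unique[OF tendsto_Im[OF lim1[OF z]], of 0] c by simp
  then show "theta q z = of_real (Re (theta q z))" by (simp add: complex_eq_iff)
  show "Re (theta q (- 1)) \<le> Re (theta q z)"
    using LIMSEQ_le[OF limR[of "- 1"] limR[OF z]] unit_prod_bounds(1)[OF q z] c by auto
  show "Re (theta q z) \<le> Re (theta q 1)"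
    using LIMSEQ_le[OF limR[OF z] limR[of 1]] unit_prod_bounds(2)[OF q z] c by auto
  have e: "0 < q ^ (2 * i + 1)" "q ^ (2 * i + 1) < 1" for i
    using q power_Suc_less_one[of q "2 * i"] by auto
  have m1: "unit_prod q (- 1) N = (\<Prod>i<N. 1 - q ^ (2 * i + 1))\<^sup>2" for N
  proof -
    have "1 + complex_of_real x * - 1 = of_real (1 - x)" for x by simp
    then show ?thesis
      unfolding unit_prod_def by (simp only: norm_of_real power2_abs prod_power_distrib)
  qed
  have p1: "unit_prod q 1 N = (\<Prod>i<N. 1 + q ^ (2 * i + 1))\<^sup>2" for N
  proof -
    have "1 + complex_of_real x * 1 = of_real (1 + x)" for x by simp
    then show ?thesis
      unfolding unit_prod_def by (simp only: norm_of_real power2_abs prod_power_distrib)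
  qed
  show "0 < Re (theta q (- 1))"
  proof (rule prod_one_minus_tendsto_pos[of "\<lambda>i. q ^ (2 * i + 1)"])
    show "summable (\<lambda>i. q ^ (2 * i + 1))"
      using q by (simp add: power_mult summable_geometric abs_square_less_1)
    fix L :: real
    assume L: "0 < L" "(\<lambda>n. \<Prod>i<n. 1 - q ^ (2 * i + 1)) \<longlonglongrightarrow> L"
    have "(\<lambda>n. (\<Prod>i<n. 1 - q ^ (2 * i + 1))\<^sup>2) \<longlonglongrightarrow> L\<^sup>2" by (intro tendsto_intros L)
    then have "unit_prod q (- 1) \<longlonglongrightarrow> L\<^sup>2" unfolding m1[abs_def] .
    from LIMSEQ_unique[OF limR[of "- 1"] this] have "c * Re (theta q (- 1)) = L\<^sup>2" by simp
    moreover have "0 < L\<^sup>2" using L by simp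
    ultimately have "0 < c * Re (theta q (- 1))" by simp
    then show ?thesis using c by (simp add: zero_less_mult_iff)
  qed (use e in \<open>auto simp: less_imp_le\<close>)
  show "Re (theta q (- 1)) \<le> (1 - q) * Re (theta q 1)"
  proof -
    have "unit_prod q (- 1) (Suc N) \<le> (1 - q) * unit_prod q 1 (Suc N)" for N
    proof -
      have a: "(\<Prod>i<N. 1 - q ^ (2 * Suc i + 1)) \<le> 1" "0 \<le> (\<Prod>i<N. 1 - q ^ (2 * Suc i + 1))"
        using e[of "Suc i" for i] by (auto intro!: prod_le_1 prod_nonneg simp: less_imp_le)
      have "(\<Prod>i<Suc N. 1 - q ^ (2 * i + 1)) = (1 - q) * (\<Prod>i<N. 1 - q ^ (2 * Suc i + 1))"
        by (subst prod.lessThan_Suc_shift) simp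
      also have "\<dots> \<le> (1 - q) * 1" using a q by (intro mult_left_mono) auto
      finally have b: "(\<Prod>i<Suc N. 1 - q ^ (2 * i + 1)) \<le> 1 - q" by simp
      have b0: "0 \<le> (\<Prod>i<Suc N. 1 - q ^ (2 * i + 1))" 
        using e by (intro prod_nonneg) (auto simp: less_imp_le)
      have "unit_prod q (- 1) (Suc N) \<le> (1 - q)\<^sup>2" unfolding m1 using b b0 by (rule power_mono)
      also have "\<dots> \<le> (1 - q) * 1" using q by (simp add: power2_eq_square mult_left_le)
      also have "\<dots> \<le> (1 - q) * unit_prod q 1 (Suc N)"
      proof (rule mult_left_mono)
        have "1 \<le> (\<Prod>i<Suc N. 1 + q ^ (2 * i + 1))" using e by (intro prod_ge_1) (auto simp: less_imp_le)
        then show "1 \<le> unit_prod q 1 (Suc N)" unfolding p1 by (rule one_le_power)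
      qed (use q in simp)
      finally show ?thesis .
    qed
    then have "c * Re (theta q (- 1)) \<le> (1 - q) * (c * Re (theta q 1))"
      by (intro LIMSEQ_le[OF LIMSEQ_Suc[OF limR[of "- 1"]] tendsto_mult[OF tendsto_const LIMSEQ_Suc[OF limR[of 1]]]]) auto
    then have "c * Re (theta q (- 1)) \<le> c * ((1 - q) * Re (theta q 1))" by (simp only: mult_ac)
    then show ?thesis using c by simp
  qed
qed

lemma theta_neg_nome:
  assumes q: "0 < q" "q < 1"
  shows "theta q (- of_real q) = 0"
proof -
  obtain c where c: "0 < c" and lim: "jacobi_prod q (- of_real q) \<longlonglongrightarrow> of_real c * theta q (- of_real q)"
    using jacobi_prod_tendsto_theta[OF q] q by (metis neg_0_equal_iff_equal of_real_eq_0_iff less_irrefl)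
  have "jacobi_prod q (- of_real q) (Suc N) = 0" for N
    unfolding jacobi_prod_def prod.lessThan_Suc_shift using q by simp
  then have "(\<lambda>N. jacobi_prod q (- of_real q) (Suc N)) \<longlonglongrightarrow> 0" by simp
  from LIMSEQ_unique[OF LIMSEQ_Suc[OF lim] this] show ?thesis using c by simp
qed

section \<open>Theta values at roots of minus one\<close>

text \<open>
The \<open>M\<close>-th roots of \<open>-1\<close>, in the order of their arguments in \<open>(0, 2 \<pi>)\<close>.
\<close>
definition neg_root :: "nat \<Rightarrow> nat \<Rightarrow> complex" where
  "neg_root M j = cis (pi * (2 * real j + 1) / real M)"

lemma neg_root_power: "0 < M \<Longrightarrow> neg_root M j ^ M = - 1"
proof -
  assume "0 < M"
  then have "real M * (pi * (2 * real j + 1) / real M) = pi * (2 * real j + 1)" by simp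
  also have "\<dots> = 2 * pi * real j + pi" by (simp add: distrib_left)
  finally have eq: "real M * (pi * (2 * real j + 1) / real M) = 2 * pi * real j + pi" .
  have "neg_root M j ^ M = cis (2 * pi * real j + pi)"
    unfolding neg_root_def Complex.DeMoivre eq ..
  also have "\<dots> = cis (2 * pi * real j) * cis pi" by (rule cis_mult[symmetric])
  also have "cis (2 * pi * real j) = 1" by (rule cis_multiple_2pi) simp
  finally show ?thesis by simp
qed

lemma norm_neg_root [simp]: "norm (neg_root M j) = 1" by (simp add: neg_root_def)

lemma neg_root_nonzero [simp]: "neg_root M j \<noteq> 0" by (simp add: neg_root_def)

lemma inj_neg_root:
  assumes "0 < M"
  shows "inj_on (neg_root M) {..<M}"
proof (rule inj_onI)
  fix i j assume ij: "i \<in> {..<M}" "j \<in> {..<M}" "neg_root M i = neg_root M j"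
  have s: "neg_root M k = cis (pi / M) * cis (2 * pi * real k / real M)" for k
    unfolding neg_root_def cis_mult using assms by (simp add: field_simps)
  have "cis (2 * pi * real i / real M) = cis (2 * pi * real j / real M)"
    using ij(3) unfolding s by simp
  with bij_betw_imp_inj_on[OF Complex.bij_betw_roots_unity[OF assms]] ij(1,2) show "i = j"
    by (auto dest: inj_onD)
qed

text \<open>
Both sides are polynomials in \<open>t\<close> of degree at most \<open>M\<close>, and they agree at \<open>0\<close> and at the \<open>M\<close> inverses of the roots.
\<close>
lemma prod_one_minus_neg_root:
  assumes M: "0 < M"
  shows "(\<Prod>j<M. 1 - t * neg_root M j) = 1 + t ^ M"
proof -
  define D where "D = (\<Prod>j<M. [:1, - neg_root M j:]) - (1 + monom 1 M)"
  have ev: "poly D t = (\<Prod>j<M. 1 - t * neg_root M j) - (1 + t ^ M)" for t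
    by (simp add: D_def poly_prod poly_monom)
  have "degree (\<Prod>j<M. [:1, - neg_root M j:]) \<le> M"
    using degree_prod_sum_le[of "{..<M}" "\<lambda>j. [:1, - neg_root M j:]"] by (simp add: o_def)
  moreover have "degree (1 + monom 1 M :: complex poly) \<le> M"
    by (intro degree_add_le) (auto simp: degree_monom_le)
  ultimately have deg: "degree D \<le> M" unfolding D_def by (intro degree_diff_le)
  have "D = 0"
  proof (rule ccontr)
    assume nz: "D \<noteq> 0"
    define R where "R = insert 0 ((\<lambda>j. inverse (neg_root M j)) ` {..<M})"
    have "inj_on (\<lambda>j. inverse (neg_root M j)) {..<M}"
      using inj_neg_root[OF M] by (auto simp: inj_on_def)
    then have "card R = Suc M" unfolding R_def
      by (subst card_insert_disjoint) (auto simp: card_image)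
    moreover have "R \<subseteq> {t. poly D t = 0}"
    proof
      fix t assume "t \<in> R"
      then consider "t = 0" | i where "i < M" "t = inverse (neg_root M i)" by (auto simp: R_def)
      then show "t \<in> {t. poly D t = 0}"
      proof cases
        case 1
        then show ?thesis using M by (simp add: ev power_0_left)
      next
        case 2
        then have "(\<Prod>j<M. 1 - t * neg_root M j) = 0" by (intro prod_zero) (auto intro!: bexI[of _ i])
        moreover have "t ^ M = - 1" unfolding 2(2) power_inverse neg_root_power[OF M] by simp
        ultimately show ?thesis by (simp add: ev)
      qed
    qed
    then have "card R \<le> card {t. poly D t = 0}"
      by (rule card_mono[OF poly_roots_finite[OF nz]])
    ultimately show False using card_poly_roots_bound[OF nz] deg by simp
  qed
  then show ?thesis using ev[of t] by simp
qed

lemma prod_one_minus_inverse_neg_root: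
  assumes M: "0 < M"
  shows "(\<Prod>j<M. 1 - t / neg_root M j) = 1 + t ^ M"
proof -
  have "1 - t / neg_root M j = cnj (1 - cnj t * neg_root M j)" for j
  proof -
    have "neg_root M j * cnj (neg_root M j) = 1"
      using norm_neg_root[of M j] by (simp add: complex_norm_square[symmetric])
    then have "inverse (neg_root M j) = cnj (neg_root M j)" by (rule inverse_unique)
    then show ?thesis by (simp add: divide_inverse)
  qed
  then have "(\<Prod>j<M. 1 - t / neg_root M j) = cnj (\<Prod>j<M. 1 - cnj t * neg_root M j)"
    by simp
  also have "\<dots> = cnj (1 + cnj t ^ M)" by (simp only: prod_one_minus_neg_root[OF M])
  finally show ?thesis by simp
qed

lemma jacobi_prod_multiplication:
  assumes M: "0 < M"
  shows "(\<Prod>j<M. jacobi_prod Q (- (x * neg_root M j)) N) = jacobi_prod (Q ^ M) (x ^ M) N"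
proof -
  have "(\<Prod>j<M. jacobi_prod Q (- (x * neg_root M j)) N)
     = (\<Prod>i<N. (\<Prod>j<M. 1 - (of_real (Q ^ (2 * i + 1)) * x) * neg_root M j)
             * (\<Prod>j<M. 1 - (of_real (Q ^ (2 * i + 1)) / x) / neg_root M j))"
    unfolding jacobi_prod_def prod.distrib[symmetric] by (subst prod.swap) (simp add: mult.assoc)
  also have "\<dots> = jacobi_prod (Q ^ M) (x ^ M) N"
    unfolding prod_one_minus_neg_root[OF M] prod_one_minus_inverse_neg_root[OF M] jacobi_prod_def
    by (simp only: power_mult_distrib power_divide of_real_power power_mult[symmetric] mult.commute)
  finally show ?thesis .
qed

text \<open>
In the triple product the factors with index \<open>i\<close> multiply over all roots \<open>\<zeta>\<close> of \<open>-1\<close> to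
\<open>(1 + (Q ^ (2 * i + 1) * x) ^ M) * (1 + (Q ^ (2 * i + 1) / x) ^ M)\<close>, which is the factor with index \<open>i\<close> for nome \<open>Q ^ M\<close> and
argument \<open>x ^ M\<close>.
\<close>
lemma theta_multiplication:
  assumes Q: "0 < Q" "Q < 1" and M: "0 < M"
  obtains D :: real where "0 < D"
    "\<And>x. x \<noteq> 0 \<Longrightarrow> (\<Prod>j<M. theta Q (- (x * neg_root M j))) = of_real D * theta (Q ^ M) (x ^ M)"
proof -
  obtain c where c: "0 < c" "\<And>z. z \<noteq> 0 \<Longrightarrow> jacobi_prod Q z \<longlonglongrightarrow> of_real c * theta Q z"
    using jacobi_prod_tendsto_theta[OF Q] by blast
  have P: "0 < Q ^ M" "Q ^ M < 1" using Q M by (auto simp: power_less_one_iff)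
  obtain d where d: "0 < d" "\<And>z. z \<noteq> 0 \<Longrightarrow> jacobi_prod (Q ^ M) z \<longlonglongrightarrow> of_real d * theta (Q ^ M) z"
    using jacobi_prod_tendsto_theta[OF P] by blast
  show ?thesis
  proof
    show "0 < d / c ^ M" using c d by simp
    fix x :: complex assume x: "x \<noteq> 0"
    have "(\<lambda>N. \<Prod>j<M. jacobi_prod Q (- (x * neg_root M j)) N)
      \<longlonglongrightarrow> (\<Prod>j<M. of_real c * theta Q (- (x * neg_root M j)))"
      using x by (intro tendsto_prod c(2)) auto
    moreover have "(\<lambda>N. \<Prod>j<M. jacobi_prod Q (- (x * neg_root M j)) N)
      \<longlonglongrightarrow> of_real d * theta (Q ^ M) (x ^ M)"
      unfolding jacobi_prod_multiplication[OF M] using x by (intro d(2)) auto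
    ultimately have "(\<Prod>j<M. of_real c * theta Q (- (x * neg_root M j))) = of_real d * theta (Q ^ M) (x ^ M)"
      by (rule LIMSEQ_unique)
    then show "(\<Prod>j<M. theta Q (- (x * neg_root M j))) = of_real (d / c ^ M) * theta (Q ^ M) (x ^ M)"
      using c(1) by (simp add: prod.distrib field_simps)
  qed
qed

text \<open>
The exponent \<open>n\<^sup>2 + n\<close> is the same for \<open>n\<close> and \<open>-1 - n\<close>. So the series is twice its part over \<open>n \<ge> 0\<close>, which
starts with \<open>1\<close> and is dominated by \<open>Q ^ (n\<^sup>2)\<close>.
\<close>
lemma theta_at_nome:
  assumes Q: "0 < Q" "Q < 1"
  shows "theta Q (of_real Q) = of_real (Re (theta Q (of_real Q)))"
    and "2 \<le> Re (theta Q (of_real Q))" and "Re (theta Q (of_real Q)) \<le> 2 * Re (theta Q 1)"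
proof -
  define h g where "h n = Q powi (n\<^sup>2 + n)" and "g n = Q powi n\<^sup>2" for n :: int
  have th: "theta_term Q (of_real Q) n = of_real (h n)" for n
    using Q power_int_add[of Q "n\<^sup>2" n] by (simp add: theta_term_def h_def)
  have tg: "theta_term Q 1 n = of_real (g n)" for n by (simp add: theta_term_def g_def)
  have pos: "0 < h n" "0 < g n" for n using Q by (auto simp: h_def g_def)
  have H: "h summable_on UNIV" "g summable_on UNIV"
    using theta_term_abs_summable[of Q "of_real Q"] theta_term_abs_summable[of Q 1] Q pos
    unfolding th tg by (simp_all add: less_imp_le)
  have HA: "h summable_on A" "g summable_on A" for A using H by (auto intro: summable_on_subset)
  have "theta Q (of_real Q) = of_real (infsum h UNIV)"
    unfolding theta_def th using H by (intro infsumI has_sum_of_real) auto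
  then have S: "Re (theta Q (of_real Q)) = infsum h UNIV" "theta Q (of_real Q) = of_real (Re (theta Q (of_real Q)))"
    by simp_all
  then show "theta Q (of_real Q) = of_real (Re (theta Q (of_real Q)))" by blast
  have "theta Q 1 = of_real (infsum g UNIV)"
    unfolding theta_def tg using H by (intro infsumI has_sum_of_real) auto
  then have G: "Re (theta Q 1) = infsum g UNIV" by simp
  have "infsum h {..<0} = infsum h {0..}"
  proof (rule infsum_reindex_bij_witness[of _ "\<lambda>n. - 1 - n" "\<lambda>n. - 1 - n"])
    show "h (- 1 - n) = h n" for n unfolding h_def
      by (rule arg_cong[where f = "(powi) Q"]) (simp add: power2_eq_square algebra_simps)
  qed auto
  moreover have "infsum h ({..<0} \<union> {0..}) = infsum h {..<0} + infsum h {0..}"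
    by (intro infsum_Un_disjoint HA) auto
  moreover have "{..<0} \<union> {0..} = (UNIV :: int set)" by auto
  ultimately have S2: "infsum h UNIV = 2 * infsum h {0..}" by simp
  have "infsum h {0} \<le> infsum h {0..}"
    by (intro infsum_mono_neutral HA) (use pos in \<open>auto simp: less_imp_le\<close>)
  then show "2 \<le> Re (theta Q (of_real Q))" unfolding S(1) S2 by (simp add: h_def)
  have "infsum h {0..} \<le> infsum g {0..}"
  proof (intro infsum_mono HA)
    show "h n \<le> g n" if "n \<in> {0..}" for n
    proof -
      have "h n = Q powi n * g n" using Q by (simp add: h_def g_def power_int_add)
      also have "\<dots> \<le> 1 * g n"
        using pos[of n] Q that by (intro mult_right_mono power_int_le_one) auto
      finally show ?thesis by simp
    qed
  qed
  also have "infsum g {0..} \<le> infsum g UNIV"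
    by (intro infsum_mono_neutral HA) (use pos in \<open>auto simp: less_imp_le\<close>)
  finally show "Re (theta Q (of_real Q)) \<le> 2 * Re (theta Q 1)" unfolding S(1) S2 G by simp
qed

lemma theta_one_mono:
  assumes "0 < p" "p \<le> q" "q < 1"
  shows "Re (theta p 1) \<le> Re (theta q 1)"
proof -
  have "((\<lambda>n. Re (theta_term p 1 n)) has_sum Re (theta p 1)) UNIV"
       "((\<lambda>n. Re (theta_term q 1 n)) has_sum Re (theta q 1)) UNIV"
    using assms by (auto intro!: has_sum_Re has_sum_theta)
  then show ?thesis
    by (rule has_sum_mono) (use assms in \<open>auto simp: theta_term_def simp flip: of_real_power_int intro!: power_int_mono\<close>)
qed

section \<open>Modulus and nome\<close>

definition theta_re :: "real \<Rightarrow> complex \<Rightarrow> real" where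
  "theta_re q z = Re (theta q z)"

lemma theta_eq_theta_re: "0 < q \<Longrightarrow> q < 1 \<Longrightarrow> norm z = 1 \<Longrightarrow> theta q z = of_real (theta_re q z)"
  unfolding theta_re_def by (rule theta_unit_circle(1))

lemma theta_re_bounds:
  assumes "0 < q" "q < 1" "norm z = 1"
  shows "0 < theta_re q (- 1)" "theta_re q (- 1) \<le> theta_re q z" "theta_re q z \<le> theta_re q 1" "0 < theta_re q z"
  using theta_unit_circle(2-4)[OF assms] unfolding theta_re_def by auto

text \<open>
The quotient \<open>\<theta>\<^sub>4(0)\<^sup>2 / \<theta>\<^sub>3(0)\<^sup>2\<close>, the classical complementary modulus of nome \<open>q\<close>.
\<close>
definition theta_modulus :: "real \<Rightarrow> real" where
  "theta_modulus q = (theta_re q (- 1) / theta_re q 1)\<^sup>2"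

text \<open>
These are the instances \<open>(1, 1)\<close>, \<open>(-1, -1)\<close> and \<open>(1, -1)\<close> of \<open>theta_product\<close>; in the last one the second
term vanishes by \<open>theta_neg_nome\<close>.
\<close>
lemma theta_re_landen:
  assumes q: "0 < q" "q < 1" and Q: "Q = q\<^sup>2"
  defines "S \<equiv> Re (theta Q (of_real Q))"
  shows "(theta_re q 1)\<^sup>2 = (theta_re Q 1)\<^sup>2 + q * S\<^sup>2"
    and "(theta_re q (- 1))\<^sup>2 = (theta_re Q 1)\<^sup>2 - q * S\<^sup>2"
    and "theta_re q 1 * theta_re q (- 1) = (theta_re Q (- 1))\<^sup>2"
proof -
  have Q1: "0 < Q" "Q < 1" using q Q by (auto simp: abs_square_less_1)
  have S: "theta Q (of_real Q) = of_real S" unfolding S_def by (rule theta_at_nome(1)[OF Q1])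
  have e: "theta q 1 = of_real (theta_re q 1)" "theta q (- 1) = of_real (theta_re q (- 1))"
    "theta Q 1 = of_real (theta_re Q 1)" "theta Q (- 1) = of_real (theta_re Q (- 1))"
    using q Q1 by (simp_all add: theta_eq_theta_re)
  have "of_real ((theta_re q 1)\<^sup>2) = complex_of_real ((theta_re Q 1)\<^sup>2 + q * S\<^sup>2)"
    using theta_product[OF q Q, of 1 1] by (simp add: e S power2_eq_square)
  then show "(theta_re q 1)\<^sup>2 = (theta_re Q 1)\<^sup>2 + q * S\<^sup>2" by (simp only: of_real_eq_iff)
  have "of_real ((theta_re q (- 1))\<^sup>2) = complex_of_real ((theta_re Q 1)\<^sup>2 - q * S\<^sup>2)"
    using theta_product[OF q Q, of "- 1" "- 1"] by (simp add: e S power2_eq_square)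
  then show "(theta_re q (- 1))\<^sup>2 = (theta_re Q 1)\<^sup>2 - q * S\<^sup>2" by (simp only: of_real_eq_iff)
  have "of_real (theta_re q 1 * theta_re q (- 1)) = complex_of_real ((theta_re Q (- 1))\<^sup>2)"
    using theta_product[OF q Q, of 1 "- 1"] theta_neg_nome[OF Q1] by (simp add: e power2_eq_square)
  then show "theta_re q 1 * theta_re q (- 1) = (theta_re Q (- 1))\<^sup>2" by (simp only: of_real_eq_iff)
qed

text \<open>
Both parts follow from \<open>theta_re_landen\<close> by elimination. The complement of the new modulus comes out as
\<open>q * S\<^sup>2 / A\<^sup>2\<close> with \<open>S\<close> the theta value at the nome and \<open>A\<close> the one at \<open>1\<close>, for nome \<open>q\<^sup>2\<close>; then \<open>2 \<le> S\<close> and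
monotonicity of \<open>A\<close> in the nome give the bound.
\<close>
lemma theta_modulus_landen:
  assumes q: "0 < q" "q < 1"
  shows "theta_modulus (q\<^sup>2) = 2 * sqrt (theta_modulus q) / (1 + theta_modulus q)"
    and "4 / (theta_re q 1)\<^sup>2 * q \<le> sqrt (1 - (theta_modulus (q\<^sup>2))\<^sup>2)"
proof -
  define Q where "Q = q\<^sup>2"
  have Q1: "0 < Q" "Q < 1" "Q \<le> q"
    using q by (auto simp: Q_def abs_square_less_1) (simp add: power2_eq_square mult_left_le)
  define S where "S = Re (theta Q (of_real Q))"
  define a b A B where "a = theta_re q 1" and "b = theta_re q (- 1)" and "A = theta_re Q 1" and "B = theta_re Q (- 1)"
  have pos: "0 < a" "0 < b" "0 < A" "0 < B"
    using theta_re_bounds[OF q, of 1] theta_re_bounds[OF Q1(1,2), of 1] by (auto simp: a_def b_def A_def B_def)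
  have l: "a\<^sup>2 = A\<^sup>2 + q * S\<^sup>2" "b\<^sup>2 = A\<^sup>2 - q * S\<^sup>2" "a * b = B\<^sup>2"
    using theta_re_landen[OF q Q_def] by (simp_all add: a_def b_def A_def B_def S_def)
  have m: "theta_modulus q = (b / a)\<^sup>2" "theta_modulus Q = B\<^sup>2 / A\<^sup>2"
    by (simp_all add: theta_modulus_def a_def b_def A_def B_def power_divide)
  have A2: "A\<^sup>2 = (a\<^sup>2 + b\<^sup>2) / 2" using l by simp
  have "theta_modulus Q = 2 * (a * b) / (a\<^sup>2 + b\<^sup>2)" unfolding m A2 l(3) by simp
  also have "\<dots> = 2 * (b / a) / (1 + (b / a)\<^sup>2)"
  proof -
    have "1 + (b / a)\<^sup>2 = (a\<^sup>2 + b\<^sup>2) / a\<^sup>2" using pos by (simp add: field_simps)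
    then show ?thesis using pos by (simp add: power2_eq_square)
  qed
  also have "b / a = sqrt (theta_modulus q)" using pos by (simp add: m)
  also have "(sqrt (theta_modulus q))\<^sup>2 = theta_modulus q"
    by (rule real_sqrt_pow2) (simp only: m zero_le_power2)
  finally show "theta_modulus (q\<^sup>2) = 2 * sqrt (theta_modulus q) / (1 + theta_modulus q)" by (simp add: Q_def)
  have "1 - (theta_modulus Q)\<^sup>2 = ((A\<^sup>2)\<^sup>2 - (a * b)\<^sup>2) / (A\<^sup>2)\<^sup>2"
    unfolding m l(3) using pos by (simp add: power_divide diff_divide_distrib)
  also have "(A\<^sup>2)\<^sup>2 - (a * b)\<^sup>2 = (q * S\<^sup>2)\<^sup>2"
    unfolding power_mult_distrib[of a] l(1,2) by (simp add: power2_eq_square algebra_simps)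
  finally have "1 - (theta_modulus Q)\<^sup>2 = (q * S\<^sup>2 / A\<^sup>2)\<^sup>2" by (simp add: power_divide)
  then have "sqrt (1 - (theta_modulus Q)\<^sup>2) = q * S\<^sup>2 / A\<^sup>2" using q by simp
  moreover have "4 / a\<^sup>2 * q \<le> q * S\<^sup>2 / A\<^sup>2"
  proof -
    have "2 \<le> S" unfolding S_def by (rule theta_at_nome(2)[OF Q1(1,2)])
    then have "2\<^sup>2 \<le> S\<^sup>2" by (intro power_mono) auto
    moreover have "A\<^sup>2 \<le> a\<^sup>2"
      using theta_one_mono[OF Q1(1,3) q(2)] pos unfolding A_def a_def theta_re_def by (intro power_mono) auto
    ultimately have "4 / a\<^sup>2 \<le> S\<^sup>2 / A\<^sup>2" using pos by (intro frac_le) auto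
    then have "4 / a\<^sup>2 * q \<le> S\<^sup>2 / A\<^sup>2 * q" using q by (intro mult_right_mono) auto
    then show ?thesis by (simp add: mult.commute)
  qed
  ultimately show "4 / (theta_re q 1)\<^sup>2 * q \<le> sqrt (1 - (theta_modulus (q\<^sup>2))\<^sup>2)"
    by (simp add: a_def Q_def)
qed

lemma theta_modulus_bounds:
  assumes q: "0 < q" "q < 1"
  shows "0 < theta_modulus q" "theta_modulus q < 1" "theta_modulus q \<le> 1 - q"
proof -
  define r where "r = theta_re q (- 1) / theta_re q 1"
  have "theta_re q (- 1) \<le> (1 - q) * theta_re q 1"
    using theta_unit_circle(5)[OF q, of 1] by (simp add: theta_re_def)
  then have r: "0 < r" "r \<le> 1 - q"
    using theta_re_bounds[OF q, of 1] by (auto simp: r_def pos_divide_le_eq)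
  have "r\<^sup>2 \<le> r" using r q by (simp add: power2_eq_square mult_left_le)
  then show "0 < theta_modulus q" "theta_modulus q < 1" "theta_modulus q \<le> 1 - q"
    using r q unfolding theta_modulus_def r_def[symmetric] by auto
qed

lemma theta_zero [simp]: "theta 0 z = 1"
proof -
  have "(theta_term 0 z has_sum 1) UNIV"
    by (rule has_sum_finite_neutralI[where B = "{0}"]) (auto simp: theta_term_def power_int_0_left_if)
  then show ?thesis unfolding theta_def by (rule infsumI)
qed

lemma theta_modulus_continuous:
  assumes "r < 1"
  shows "continuous_on {0..r} theta_modulus"
proof -
  have c: "continuous_on {0..r} (\<lambda>q. theta_re q z)" if "norm z = 1" for z
  proof -
    have "continuous_on {0..r} (\<lambda>q. (\<lambda>(q, z). theta q z) (q, z))"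
      by (rule continuous_on_compose2[OF theta_continuous[OF assms]])
         (use that in \<open>auto intro!: continuous_intros\<close>)
    then show ?thesis unfolding theta_re_def by (auto intro: continuous_intros)
  qed
  have "theta_re q 1 \<noteq> 0" if "q \<in> {0..r}" for q
    using theta_re_bounds(4)[of q 1] that assms by (cases "q = 0") (auto simp: theta_re_def)
  then show ?thesis unfolding theta_modulus_def[abs_def]
    by (intro continuous_intros c) auto
qed

lemma theta_modulus_surj:
  assumes "0 < k" "k < 1"
  obtains q where "0 < q" "q < 1" "theta_modulus q = k"
proof -
  have "\<exists>q\<ge>0. q \<le> 1 - k \<and> theta_modulus q = k"
  proof (rule IVT2')
    show "theta_modulus (1 - k) \<le> k" using theta_modulus_bounds(3)[of "1 - k"] assms by simp
    show "k \<le> theta_modulus 0" using assms by (simp add: theta_modulus_def theta_re_def)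
    show "continuous_on {0..1 - k} theta_modulus" using assms by (intro theta_modulus_continuous) auto
  qed (use assms in auto)
  then obtain q where q: "0 \<le> q" "q \<le> 1 - k" "theta_modulus q = k" by blast
  moreover have "q \<noteq> 0" using q assms by (auto simp: theta_modulus_def theta_re_def)
  ultimately show ?thesis using that[of q] assms by auto
qed

text \<open>
The moduli of the nomes \<open>q ^ 2 ^ n\<close> form an orbit of Landen's transformation that tends to \<open>1\<close>, and by
\<open>theta_modulus_landen\<close> their complements satisfy the lower bound demanded in \<open>K_ratio_le_via_landen_orbit\<close>.
\<close>
theorem nome_le_exp_K_ratio:
  assumes q: "0 < q" "q < 1"
  shows "q \<le> exp (- (pi * K_ratio (theta_modulus q)))"
proof -
  define k where "k n = theta_modulus (q ^ 2 ^ n)" for n :: nat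
  have qn: "0 < q ^ 2 ^ n" "q ^ 2 ^ n < 1" "q ^ 2 ^ n \<le> q" for n :: nat
  proof -
    show "0 < q ^ 2 ^ n" "q ^ 2 ^ n < 1" using q by (auto simp: power_less_one_iff)
    show "q ^ 2 ^ n \<le> q" using q power_decreasing[of 1 "2 ^ n" q] by simp
  qed
  have sq: "q ^ 2 ^ Suc n = (q ^ 2 ^ n)\<^sup>2" for n :: nat by (simp only: power_Suc power_even_eq)
  have "pi * K_ratio (k 0) \<le> - ln q"
  proof (rule K_ratio_le_via_landen_orbit[OF q])
    show "0 < 4 / (theta_re q 1)\<^sup>2" using theta_re_bounds(4)[OF q, of 1] by simp
    show "0 < k n" "k n < 1" for n using theta_modulus_bounds[OF qn(1,2)] by (auto simp: k_def)
    show "k (Suc n) = 2 * sqrt (k n) / (1 + k n)" for n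
      unfolding k_def sq by (rule theta_modulus_landen(1)[OF qn(1,2)])
    show "4 / (theta_re q 1)\<^sup>2 * q ^ 2 ^ n \<le> sqrt (1 - (k (Suc n))\<^sup>2)" for n
    proof -
      have "(theta_re (q ^ 2 ^ n) 1)\<^sup>2 \<le> (theta_re q 1)\<^sup>2"
        using theta_one_mono[OF qn(1,3) q(2)] theta_re_bounds(4)[OF qn(1,2), of 1]
        unfolding theta_re_def by (intro power_mono) (auto simp: less_imp_le)
      then have "4 / (theta_re q 1)\<^sup>2 * q ^ 2 ^ n \<le> 4 / (theta_re (q ^ 2 ^ n) 1)\<^sup>2 * q ^ 2 ^ n"
        using qn(1)[of n] theta_re_bounds(4)[OF qn(1,2)[of n], of 1] theta_re_bounds(4)[OF q, of 1]
        by (intro mult_right_mono divide_left_mono) auto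
      also have "\<dots> \<le> sqrt (1 - (k (Suc n))\<^sup>2)"
        unfolding k_def sq by (rule theta_modulus_landen(2)[OF qn(1,2)])
      finally show ?thesis .
    qed
    have "(\<lambda>n. q ^ 2 ^ n) \<longlonglongrightarrow> 0"
    proof -
      have "filterlim (\<lambda>n::nat. (2::nat) ^ n) at_top sequentially"
        by (intro filterlim_subseq strict_monoI) simp
      from filterlim_compose[OF LIMSEQ_realpow_zero this] q show ?thesis by simp
    qed
    then have "(\<lambda>n. theta_modulus (q ^ 2 ^ n)) \<longlonglongrightarrow> theta_modulus 0"
      by (intro continuous_on_tendsto_compose[OF theta_modulus_continuous[OF q(2)]])
         (use q qn in \<open>auto simp: less_imp_le\<close>)
    then show "k \<longlonglongrightarrow> 1" by (simp add: k_def[abs_def] theta_modulus_def theta_re_def)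
  qed
  then have "ln q \<le> - (pi * K_ratio (theta_modulus q))" by (simp add: k_def)
  then have "exp (ln q) \<le> exp (- (pi * K_ratio (theta_modulus q)))" by (simp only: exp_le_cancel_iff)
  then show ?thesis using q by simp
qed

section \<open>The Zolotarev problem for two symmetric intervals\<close>

text \<open>
Let \<open>p = sqrt P\<close>, \<open>x = -z\<close>, and let \<open>\<tau>(x)\<close> be the quotient of the theta values of nome \<open>p\<close> at \<open>x\<close> and \<open>-x\<close>. By
\<open>theta_product\<close>, the square of the quotient to be bounded is \<open>(\<tau>(1) - \<tau>(x)) / (\<tau>(1) + \<tau>(x))\<close> up to the factor \<open>p\<close>. As
\<open>\<tau>(x)\<close> lies between \<open>\<tau>(-1) = 1 / \<tau>(1)\<close> and \<open>\<tau>(1)\<close>, this is largest at \<open>x = -1\<close>, that is at \<open>z = 1\<close>, where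
\<open>theta_at_nome\<close> applies.
\<close>
lemma theta_shift_le_two:
  assumes P: "0 < P" "P < 1" and z: "norm z = 1"
  shows "norm (theta P (of_real P * z)) \<le> 2 * norm (theta P z)"
proof -
  define p where "p = sqrt P"
  have p: "0 < p" "p < 1" "P = p\<^sup>2" using P by (auto simp: p_def)
  define x where "x = - z"
  have x: "norm x = 1" "x \<noteq> 0" using z by (auto simp: x_def)
  define A B a b where "A = theta_re p x" and "B = theta_re p (- x)" and "a = theta_re p 1" and "b = theta_re p (- 1)"
  have e: "theta p x = of_real A" "theta p (- x) = of_real B" "theta p 1 = of_real a" "theta p (- 1) = of_real b"
    using p x by (simp_all add: A_def B_def a_def b_def theta_eq_theta_re)
  have bd: "0 < b" "b \<le> A" "B \<le> a" "0 < A" "0 < B" "0 < a" "b \<le> B" "A \<le> a"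
    using theta_re_bounds[OF p(1,2), of x] theta_re_bounds[OF p(1,2), of "- x"] theta_re_bounds[OF p(1,2), of 1] x
    by (auto simp: A_def B_def a_def b_def)
  define S T where "S = Re (theta P (of_real P))" and "T = theta_re P 1"
  have ST: "0 \<le> S" "S \<le> 2 * T" "0 < T"
    using theta_at_nome(2,3)[OF P] theta_re_bounds(4)[OF P, of 1] by (auto simp: S_def T_def theta_re_def)
  have ab: "2 * T\<^sup>2 = a\<^sup>2 + b\<^sup>2" "2 * p * S\<^sup>2 = a\<^sup>2 - b\<^sup>2"
    using theta_re_landen[OF p] by (simp_all add: a_def b_def S_def T_def)
  define u v where "u = norm (theta P (of_real P * z))" and "v = norm (theta P z)"
  have prod1: "theta p x * theta p (- 1) = theta P z * theta P z + p * x * (theta P (of_real P * z) * theta P (of_real P * z))"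
    using theta_product[OF p, of x "- 1"] x by (simp add: x_def)
  have prod2: "theta p (- x) * theta p 1 = theta P z * theta P z - p * x * (theta P (of_real P * z) * theta P (of_real P * z))"
    using theta_product[OF p, of "- x" 1] x by (simp add: x_def)
  have "of_real (A * b - B * a) = 2 * p * x * (theta P (of_real P * z) * theta P (of_real P * z))"
    using prod1 prod2 unfolding e by simp
  then have "norm (complex_of_real (A * b - B * a)) = 2 * p * u\<^sup>2"
    using p x by (simp add: norm_mult u_def power2_eq_square)
  then have 1: "\<bar>A * b - B * a\<bar> = 2 * p * u\<^sup>2" by (simp only: norm_of_real)
  have "of_real (A * b + B * a) = 2 * (theta P z * theta P z)"
    using prod1 prod2 unfolding e by simp
  then have "norm (complex_of_real (A * b + B * a)) = 2 * v\<^sup>2"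
    by (simp add: norm_mult v_def power2_eq_square)
  then have "\<bar>A * b + B * a\<bar> = 2 * v\<^sup>2" by (simp only: norm_of_real)
  then have 2: "A * b + B * a = 2 * v\<^sup>2" using bd by simp
  \<comment> \<open>The value \<open>a / b\<close> is the maximum of \<open>A / B\<close>, and \<open>b / a\<close> the minimum.\<close>
  have "\<bar>A * b - B * a\<bar> * (a\<^sup>2 + b\<^sup>2) \<le> (a\<^sup>2 - b\<^sup>2) * (A * b + B * a)"
  proof -
    have h: "B * b \<le> A * a" "A * b \<le> B * a"       using mult_mono[of B a b A] mult_mono[of A a b B] bd by (auto simp: mult.commute)
    have "2 * (a * b) * (B * b) \<le> 2 * (a * b) * (A * a)" "2 * (a * b) * (A * b) \<le> 2 * (a * b) * (B * a)"
      using h bd by (intro mult_left_mono; simp)+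
    then have "(B * a - A * b) * (a\<^sup>2 + b\<^sup>2) \<le> (a\<^sup>2 - b\<^sup>2) * (A * b + B * a)"
      by (simp add: power2_eq_square algebra_simps)
    moreover have "\<bar>A * b - B * a\<bar> = B * a - A * b" using h by simp
    ultimately show ?thesis by simp
  qed
  then have "2 * p * u\<^sup>2 * (2 * T\<^sup>2) \<le> 2 * p * S\<^sup>2 * (2 * v\<^sup>2)" unfolding 1 2 ab .
  then have "u\<^sup>2 * T\<^sup>2 \<le> S\<^sup>2 * v\<^sup>2" using p by simp
  also have "\<dots> \<le> (2 * T)\<^sup>2 * v\<^sup>2" using ST by (intro mult_right_mono power_mono) auto
  finally have "T\<^sup>2 * u\<^sup>2 \<le> T\<^sup>2 * (2 * v)\<^sup>2" by (simp add: power_mult_distrib mult_ac)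
  then have "u\<^sup>2 \<le> (2 * v)\<^sup>2" using ST by simp
  then show ?thesis unfolding u_def v_def by (rule power2_le_imp_le) simp
qed

text \<open>
A constant multiple of Jacobi's function dn of nome \<open>q\<close> in a rescaled argument, normalised so that its values on the real line are
symmetric under inversion.
\<close>
definition theta_dn :: "real \<Rightarrow> real \<Rightarrow> real" where
  "theta_dn q v = theta_re q (cis v) / theta_re q (- cis v)"

lemma theta_dn_pos: "0 < q \<Longrightarrow> q < 1 \<Longrightarrow> 0 < theta_dn q v"
  unfolding theta_dn_def using theta_re_bounds(4)[of q "cis v"] theta_re_bounds(4)[of q "- cis v"] by simp

text \<open>
The instances \<open>(x, -y)\<close> and \<open>(-x, y)\<close> of \<open>theta_product\<close>, with \<open>x = cis u\<close> and \<open>y = cis v\<close>, share their first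
term and have opposite second terms. Their sum and their difference are the denominator and the
numerator of the quotient on the left, cleared of fractions.
\<close>
lemma theta_dn_quotient:
  assumes q: "0 < q" "q < 1" and Q: "Q = q\<^sup>2"
  shows "norm (theta Q (- (cis u * cis v))) * norm (theta Q (- (cis u / cis v)))
           * \<bar>(theta_dn q u - theta_dn q v) / (theta_dn q u + theta_dn q v)\<bar>
       = q * (norm (theta Q (- (of_real Q * cis u * cis v))) * norm (theta Q (- (of_real Q * cis u / cis v))))"
proof -
  define x y where "x = cis u" and "y = cis v"
  have xy: "norm x = 1" "norm y = 1" "x \<noteq> 0" "y \<noteq> 0" by (auto simp: x_def y_def)
  define A B a b where "A = theta_re q x" and "B = theta_re q (- x)" and "a = theta_re q y" and "b = theta_re q (- y)"
  have e: "theta q x = of_real A" "theta q (- x) = of_real B" "theta q y = of_real a" "theta q (- y) = of_real b"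
    using q xy by (simp_all add: A_def B_def a_def b_def theta_eq_theta_re)
  have pos: "0 < A" "0 < B" "0 < a" "0 < b"
    using theta_re_bounds(4)[OF q] xy by (auto simp: A_def B_def a_def b_def)
  define U V where "U = theta Q (- (x * y)) * theta Q (- (x / y))"
    and "V = theta Q (- (of_real Q * x * y)) * theta Q (- (of_real Q * x / y))"
  have p1: "theta q x * theta q (- y) = U + q * x * V"
    using theta_product[OF q Q, of x "- y"] xy by (simp add: U_def V_def mult.assoc)
  have p2: "theta q (- x) * theta q y = U - q * x * V"
    using theta_product[OF q Q, of "- x" y] xy by (simp add: U_def V_def mult.assoc)
  have "complex_of_real (A * b - B * a) = 2 * q * x * V" using p1 p2 unfolding e by simp
  then have "norm (complex_of_real (A * b - B * a)) = 2 * q * norm V" using xy q by (simp add: norm_mult)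
  then have 1: "\<bar>A * b - B * a\<bar> = 2 * q * norm V" by (simp only: norm_of_real)
  have "complex_of_real (A * b + B * a) = 2 * U" using p1 p2 unfolding e by simp
  then have "norm (complex_of_real (A * b + B * a)) = 2 * norm U" by (simp add: norm_mult)
  then have "\<bar>A * b + B * a\<bar> = 2 * norm U" by (simp only: norm_of_real)
  then have 2: "A * b + B * a = 2 * norm U" using pos by simp
  have d: "theta_dn q u = A / B" "theta_dn q v = a / b"
    by (simp_all add: theta_dn_def A_def B_def a_def b_def x_def y_def)
  have "theta_dn q u - theta_dn q v = (A * b - B * a) / (B * b)"
       "theta_dn q u + theta_dn q v = (A * b + B * a) / (B * b)"
    unfolding d using pos by (simp_all add: diff_frac_eq add_frac_eq mult.commute)
  then have "\<bar>(theta_dn q u - theta_dn q v) / (theta_dn q u + theta_dn q v)\<bar> = \<bar>A * b - B * a\<bar> / (A * b + B * a)"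
    using pos by (simp add: abs_mult)
  moreover have "\<bar>A * b - B * a\<bar> / (A * b + B * a) = q * norm V / norm U" unfolding 1 2 by simp
  moreover have "0 < norm U" using 2 mult_pos_pos[OF pos(1,4)] mult_pos_pos[OF pos(2,3)] by linarith
  ultimately have "norm U * \<bar>(theta_dn q u - theta_dn q v) / (theta_dn q u + theta_dn q v)\<bar> = q * norm V"
    by simp
  then show ?thesis by (simp add: U_def V_def x_def y_def norm_mult)
qed

text \<open>
The inverse of the root with index \<open>j\<close> is the root with index \<open>2 * l - 1 - j\<close>.
\<close>
lemma prod_neg_root_pairs:
  fixes f :: "complex \<Rightarrow> real"
  assumes l: "0 < l"
  shows "(\<Prod>j<l. f (x * neg_root (2 * l) j) * f (x / neg_root (2 * l) j)) = (\<Prod>j<2 * l. f (x * neg_root (2 * l) j))"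
proof -
  have inv: "x / neg_root (2 * l) j = x * neg_root (2 * l) (2 * l - 1 - j)" if "j < 2 * l" for j
  proof -
    have "pi * (2 * real (2 * l - 1 - j) + 1) / real (2 * l) = 2 * pi + - (pi * (2 * real j + 1) / real (2 * l))"
      using that by (simp add: of_nat_diff field_simps)
    then have "neg_root (2 * l) (2 * l - 1 - j) = cis (2 * pi) * cis (- (pi * (2 * real j + 1) / real (2 * l)))"
      unfolding neg_root_def cis_mult by (rule arg_cong)
    also have "\<dots> = inverse (neg_root (2 * l) j)" by (simp add: neg_root_def cis_inverse)
    finally show ?thesis by (simp add: divide_inverse)
  qed
  have "(\<Prod>j<2 * l. f (x * neg_root (2 * l) j)) = (\<Prod>j<l. f (x * neg_root (2 * l) j)) * (\<Prod>j\<in>{l..<2 * l}. f (x * neg_root (2 * l) j))"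
    by (subst prod.union_disjoint[symmetric]) (auto intro!: prod.cong)
  also have "(\<Prod>j\<in>{l..<2 * l}. f (x * neg_root (2 * l) j)) = (\<Prod>j<l. f (x / neg_root (2 * l) j))"
    by (rule prod.reindex_bij_witness[of _ "\<lambda>j. 2 * l - 1 - j" "\<lambda>j. 2 * l - 1 - j"]) (auto simp: inv)
  finally show ?thesis by (simp add: prod.distrib)
qed

text \<open>
By \<open>theta_dn_quotient\<close>, factor \<open>j\<close> is \<open>q\<close> times a quotient \<open>g / f\<close> at \<open>x y_j\<close> times the same quotient at \<open>x / y_j\<close>. These points
run through \<open>x\<close> times all the roots of \<open>-1\<close> of order \<open>2 * l\<close>. So \<open>theta_multiplication\<close> turns the product over \<open>j\<close> into
a single quotient, to which \<open>theta_shift_le_two\<close> applies.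
\<close>
lemma theta_dn_zolotarev:
  assumes q: "0 < q" "q < 1" and l: "0 < l"
  shows "(\<Prod>j<l. \<bar>(theta_dn q u - theta_dn q (pi * (2 * real j + 1) / real (2 * l)))
      / (theta_dn q u + theta_dn q (pi * (2 * real j + 1) / real (2 * l)))\<bar>) \<le> 2 * q ^ l"
proof -
  define Q where "Q = q\<^sup>2"
  have Q: "0 < Q" "Q < 1" using q by (auto simp: Q_def abs_square_less_1)
  define M where "M = 2 * l"
  have M: "0 < M" using l by (simp add: M_def)
  define y where "y = neg_root M"
  define x where "x = cis u"
  have x: "norm x = 1" "x \<noteq> 0" by (auto simp: x_def)
  define R where "R j = \<bar>(theta_dn q u - theta_dn q (pi * (2 * real j + 1) / real M))
      / (theta_dn q u + theta_dn q (pi * (2 * real j + 1) / real M))\<bar>" for j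
  define f where "f z = norm (theta Q (- z))" for z
  define g where "g z = norm (theta Q (- (of_real Q * z)))" for z
  have R: "f (x * y j) * f (x / y j) * R j = q * (g (x * y j) * g (x / y j))" for j
    using theta_dn_quotient[OF q Q_def, of u "pi * (2 * real j + 1) / real M"]
    unfolding f_def g_def R_def x_def y_def neg_root_def
    by (simp only: mult.assoc times_divide_eq_right)
  obtain D where D: "0 < D"
    "\<And>x. x \<noteq> 0 \<Longrightarrow> (\<Prod>j<M. theta Q (- (x * neg_root M j))) = of_real D * theta (Q ^ M) (x ^ M)"
    using theta_multiplication[OF Q M] by blast
  have P: "0 < Q ^ M" "Q ^ M < 1" using Q M by (auto simp: power_less_one_iff)
  define F where "F = (\<Prod>j<M. f (x * y j))"
  define G where "G = (\<Prod>j<M. g (x * y j))"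
  have F: "F = D * norm (theta (Q ^ M) (x ^ M))"
    using arg_cong[OF D(2)[OF x(2)], of norm] D(1) by (simp add: F_def f_def y_def prod_norm[symmetric] norm_mult)
  have G: "G = D * norm (theta (Q ^ M) (of_real (Q ^ M) * x ^ M))"
    using arg_cong[OF D(2)[of "of_real Q * x"], of norm] D(1) x Q
    by (simp add: G_def g_def y_def prod_norm[symmetric] norm_mult power_mult_distrib mult.assoc)
  have xM: "norm (x ^ M) = 1" using x by (simp add: norm_power)
  have "0 < norm (theta (Q ^ M) (x ^ M))"
    using theta_re_bounds(4)[OF P xM] theta_eq_theta_re[OF P xM] by simp
  then have Fpos: "0 < F" using D by (simp add: F)
  have GF: "G \<le> 2 * F" using theta_shift_le_two[OF P xM] D(1) unfolding F G by simp
  have "F * (\<Prod>j<l. R j) = (\<Prod>j<l. f (x * y j) * f (x / y j)) * (\<Prod>j<l. R j)"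
    unfolding F_def M_def y_def using prod_neg_root_pairs[OF l, of f x] by simp
  also have "\<dots> = (\<Prod>j<l. q * (g (x * y j) * g (x / y j)))"
    by (simp only: prod.distrib[symmetric] R)
  also have "\<dots> = q ^ l * (\<Prod>j<l. g (x * y j) * g (x / y j))"
    unfolding prod.distrib by simp
  also have "\<dots> = q ^ l * G"
    unfolding G_def M_def y_def using prod_neg_root_pairs[OF l, of g x] by simp
  also have "\<dots> \<le> q ^ l * (2 * F)" using GF q by (intro mult_left_mono) auto
  finally have "F * (\<Prod>j<l. R j) \<le> F * (2 * q ^ l)" by (simp add: mult_ac)
  then have "(\<Prod>j<l. R j) \<le> 2 * q ^ l" using Fpos by simp
  then show ?thesis by (simp add: R_def M_def)
qed

lemma theta_dn_surj:
  assumes q: "0 < q" "q < 1" and t: "sqrt (theta_modulus q) \<le> t" "t \<le> 1 / sqrt (theta_modulus q)"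
  obtains v where "theta_dn q v = t"
proof -
  have pos: "0 < theta_re q 1" "0 < theta_re q (- 1)" using theta_re_bounds[OF q, of 1] by auto
  then have m: "sqrt (theta_modulus q) = theta_re q (- 1) / theta_re q 1" by (simp add: theta_modulus_def)
  have c: "continuous_on {0..pi} (\<lambda>v. theta_re q (s * cis v))" if "norm s = 1" for s
  proof -
    have "continuous_on {0..pi} (\<lambda>v. (\<lambda>(q, z). theta q z) (q, s * cis v))"
      by (rule continuous_on_compose2[OF theta_continuous[OF q(2)]])
         (use that q in \<open>auto intro!: continuous_intros simp: norm_mult\<close>)
    then show ?thesis unfolding theta_re_def by (auto intro: continuous_intros)
  qed
  have "theta_re q (- cis v) \<noteq> 0" for v using theta_re_bounds(4)[OF q, of "- cis v"] by simp
  then have "continuous_on {0..pi} (theta_dn q)"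
    unfolding theta_dn_def[abs_def] using c[of 1] c[of "- 1"] by (intro continuous_intros) auto
  moreover have "theta_dn q pi \<le> t" "t \<le> theta_dn q 0"
    using t by (simp_all add: theta_dn_def m)
  ultimately have "\<exists>v\<ge>0. v \<le> pi \<and> theta_dn q v = t" by (intro IVT2') auto
  then show ?thesis using that by blast
qed

text \<open>
The nome is chosen such that \<open>sqrt (a * b) * theta_dn q v\<close> runs through \<open>[a, b]\<close>; the zeros are its values at
equally spaced \<open>v\<close>. The scaling cancels in every factor.
\<close>
theorem zolotarev_upper_bound:
  fixes a b :: real
  assumes ab: "0 < a" "a < b" and l: "0 < l"
  obtains p where "\<And>j. 0 < p j"
    "\<And>x. a \<le> x \<Longrightarrow> x \<le> b \<Longrightarrow> \<bar>\<Prod>j<l. (x - p j) / (x + p j)\<bar> \<le> 2 * exp (- (pi * K_ratio (a / b))) ^ l"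
proof -
  obtain q where q: "0 < q" "q < 1" "theta_modulus q = a / b"
    using theta_modulus_surj[of "a / b"] ab by auto
  define c where "c = sqrt (a * b)"
  have c: "0 < c" using ab by (simp add: c_def)
  define p where "p j = c * theta_dn q (pi * (2 * real j + 1) / real (2 * l))" for j
  show ?thesis
  proof
    show "0 < p j" for j using c theta_dn_pos[OF q(1,2)] by (simp add: p_def)
    fix x assume x: "a \<le> x" "x \<le> b"
    have c1: "c * sqrt (a / b) = a" "c / sqrt (a / b) = b"
      using ab by (simp_all add: c_def real_sqrt_mult real_sqrt_divide)
    have "sqrt (a / b) \<le> x / c" using x c c1(1) by (simp add: pos_le_divide_eq mult.commute)
    moreover have "x / c \<le> 1 / sqrt (a / b)"
    proof (rule pos_divide_le_eq[OF c, THEN iffD2])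
      have "1 / sqrt (a / b) * c = c / sqrt (a / b)" by simp
      then show "x \<le> 1 / sqrt (a / b) * c" unfolding c1(2) using x by simp
    qed
    ultimately obtain v where "theta_dn q v = x / c"
      using theta_dn_surj[OF q(1,2), of "x / c"] unfolding q(3) by blast
    then have v: "x = c * theta_dn q v" using c by simp
    have "\<bar>\<Prod>j<l. (x - p j) / (x + p j)\<bar> = (\<Prod>j<l. \<bar>(theta_dn q v - theta_dn q (pi * (2 * real j + 1) / real (2 * l)))
      / (theta_dn q v + theta_dn q (pi * (2 * real j + 1) / real (2 * l)))\<bar>)"
      unfolding abs_prod v p_def using c
      by (simp only: right_diff_distrib[symmetric] distrib_left[symmetric] mult_divide_mult_cancel_left_if) simp
    also have "\<dots> \<le> 2 * q ^ l" by (rule theta_dn_zolotarev[OF q(1,2) l])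
    also have "\<dots> \<le> 2 * exp (- (pi * K_ratio (a / b))) ^ l"
      using nome_le_exp_K_ratio[OF q(1,2)] q by (intro mult_left_mono power_mono) auto
    finally show "\<bar>\<Prod>j<l. (x - p j) / (x + p j)\<bar> \<le> 2 * exp (- (pi * K_ratio (a / b))) ^ l" .
  qed
qed

section \<open>The spectral theorem for real symmetric matrices\<close>

\<comment> \<open>From here on, the two infix symbols denote the operations on vectors of variable length.\<close>
no_notation inner (infix "\<bullet>" 70)
no_notation vec_nth (infixl "$" 90)

lemma transpose_symD: "transpose_mat A = A \<Longrightarrow> A \<in> carrier_mat n n \<Longrightarrow> i < n \<Longrightarrow> j < n \<Longrightarrow> A $$ (i, j) = A $$ (j, i)"
  by (metis carrier_matD index_transpose_mat(1))

lemma sq_norm_pos: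
  assumes "v \<in> carrier_vec n" "v \<noteq> 0\<^sub>v n"
  shows "0 < v \<bullet> (v :: real vec)"
proof -
  obtain i where i: "i < n" "v $ i \<noteq> 0"
    using assms by (metis carrier_vecD eq_vecI index_zero_vec)
  have "0 < v $ i * v $ i" using i by (metis not_real_square_gt_zero)
  also have "\<dots> \<le> (\<Sum>k\<in>{0..<n}. v $ k * v $ k)"
    using i by (intro member_le_sum) auto
  finally show ?thesis using assms(1) by (simp add: scalar_prod_def)
qed

text \<open>
A complex eigenvector \<open>z = x + i y\<close> with eigenvalue \<open>mu\<close> exists. Comparing \<open>y \<bullet> A x\<close> with \<open>A y \<bullet> x\<close> gives
\<open>Im mu * (x \<bullet> x + y \<bullet> y) = 0\<close>. So \<open>mu\<close> is real, and \<open>x\<close> or \<open>y\<close> is a real eigenvector.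
\<close>
lemma real_symmetric_has_eigenvector:
  fixes A :: "real mat"
  assumes A: "A \<in> carrier_mat n n" and sym: "transpose_mat A = A" and n: "0 < n"
  obtains v e where "v \<in> carrier_vec n" "v \<bullet> v = 1" "A *\<^sub>v v = e \<cdot>\<^sub>v v"
proof -
  define Ac where "Ac = map_mat complex_of_real A"
  have Ac: "Ac \<in> carrier_mat n n" using A by (simp add: Ac_def)
  obtain mu z where z: "z \<in> carrier_vec n" "z \<noteq> 0\<^sub>v n" "Ac *\<^sub>v z = mu \<cdot>\<^sub>v z"
    using spectrum_non_empty[OF Ac n] Ac unfolding spectrum_def eigenvalue_def eigenvector_def by auto
  define x y where "x = map_vec Re z" and "y = map_vec Im z"
  have xy: "x \<in> carrier_vec n" "y \<in> carrier_vec n" using z by (auto simp: x_def y_def)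
  have ent: "(\<Sum>j\<in>{0..<n}. complex_of_real (A $$ (i, j)) * z $ j) = mu * z $ i" if "i < n" for i
  proof -
    have "(Ac *\<^sub>v z) $ i = (\<Sum>j\<in>{0..<n}. complex_of_real (A $$ (i, j)) * z $ j)"
      using that A z(1) by (simp add: Ac_def scalar_prod_def)
    then show ?thesis using z that by simp
  qed
  have Ax: "(A *\<^sub>v x) $ i = Re mu * x $ i - Im mu * y $ i" if "i < n" for i
    using arg_cong[OF ent[OF that], of Re] that A z(1) by (simp add: scalar_prod_def x_def y_def)
  have Ay: "(A *\<^sub>v y) $ i = Im mu * x $ i + Re mu * y $ i" if "i < n" for i
    using arg_cong[OF ent[OF that], of Im] that A z(1) by (simp add: scalar_prod_def x_def y_def)
  have "y \<bullet> (A *\<^sub>v x) = (A *\<^sub>v y) \<bullet> x"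
    using transpose_vec_mult_scalar[OF A xy] sym by simp
  moreover have "y \<bullet> (A *\<^sub>v x) = Re mu * (\<Sum>i<n. x $ i * y $ i) - Im mu * (\<Sum>i<n. y $ i * y $ i)"
  proof -
    have "y \<bullet> (A *\<^sub>v x) = (\<Sum>i<n. y $ i * (Re mu * x $ i - Im mu * y $ i))"
      unfolding scalar_prod_def by (rule sum.cong) (use A Ax in \<open>auto simp del: index_mult_mat_vec\<close>)
    then show ?thesis by (simp add: right_diff_distrib sum_subtractf sum_distrib_left mult_ac)
  qed
  moreover have "(A *\<^sub>v y) \<bullet> x = Im mu * (\<Sum>i<n. x $ i * x $ i) + Re mu * (\<Sum>i<n. x $ i * y $ i)"
  proof -
    have "(A *\<^sub>v y) \<bullet> x = (\<Sum>i<n. Im mu * (x $ i * x $ i) + Re mu * (x $ i * y $ i))"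
      unfolding scalar_prod_def
      by (rule sum.cong) (use A xy Ay in \<open>auto simp: distrib_right simp del: index_mult_mat_vec\<close>)
    then show ?thesis by (simp add: sum.distrib sum_distrib_left)
  qed
  ultimately have im: "Im mu * ((\<Sum>i<n. x $ i * x $ i) + (\<Sum>i<n. y $ i * y $ i)) = 0"
    by (simp add: algebra_simps)
  have nz: "x \<noteq> 0\<^sub>v n \<or> y \<noteq> 0\<^sub>v n"
  proof (rule ccontr)
    assume "\<not> ?thesis"
    then have "\<forall>i<n. x $ i = 0 \<and> y $ i = 0" by auto
    then have "z = 0\<^sub>v n" using z(1) by (intro eq_vecI) (auto simp: x_def y_def complex_eq_iff)
    then show False using z by simp
  qed
  have "x \<bullet> x = (\<Sum>i<n. x $ i * x $ i)" "y \<bullet> y = (\<Sum>i<n. y $ i * y $ i)"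
    using xy by (auto simp: scalar_prod_def atLeast0LessThan)
  moreover have "0 \<le> (\<Sum>i<n. x $ i * x $ i)" "0 \<le> (\<Sum>i<n. y $ i * y $ i)" by (auto intro: sum_nonneg)
  ultimately have "0 < (\<Sum>i<n. x $ i * x $ i) + (\<Sum>i<n. y $ i * y $ i)"
    using nz sq_norm_pos[OF xy(1)] sq_norm_pos[OF xy(2)] by auto
  with im have im0: "Im mu = 0" by simp
  have "A *\<^sub>v x = Re mu \<cdot>\<^sub>v x" "A *\<^sub>v y = Re mu \<cdot>\<^sub>v y"
    using A xy Ax Ay im0 by (intro eq_vecI; simp)+
  then obtain w where w: "w \<in> carrier_vec n" "w \<noteq> 0\<^sub>v n" "A *\<^sub>v w = Re mu \<cdot>\<^sub>v w"
    using nz xy by blast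
  define c where "c = 1 / sqrt (w \<bullet> w)"
  have pos: "0 < w \<bullet> w" by (rule sq_norm_pos[OF w(1,2)])
  show ?thesis
  proof
    show "c \<cdot>\<^sub>v w \<in> carrier_vec n" using w by simp
    show "(c \<cdot>\<^sub>v w) \<bullet> (c \<cdot>\<^sub>v w) = 1"
      using w pos by (simp add: c_def)
    show "A *\<^sub>v (c \<cdot>\<^sub>v w) = Re mu \<cdot>\<^sub>v (c \<cdot>\<^sub>v w)"
      using w A by (simp add: mult_mat_vec smult_smult_assoc mult.commute)
  qed
qed

text \<open>
The Householder reflection along \<open>w = v - unit_vec n 0\<close>. It maps the first unit vector to \<open>v\<close> because \<open>v\<close> has norm
one, which amounts to \<open>w \<bullet> w = - 2 * w $ 0\<close>.
\<close>
lemma orthogonal_reflection_to: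
  fixes v :: "real vec"
  assumes v: "v \<in> carrier_vec n" "v \<bullet> v = 1" and n: "0 < n"
  obtains H where "H \<in> carrier_mat n n" "transpose_mat H = H" "H * H = 1\<^sub>m n" "H *\<^sub>v unit_vec n 0 = v"
proof (cases "v = unit_vec n 0")
  case True
  show ?thesis using True that[of "1\<^sub>m n"] by simp
next
  case False
  define w where "w i = v $ i - (if i = 0 then 1 else 0)" for i
  define s where "s = (\<Sum>i<n. w i * w i)"
  have vv: "(\<Sum>i<n. v $ i * v $ i) = 1" using v by (simp add: scalar_prod_def atLeast0LessThan)
  have d1: "(\<Sum>i<n. (if i = j then 1 else 0) * f i) = f j" if "j < n" for j and f :: "nat \<Rightarrow> real"
    using that by (subst sum.cong[OF refl, of _ _ "\<lambda>i. if i = j then f i else 0"]) auto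
  have "s = (\<Sum>i<n. v $ i * v $ i - 2 * ((if i = 0 then 1 else 0) * v $ i) + (if i = 0 then 1 else 0) * 1)"
    unfolding s_def w_def by (intro sum.cong) (auto simp: algebra_simps)
  also have "\<dots> = 1 - 2 * v $ 0 + 1"
    unfolding sum.distrib sum_subtractf vv sum_distrib_left[symmetric] d1[OF n] by simp
  finally have s: "s = - 2 * w 0" by (simp add: w_def)
  have "s \<noteq> 0"
  proof
    assume "s = 0"
    then have "\<forall>i\<in>{..<n}. w i * w i = 0" unfolding s_def by (subst (asm) sum_nonneg_eq_0_iff) auto
    then have "v = unit_vec n 0" using v by (intro eq_vecI) (auto simp: w_def)
    then show False using False by simp
  qed
  \<comment> \<open>As \<open>s\<close> is the squared norm of \<open>w\<close>, the matrix \<open>1 - c w w\<^sup>T\<close> is the reflection along \<open>w\<close>.\<close>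
  define c where "c = 2 / s"
  have cs: "c * s = 2" "c * w 0 = - 1" using \<open>s \<noteq> 0\<close> s by (auto simp: c_def field_simps)
  define h where "h i j = (if i = j then 1 else 0) - c * w i * w j" for i j
  define H where "H = mat n n (\<lambda>(i, j). h i j)"
  have hh: "(\<Sum>k<n. h i k * h k j) = (if i = j then 1 else 0)" if ij: "i < n" "j < n" for i j
  proof -
    have "(\<Sum>k<n. h i k * h k j) = (\<Sum>k<n. (if k = i then 1 else 0) * h k j - c * w i * w k * h k j)"
      by (intro sum.cong) (auto simp: h_def algebra_simps)
    also have "\<dots> = h i j - (\<Sum>k<n. c * w i * w k * h k j)"
      unfolding sum_subtractf d1[OF ij(1)] ..
    also have "(\<Sum>k<n. c * w i * w k * h k j) = (\<Sum>k<n. (if k = j then 1 else 0) * (c * w i * w k) - (c * w i * w j * c) * (w k * w k))"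
      by (intro sum.cong) (auto simp: h_def algebra_simps)
    also have "\<dots> = c * w i * w j - (c * w i * w j) * (c * s)"
      unfolding sum_subtractf d1[OF ij(2)] sum_distrib_left[symmetric] s_def by (simp add: mult.assoc)
    finally show ?thesis unfolding cs by (simp add: h_def)
  qed
  show ?thesis
  proof (rule that[of H])
    show "H \<in> carrier_mat n n" by (simp add: H_def)
    show "transpose_mat H = H" by (rule eq_matI) (auto simp: H_def h_def)
    show "H * H = 1\<^sub>m n"
      by (rule eq_matI) (auto simp: H_def scalar_prod_def hh atLeast0LessThan)
    show "H *\<^sub>v unit_vec n 0 = v"
    proof (rule eq_vecI)
      fix i assume "i < dim_vec v"
      then have i: "i < n" using v by simp
      have "(H *\<^sub>v unit_vec n 0) $ i = h i 0" using i n by (simp add: H_def)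
      also have "\<dots> = (if i = 0 then 1 else 0) - (c * w 0) * w i" by (simp add: h_def)
      also have "\<dots> = v $ i" unfolding cs by (simp add: w_def)
      finally show "(H *\<^sub>v unit_vec n 0) $ i = v $ i" .
    qed (use v in \<open>simp add: H_def\<close>)
  qed
qed

lemma symmetric_split_off_eigenvector:
  fixes B :: "real mat"
  assumes B: "B \<in> carrier_mat (Suc n) (Suc n)" and sym: "transpose_mat B = B"
    and e: "B *\<^sub>v unit_vec (Suc n) 0 = e \<cdot>\<^sub>v unit_vec (Suc n) 0"
  obtains C where "C \<in> carrier_mat n n" "transpose_mat C = C"
    "B = four_block_mat (mat 1 1 (\<lambda>_. e)) (0\<^sub>m 1 n) (0\<^sub>m n 1) C"
proof
  define C where "C = mat n n (\<lambda>(i, j). B $$ (Suc i, Suc j))"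
  show "C \<in> carrier_mat n n" by (simp add: C_def)
  show "transpose_mat C = C"
    by (rule eq_matI) (auto simp: C_def intro!: transpose_symD[OF sym B])
  have c0: "B $$ (i, 0) = (if i = 0 then e else 0)" if "i < Suc n" for i
    using arg_cong[OF e, of "\<lambda>v. v $ i"] that B by simp
  have r0: "B $$ (0, i) = (if i = 0 then e else 0)" if "i < Suc n" for i
    using c0[OF that] transpose_symD[OF sym B that, of 0] by simp
  show "B = four_block_mat (mat 1 1 (\<lambda>_. e)) (0\<^sub>m 1 n) (0\<^sub>m n 1) C"
    by (rule eq_matI) (use B in \<open>auto simp: c0 r0 C_def\<close>)
qed

text \<open>
Conjugating with a reflection that maps the first unit vector to an eigenvector splits off a block of size
one; the remaining block is symmetric again.
\<close>
theorem real_spectral_theorem: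
  fixes A :: "real mat"
  assumes "A \<in> carrier_mat n n" "transpose_mat A = A"
  shows "\<exists>U d. U \<in> carrier_mat n n \<and> transpose_mat U * U = 1\<^sub>m n \<and> A = U * mat_diag n d * transpose_mat U"
  using assms
proof (induction n arbitrary: A)
  case 0
  then show ?case by (intro exI[of _ "1\<^sub>m 0"]) (auto intro!: eq_matI)
next
  case (Suc n)
  note A = Suc.prems
  obtain v e where v: "v \<in> carrier_vec (Suc n)" "v \<bullet> v = 1" "A *\<^sub>v v = e \<cdot>\<^sub>v v"
    using real_symmetric_has_eigenvector[OF A] by blast
  obtain H where H: "H \<in> carrier_mat (Suc n) (Suc n)" "transpose_mat H = H" "H * H = 1\<^sub>m (Suc n)"
    "H *\<^sub>v unit_vec (Suc n) 0 = v"
    using orthogonal_reflection_to[OF v(1,2)] by blast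
  define B where "B = H * (A * H)"
  have AH: "A * H \<in> carrier_mat (Suc n) (Suc n)" using H A by simp
  have B: "B \<in> carrier_mat (Suc n) (Suc n)" using H AH by (simp add: B_def)
  have "transpose_mat B = B"
    unfolding B_def transpose_mult[OF H(1) AH] transpose_mult[OF A(1) H(1)] H(2) A(2)
    by (rule assoc_mult_mat[OF H(1) A(1) H(1)])
  moreover have "B *\<^sub>v unit_vec (Suc n) 0 = e \<cdot>\<^sub>v unit_vec (Suc n) 0"
  proof -
    have u: "unit_vec (Suc n) 0 \<in> carrier_vec (Suc n)" by simp
    have "B *\<^sub>v unit_vec (Suc n) 0 = H *\<^sub>v (A *\<^sub>v (H *\<^sub>v unit_vec (Suc n) 0))"
      unfolding B_def assoc_mult_mat_vec[OF H(1) AH u] assoc_mult_mat_vec[OF A(1) H(1) u] ..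
    also have "\<dots> = e \<cdot>\<^sub>v (H *\<^sub>v v)" unfolding H(4) v(3) by (rule mult_mat_vec[OF H(1) v(1)])
    also have "H *\<^sub>v v = (H * H) *\<^sub>v unit_vec (Suc n) 0"
      using assoc_mult_mat_vec[OF H(1) H(1) u] H(4) by simp
    also have "\<dots> = unit_vec (Suc n) 0" unfolding H(3) by simp
    finally show ?thesis .
  qed
  ultimately obtain C where C: "C \<in> carrier_mat n n" "transpose_mat C = C"
    "B = four_block_mat (mat 1 1 (\<lambda>_. e)) (0\<^sub>m 1 n) (0\<^sub>m n 1) C"
    using symmetric_split_off_eigenvector[OF B] by blast
  obtain V f where V: "V \<in> carrier_mat n n" "transpose_mat V * V = 1\<^sub>m n" "C = V * mat_diag n f * transpose_mat V"
    using Suc.IH[OF C(1,2)] by blast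
  define W where "W = four_block_mat (1\<^sub>m 1) (0\<^sub>m 1 n) (0\<^sub>m n 1) V"
  have Vt: "transpose_mat V \<in> carrier_mat n n" using V(1) by simp
  have W: "W \<in> carrier_mat (Suc n) (Suc n)" using V(1) four_block_carrier_mat[of "1\<^sub>m 1" 1 1 V n n] by (simp add: W_def)
  have Wt: "transpose_mat W = four_block_mat (1\<^sub>m 1) (0\<^sub>m 1 n) (0\<^sub>m n 1) (transpose_mat V)"
    unfolding W_def transpose_four_block_mat[OF one_carrier_mat zero_carrier_mat zero_carrier_mat V(1)]
    by simp
  have WW: "transpose_mat W * W = 1\<^sub>m (Suc n)"
    unfolding Wt unfolding W_def
      mult_four_block_mat[OF one_carrier_mat zero_carrier_mat zero_carrier_mat Vt
        one_carrier_mat zero_carrier_mat zero_carrier_mat V(1)]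
    using V(1,2) Vt four_block_one_mat[of 1 n] by simp
  define g where "g i = (case i of 0 \<Rightarrow> e | Suc j \<Rightarrow> f j)" for i
  have D: "mat_diag (Suc n) g = four_block_mat (mat 1 1 (\<lambda>_. e)) (0\<^sub>m 1 n) (0\<^sub>m n 1) (mat_diag n f)"
    by (rule eq_matI) (auto simp: mat_diag_def g_def split: nat.splits)
  have BW: "B = W * mat_diag (Suc n) g * transpose_mat W"
  proof -
    have E: "mat 1 1 (\<lambda>_. e) \<in> carrier_mat 1 1" "mat_diag n f \<in> carrier_mat n n"
      "V * mat_diag n f \<in> carrier_mat n n" using V(1) by auto
    have E4: "V * mat_diag n f * transpose_mat V \<in> carrier_mat n n" by (rule mult_carrier_mat[OF E(3) Vt])
    have "W * mat_diag (Suc n) g = four_block_mat (mat 1 1 (\<lambda>_. e)) (0\<^sub>m 1 n) (0\<^sub>m n 1) (V * mat_diag n f)"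
      unfolding D W_def mult_four_block_mat[OF one_carrier_mat zero_carrier_mat zero_carrier_mat V(1)
        E(1) zero_carrier_mat zero_carrier_mat E(2)]
      using V(1) E by (simp add: left_mult_zero_mat[OF E(2)])
    then show ?thesis
      unfolding Wt C(3) V(3) by (simp only: mult_four_block_mat[OF E(1) zero_carrier_mat zero_carrier_mat E(3)
        one_carrier_mat zero_carrier_mat zero_carrier_mat Vt])
        (use E Vt E4 in \<open>simp add: left_mult_zero_mat[OF Vt] right_mult_zero_mat[OF E(3)] left_add_zero_mat[OF E4]
            del: assoc_mult_mat\<close>)
  qed
  define U where "U = H * W"
  have U: "U \<in> carrier_mat (Suc n) (Suc n)" using H W by (simp add: U_def)
  have Ut: "transpose_mat U = transpose_mat W * H" unfolding U_def transpose_mult[OF H(1) W] H(2) ..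
  have Wt': "transpose_mat W \<in> carrier_mat (Suc n) (Suc n)" using W by simp
  have Dc: "mat_diag (Suc n) g \<in> carrier_mat (Suc n) (Suc n)" by simp
  have "transpose_mat U * U = transpose_mat W * (H * H) * W"
    unfolding Ut unfolding U_def using H(1) W Wt'
    by (simp add: assoc_mult_mat[of _ "Suc n" "Suc n" _ "Suc n" _ "Suc n"]
          mult_carrier_mat[of _ "Suc n" "Suc n" _ "Suc n"])
  then have "transpose_mat U * U = 1\<^sub>m (Suc n)" unfolding H(3) using WW Wt' by simp
  moreover have "A = U * mat_diag (Suc n) g * transpose_mat U"
  proof -
    have "U * mat_diag (Suc n) g * transpose_mat U = H * B * H"
      unfolding Ut BW unfolding U_def using H(1) W Wt' Dc
      by (simp add: assoc_mult_mat[of _ "Suc n" "Suc n" _ "Suc n" _ "Suc n"]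
          mult_carrier_mat[of _ "Suc n" "Suc n" _ "Suc n"])
    also have "\<dots> = (H * H) * A * (H * H)"
      unfolding B_def using H(1) A(1)
      by (simp add: assoc_mult_mat[of _ "Suc n" "Suc n" _ "Suc n" _ "Suc n"]
          mult_carrier_mat[of _ "Suc n" "Suc n" _ "Suc n"])
    finally show ?thesis unfolding H(3) using A(1) by simp
  qed
  ultimately show ?case using U by (intro exI[of _ U] exI[of _ g] conjI)
qed

section \<open>Separable kernels and rank\<close>

text \<open>
The kernel \<open>f\<close> has rank at most \<open>r\<close> on the window \<open>m \<times> c\<close>. Phrased for kernels instead of matrices, the notion applies
directly to blocks given by index shifts and to pointwise products.
\<close>
definition separable :: "nat \<Rightarrow> nat \<Rightarrow> nat \<Rightarrow> (nat \<Rightarrow> nat \<Rightarrow> real) \<Rightarrow> bool" where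
  "separable m c r f \<longleftrightarrow> (\<exists>u v. \<forall>i<m. \<forall>j<c. f i j = (\<Sum>t<r. u t i * v t j))"

lemma separableI: "(\<And>i j. i < m \<Longrightarrow> j < c \<Longrightarrow> f i j = (\<Sum>t<r. u t i * v t j)) \<Longrightarrow> separable m c r f"
  unfolding separable_def by blast

lemma separable_cong:
  assumes "separable m c r f" "\<And>i j. i < m \<Longrightarrow> j < c \<Longrightarrow> g i j = f i j"
  shows "separable m c r g"
  using assms unfolding separable_def by simp

lemma separable_mono:
  assumes "separable m c r f" "r \<le> s"
  shows "separable m c s f"
proof -
  obtain u v where uv: "\<And>i j. i < m \<Longrightarrow> j < c \<Longrightarrow> f i j = (\<Sum>t<r. u t i * v t j)"
    using assms(1) unfolding separable_def by blast
  show ?thesis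
  proof (rule separableI[where u = "\<lambda>t i. if t < r then u t i else 0" and v = v])
    fix i j assume ij: "i < m" "j < c"
    have "(\<Sum>t<s. (if t < r then u t i else 0) * v t j) = (\<Sum>t<r. u t i * v t j)"
      using assms(2) by (intro sum.mono_neutral_cong_right) auto
    then show "f i j = (\<Sum>t<s. (if t < r then u t i else 0) * v t j)" using uv[OF ij] by simp
  qed
qed

lemma sum_lessThan_add: "(\<Sum>t<r + s. h t) = (\<Sum>t<r. h t) + (\<Sum>t<s. h (r + t))" for h :: "nat \<Rightarrow> real"
  by (induction s) (auto simp: add.assoc)

lemma separable_add:
  assumes "separable m c r f" "separable m c s g"
  shows "separable m c (r + s) (\<lambda>i j. f i j + g i j)"
proof -
  obtain u v where uv: "\<And>i j. i < m \<Longrightarrow> j < c \<Longrightarrow> f i j = (\<Sum>t<r. u t i * v t j)"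
    using assms(1) unfolding separable_def by blast
  obtain u' v' where uv': "\<And>i j. i < m \<Longrightarrow> j < c \<Longrightarrow> g i j = (\<Sum>t<s. u' t i * v' t j)"
    using assms(2) unfolding separable_def by blast
  show ?thesis
    by (rule separableI[where u = "\<lambda>t i. if t < r then u t i else u' (t - r) i"
          and v = "\<lambda>t j. if t < r then v t j else v' (t - r) j"])
       (simp add: sum_lessThan_add uv uv')
qed

lemma separable_scale:
  assumes "separable m c r f"
  shows "separable m c r (\<lambda>i j. p i * f i j * q j)"
proof -
  obtain u v where uv: "\<And>i j. i < m \<Longrightarrow> j < c \<Longrightarrow> f i j = (\<Sum>t<r. u t i * v t j)"
    using assms(1) unfolding separable_def by blast
  show ?thesis
    by (rule separableI[where u = "\<lambda>t i. p i * u t i" and v = "\<lambda>t j. v t j * q j"])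
       (simp add: uv sum_distrib_left sum_distrib_right mult_ac)
qed

lemma separable_diff:
  assumes "separable m c r f" "separable m c s g"
  shows "separable m c (r + s) (\<lambda>i j. f i j - g i j)"
  using separable_add[OF assms(1) separable_scale[OF assms(2), of "\<lambda>_. - 1" "\<lambda>_. 1"]] by simp

lemma separable_left_mult:
  assumes "separable m c r f"
  shows "separable m' c r (\<lambda>i j. \<Sum>k<m. a i k * f k j)"
proof -
  obtain u v where uv: "\<And>i j. i < m \<Longrightarrow> j < c \<Longrightarrow> f i j = (\<Sum>t<r. u t i * v t j)"
    using assms(1) unfolding separable_def by blast
  show ?thesis
  proof (rule separableI[where u = "\<lambda>t i. \<Sum>k<m. a i k * u t k" and v = v])
    fix i j assume j: "j < c"
    have "(\<Sum>k<m. a i k * f k j) = (\<Sum>k<m. \<Sum>t<r. a i k * u t k * v t j)"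
      using j by (intro sum.cong) (auto simp: uv sum_distrib_left mult_ac)
    also have "\<dots> = (\<Sum>t<r. \<Sum>k<m. a i k * u t k * v t j)" by (rule sum.swap)
    finally show "(\<Sum>k<m. a i k * f k j) = (\<Sum>t<r. (\<Sum>k<m. a i k * u t k) * v t j)"
      by (simp add: sum_distrib_right)
  qed
qed

lemma separable_transpose:
  assumes "separable m c r f"
  shows "separable c m r (\<lambda>i j. f j i)"
proof -
  obtain u v where uv: "\<And>i j. i < m \<Longrightarrow> j < c \<Longrightarrow> f i j = (\<Sum>t<r. u t i * v t j)"
    using assms unfolding separable_def by blast
  show ?thesis by (rule separableI[where u = v and v = u]) (simp add: uv mult.commute)
qed

lemma separable_right_mult:
  assumes "separable m c r f"
  shows "separable m c' r (\<lambda>i j. \<Sum>k<c. f i k * a k j)"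
  using separable_transpose[OF separable_left_mult[OF separable_transpose[OF assms], of c' "\<lambda>i k. a k i"]]
  by (simp add: mult.commute)

text \<open>
Gaussian elimination: if equation \<open>r\<close> involves the unknown \<open>p\<close>, it is used to remove \<open>p\<close> from the other
equations, which leaves one equation and one unknown fewer.
\<close>
lemma homogeneous_system_nontrivial:
  fixes g :: "nat \<Rightarrow> 'i \<Rightarrow> real"
  assumes "finite J" "r < card J"
  shows "\<exists>z. (\<exists>i\<in>J. z i \<noteq> 0) \<and> (\<forall>t<r. (\<Sum>i\<in>J. g t i * z i) = 0)"
  using assms
proof (induction r arbitrary: J g)
  case 0
  then obtain i where "i \<in> J" by (metis card.empty equals0I less_irrefl)
  then show ?case by (intro exI[of _ "\<lambda>_. 1"]) auto
next
  case (Suc r)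
  show ?case
  proof (cases "\<forall>i\<in>J. g r i = 0")
    case True
    obtain z where "\<exists>i\<in>J. z i \<noteq> 0" "\<forall>t<r. (\<Sum>i\<in>J. g t i * z i) = 0"
      using Suc.IH[of J g] Suc.prems by auto
    moreover have "(\<Sum>i\<in>J. g r i * z i) = 0" using True by simp
    ultimately show ?thesis by (auto simp: less_Suc_eq)
  next
    case False
    then obtain p where p: "p \<in> J" "g r p \<noteq> 0" by blast
    define J' where "J' = J - {p}"
    have J': "finite J'" "r < card J'" "J = insert p J'" "p \<notin> J'"
      using Suc.prems p by (auto simp: J'_def)
    obtain z where z: "\<exists>i\<in>J'. z i \<noteq> 0" "\<forall>t<r. (\<Sum>i\<in>J'. (g t i - g t p * g r i / g r p) * z i) = 0"
      using Suc.IH[OF J'(1,2), of "\<lambda>t i. g t i - g t p * g r i / g r p"] by blast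
    define s where "s = (\<Sum>i\<in>J'. g r i * z i)"
    define y where "y = z(p := - s / g r p)"
    have sum_y: "(\<Sum>i\<in>J. g t i * y i) = (\<Sum>i\<in>J'. g t i * z i) - g t p * s / g r p" for t
    proof -
      have "(\<Sum>i\<in>J'. g t i * y i) = (\<Sum>i\<in>J'. g t i * z i)"
        using J'(4) by (intro sum.cong) (auto simp: y_def)
      then show ?thesis unfolding J'(3) using J'(1,4) by (simp add: y_def)
    qed
    have "(\<Sum>i\<in>J. g t i * y i) = 0" if "t < Suc r" for t
    proof (cases "t = r")
      case True
      then show ?thesis unfolding sum_y using p by (simp add: s_def)
    next
      case False
      then have "0 = (\<Sum>i\<in>J'. (g t i - g t p * g r i / g r p) * z i)" using z(2) that by simp
      also have "\<dots> = (\<Sum>i\<in>J'. g t i * z i) - (\<Sum>i\<in>J'. g t p / g r p * (g r i * z i))"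
        by (simp add: left_diff_distrib sum_subtractf mult.assoc)
      also have "(\<Sum>i\<in>J'. g t p / g r p * (g r i * z i)) = g t p * s / g r p"
        unfolding s_def by (simp add: sum_distrib_left sum_divide_distrib)
      finally show ?thesis unfolding sum_y by simp
    qed
    moreover have "\<exists>i\<in>J. y i \<noteq> 0" using z(1) J'(3,4) by (auto simp: y_def)
    ultimately show ?thesis by blast
  qed
qed

text \<open>
The rank is the size of a maximal independent set of columns, and every column is a combination of those.
\<close>
lemma mat_rank_separable:
  assumes M: "M \<in> carrier_mat m c"
  shows "separable m c (mat_rank M) (\<lambda>i j. M $$ (i, j))"
proof -
  interpret vec_space "TYPE(real)" m .
  define P where "P T \<longleftrightarrow> T \<subseteq> set (cols M) \<and> lin_indpt T" for T
  have "\<exists>S. finite S \<and> maximal S P \<and> {} \<subseteq> S"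
  proof (rule maximal_exists_superset[where S = "set (cols M)"])
    show "P {}" unfolding P_def using finite_lin_indpt2[of "{}"] by auto
  qed (auto simp: P_def)
  then obtain S where S: "finite S" "maximal S P" by blast
  have PS: "S \<subseteq> set (cols M)" "lin_indpt S" using S(2) by (auto simp: maximal_def P_def)
  have cS: "set (cols M) \<subseteq> carrier_vec m" using M cols_dim by blast
  have card: "mat_rank M = card S"
    using rank_card_indpt[OF M, of S] S(2) M unfolding mat_rank_def P_def[abs_def] by simp
  obtain h where "bij_betw h {0..<card S} S"
    using ex_bij_betw_nat_finite[OF S(1)] by blast
  then have h: "bij_betw h {..<card S} S" by (simp add: atLeast0LessThan)
  have "\<exists>a. col M j = lincomb a S" if j: "j < c" for j
  proof -
    have cj: "col M j \<in> set (cols M)" using M j by (auto simp: cols_def)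
    have SC: "S \<subseteq> carrier_vec m" using PS cS by blast
    have "col M j \<in> span S"
    proof (cases "col M j \<in> S")
      case True
      then show ?thesis using PS cS in_own_span[of S] by blast
    next
      case False
      show ?thesis
      proof (rule ccontr)
        assume "col M j \<notin> span S"
        then have "lin_indpt (S \<union> {col M j})"
          using lin_dep_iff_in_span[of S "col M j"] PS cS cj False by auto
        then have "P (S \<union> {col M j})" using PS cj by (auto simp: P_def)
        then show False using S(2) False unfolding maximal_def by blast
      qed
    qed
    from finite_in_span[OF S(1) _ this] SC obtain a where "lincomb a S = col M j" by auto
    then show ?thesis by (intro exI[of _ a]) simp
  qed
  then obtain a where a: "\<And>j. j < c \<Longrightarrow> col M j = lincomb (a j) S" by metis
  show ?thesis unfolding card
  proof (rule separableI[where u = "\<lambda>t i. h t $ i" and v = "\<lambda>t j. a j (h t)"])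
    fix i j assume ij: "i < m" "j < c"
    have "M $$ (i, j) = col M j $ i" using M ij by simp
    also have "\<dots> = (\<Sum>x\<in>S. a j x * x $ i)"
      unfolding a[OF ij(2)] using PS cS by (intro lincomb_index ij) auto
    also have "\<dots> = (\<Sum>t<card S. a j (h t) * h t $ i)"
      using h by (rule sum.reindex_bij_betw[symmetric])
    finally show "M $$ (i, j) = (\<Sum>t<card S. h t $ i * a j (h t))" by (simp add: mult.commute)
  qed
qed

lemma quasiseparable_block_separable:
  assumes M: "M \<in> carrier_mat n n" and I: "r0 + m \<le> n" and J: "c0 + c \<le> n"
    and off: "r0 + m \<le> c0 \<or> c0 + c \<le> r0"
  shows "separable m c (quasiseparable_rank M) (\<lambda>i j. M $$ (r0 + i, c0 + j))"
proof -
  define I J where "I = {r0..<r0 + m}" and "J = {c0..<c0 + c}"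
  define S where "S = submatrix M I J"
  have cI: "{i. i < dim_row M \<and> i \<in> I} = {r0..<r0 + m}" and cJ: "{i. i < dim_col M \<and> i \<in> J} = {c0..<c0 + c}"
    using assms by (auto simp: I_def J_def)
  have S: "S \<in> carrier_mat m c"
    unfolding S_def by (rule carrier_matI) (simp_all add: dim_submatrix cI cJ)
  have ent: "S $$ (i, j) = M $$ (r0 + i, c0 + j)" if "i < m" "j < c" for i j
  proof -
    have "{a \<in> I. a < r0 + i} = {r0..<r0 + i}" "{a \<in> J. a < c0 + j} = {c0..<c0 + j}"
      using that by (auto simp: I_def J_def)
    then show ?thesis
      using submatrix_index_card[of "r0 + i" M "c0 + j" I J] that assms by (simp add: S_def I_def J_def)
  qed
  let ?R = "{mat_rank (submatrix M I J) | I J. I \<subseteq> {..<dim_row M} \<and> J \<subseteq> {..<dim_col M} \<and>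
     ((\<forall>i\<in>I. \<forall>j\<in>J. i < j) \<or> (\<forall>i\<in>I. \<forall>j\<in>J. j < i))}"
  have "?R \<subseteq> (\<lambda>(I, J). mat_rank (submatrix M I J)) ` (Pow {..<dim_row M} \<times> Pow {..<dim_col M})" by auto
  then have "finite ?R" by (rule finite_subset) auto
  moreover have "mat_rank S \<in> ?R"
  proof -
    have "I \<subseteq> {..<dim_row M} \<and> J \<subseteq> {..<dim_col M} \<and> ((\<forall>i\<in>I. \<forall>j\<in>J. i < j) \<or> (\<forall>i\<in>I. \<forall>j\<in>J. j < i))"
      using assms by (auto simp: I_def J_def)
    then show ?thesis unfolding S_def by blast
  qed
  ultimately have "mat_rank S \<le> quasiseparable_rank M"
    unfolding quasiseparable_rank_def by (rule Max_ge)
  then show ?thesis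
    by (rule separable_cong[OF separable_mono[OF mat_rank_separable[OF S]]]) (simp add: ent)
qed

section \<open>Singular values and low-rank approximation\<close>

lemma orthogonal_cancel:
  fixes U :: "real mat"
  assumes "U \<in> carrier_mat n n" "transpose_mat U * U = 1\<^sub>m n" "x \<in> carrier_vec n"
  shows "transpose_mat U *\<^sub>v (U *\<^sub>v x) = x"
proof -
  have "transpose_mat U *\<^sub>v (U *\<^sub>v x) = (transpose_mat U * U) *\<^sub>v x"
    using assms(1,3) by (intro assoc_mult_mat_vec[symmetric]) auto
  then show ?thesis unfolding assms(2) using assms(3) by simp
qed

lemma orthogonal_mult_norm:
  fixes U :: "real mat"
  assumes U: "U \<in> carrier_mat n n" "transpose_mat U * U = 1\<^sub>m n" and x: "x \<in> carrier_vec n"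
  shows "(U *\<^sub>v x) \<bullet> (U *\<^sub>v x) = x \<bullet> x"
proof -
  have Ux: "U *\<^sub>v x \<in> carrier_vec n" using U(1) x by simp
  have Ut: "transpose_mat U \<in> carrier_mat n n" using U(1) by simp
  have "(U *\<^sub>v x) \<bullet> (U *\<^sub>v x) = (transpose_mat U *\<^sub>v (U *\<^sub>v x)) \<bullet> x"
    by (rule transpose_vec_mult_scalar[OF U(1) x Ux, symmetric])
  also have "transpose_mat U *\<^sub>v (U *\<^sub>v x) = x"
    by (rule orthogonal_cancel[OF U x])
  finally show ?thesis .
qed

lemma orthogonal_transpose:
  fixes U :: "real mat"
  assumes "U \<in> carrier_mat n n" "transpose_mat U * U = 1\<^sub>m n"
  shows "U * transpose_mat U = 1\<^sub>m n"
  by (rule mat_mult_left_right_inverse[OF _ assms]) (use assms(1) in simp)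

lemma mat_diag_mult_vec:
  assumes "x \<in> carrier_vec n" "i < n"
  shows "(mat_diag n f *\<^sub>v x) $ i = f i * (x $ i :: real)"
proof -
  have "(mat_diag n f *\<^sub>v x) $ i = (\<Sum>j\<in>{0..<n}. (if i = j then f j else 0) * x $ j)"
    using assms by (simp add: mat_diag_def scalar_prod_def)
  also have "\<dots> = (\<Sum>j\<in>{0..<n}. if j = i then f i * x $ i else 0)" by (intro sum.cong) auto
  finally show ?thesis using assms by simp
qed

lemma mat_diag_quadratic_form:
  assumes z: "z \<in> carrier_vec n"
  shows "z \<bullet> (mat_diag n d *\<^sub>v z) = (\<Sum>i<n. d i * (z $ i :: real)\<^sup>2)"
proof -
  have "dim_vec (mat_diag n d *\<^sub>v z) = n" by (simp add: mat_diag_def)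
  then show ?thesis
    unfolding scalar_prod_def atLeast0LessThan
    by (auto simp: mat_diag_mult_vec[OF z] power2_eq_square simp del: index_mult_mat_vec dim_mult_mat_vec intro!: sum.cong)
qed

lemma sq_norm_sum: "x \<in> carrier_vec n \<Longrightarrow> x \<bullet> x = (\<Sum>i<n. (x $ i)\<^sup>2)" for x :: "real vec"
  by (simp add: scalar_prod_def atLeast0LessThan power2_eq_square)

lemma char_poly_orthogonal_diag:
  fixes A :: "real mat"
  assumes U: "U \<in> carrier_mat n n" "transpose_mat U * U = 1\<^sub>m n" and A: "A = U * mat_diag n d * transpose_mat U"
  shows "char_poly A = (\<Prod>a\<leftarrow>map d [0..<n]. [:- a, 1:])"
proof -
  have Ut: "transpose_mat U \<in> carrier_mat n n" using U(1) by simp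
  have D: "mat_diag n d \<in> carrier_mat n n" by simp
  have A': "A \<in> carrier_mat n n" unfolding A by (rule mult_carrier_mat[OF mult_carrier_mat[OF U(1) D] Ut])
  have "similar_mat A (mat_diag n d)"
    unfolding similar_mat_def similar_mat_wit_def Let_def
    using U(1) Ut A' A orthogonal_transpose[OF U] U(2)
    by (intro exI[of _ U] exI[of _ "transpose_mat U"]) (simp only: carrier_matD insert_subset empty_subsetI D)
  then have "char_poly A = char_poly (mat_diag n d)" by (rule char_poly_similar)
  also have "\<dots> = (\<Prod>a\<leftarrow>diag_mat (mat_diag n d). [:- a, 1:])"
    by (rule char_poly_upper_triangular[OF D]) (auto simp: mat_diag_def)
  also have "diag_mat (mat_diag n d) = map d [0..<n]"
    by (auto simp: diag_mat_def mat_diag_def)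
  finally show ?thesis .
qed

lemma proots_linear_factors:
  "proots (\<Prod>a\<leftarrow>as. [:- a, 1:]) = mset (as :: real list)"
proof (induction as)
  case (Cons a as)
  have "(\<Prod>a\<leftarrow>as. [:- a, 1:]) \<noteq> 0" by (auto simp: prod_list_zero_iff)
  then have "proots ([:- a, 1:] * (\<Prod>a\<leftarrow>as. [:- a, 1:])) = proots [:- a, 1:] + mset as"
    by (subst proots_mult) (simp_all only: Cons pCons_eq_0_iff one_neq_zero not_False_eq_True simp_thms)
  then show ?case by (simp only: list.map prod_list.Cons proots_linear_factor) simp
qed simp

lemma orthogonal_diag_quadratic_form:
  fixes A :: "real mat"
  assumes U: "U \<in> carrier_mat n n" "transpose_mat U * U = 1\<^sub>m n" and A: "A = U * mat_diag n d * transpose_mat U"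
    and z: "z \<in> carrier_vec n"
  shows "(U *\<^sub>v z) \<bullet> (A *\<^sub>v (U *\<^sub>v z)) = (\<Sum>i<n. d i * (z $ i)\<^sup>2)"
proof -
  have Ut: "transpose_mat U \<in> carrier_mat n n" using U(1) by simp
  have D: "mat_diag n d \<in> carrier_mat n n" by simp
  have Uz: "U *\<^sub>v z \<in> carrier_vec n" by (rule mult_mat_vec_carrier[OF U(1) z])
  have Dz: "mat_diag n d *\<^sub>v z \<in> carrier_vec n" by (rule mult_mat_vec_carrier[OF D z])
  have "A *\<^sub>v (U *\<^sub>v z) = U *\<^sub>v (mat_diag n d *\<^sub>v z)"
    unfolding A assoc_mult_mat_vec[OF mult_carrier_mat[OF U(1) D] Ut Uz] orthogonal_cancel[OF U z]
    by (rule assoc_mult_mat_vec[OF U(1) D z])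
  then have "(U *\<^sub>v z) \<bullet> (A *\<^sub>v (U *\<^sub>v z)) = z \<bullet> (mat_diag n d *\<^sub>v z)"
    using transpose_vec_mult_scalar[OF U(1) Dz Uz] orthogonal_cancel[OF U z] by simp
  then show ?thesis using mat_diag_quadratic_form[OF z] by simp
qed

lemma sum_mult_unit_vec_square:
  "i < n \<Longrightarrow> (\<Sum>j<n. d j * ((unit_vec n i :: real vec) $ j)\<^sup>2) = (d i :: real)"
  by (subst sum.cong[OF refl, of _ _ "\<lambda>j. if j = i then d i else 0"]) auto

lemma symmetric_spectrum_quadratic_form:
  fixes A :: "real mat"
  assumes A: "A \<in> carrier_mat n n" "transpose_mat A = A" and spec: "spectrum A \<subseteq> {a..b}"
    and x: "x \<in> carrier_vec n"
  shows "a * (x \<bullet> x) \<le> x \<bullet> (A *\<^sub>v x)" "x \<bullet> (A *\<^sub>v x) \<le> b * (x \<bullet> x)"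
proof -
  obtain U d where U: "U \<in> carrier_mat n n" "transpose_mat U * U = 1\<^sub>m n" and Ad: "A = U * mat_diag n d * transpose_mat U"
    using real_spectral_theorem[OF A] by blast
  have dab: "d i \<in> {a..b}" if "i < n" for i
  proof -
    have "poly (char_poly A) (d i) = 0"
      unfolding char_poly_orthogonal_diag[OF U Ad] using that by (auto simp: poly_prod_list prod_list_zero_iff)
    then have "eigenvalue A (d i)" using eigenvalue_root_char_poly[OF A(1)] by simp
    then show ?thesis using spec by (auto simp: spectrum_def)
  qed
  have Ut: "transpose_mat U \<in> carrier_mat n n" using U(1) by simp
  define z where "z = transpose_mat U *\<^sub>v x"
  have z: "z \<in> carrier_vec n" unfolding z_def by (rule mult_mat_vec_carrier[OF Ut x])
  have xz: "x = U *\<^sub>v z"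
    unfolding z_def using orthogonal_cancel[of "transpose_mat U" n x] Ut x orthogonal_transpose[OF U]
    unfolding transpose_transpose by metis
  have q: "x \<bullet> (A *\<^sub>v x) = (\<Sum>i<n. d i * (z $ i)\<^sup>2)"
    unfolding xz by (rule orthogonal_diag_quadratic_form[OF U Ad z])
  have "x \<bullet> x = (\<Sum>i<n. (z $ i)\<^sup>2)"
    unfolding xz orthogonal_mult_norm[OF U z] by (rule sq_norm_sum[OF z])
  then show "a * (x \<bullet> x) \<le> x \<bullet> (A *\<^sub>v x)" "x \<bullet> (A *\<^sub>v x) \<le> b * (x \<bullet> x)"
    unfolding q using dab by (auto simp: sum_distrib_left intro!: sum_mono mult_right_mono)
qed

text \<open>
The eigenvalue \<open>d i\<close> is the value of the quadratic form at column \<open>i\<close> of \<open>U\<close>, which is a unit vector.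
\<close>
lemma symmetric_diagonalization_bounded:
  fixes A :: "real mat"
  assumes A: "A \<in> carrier_mat n n" "transpose_mat A = A"
    and lo: "\<And>x. x \<in> carrier_vec n \<Longrightarrow> a * (x \<bullet> x) \<le> x \<bullet> (A *\<^sub>v x)"
    and hi: "\<And>x. x \<in> carrier_vec n \<Longrightarrow> x \<bullet> (A *\<^sub>v x) \<le> b * (x \<bullet> x)"
  obtains U d where "U \<in> carrier_mat n n" "transpose_mat U * U = 1\<^sub>m n" "A = U * mat_diag n d * transpose_mat U"
    "\<And>i. i < n \<Longrightarrow> a \<le> d i" "\<And>i. i < n \<Longrightarrow> d i \<le> b"
proof -
  obtain U d where U: "U \<in> carrier_mat n n" "transpose_mat U * U = 1\<^sub>m n" and Ad: "A = U * mat_diag n d * transpose_mat U"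
    using real_spectral_theorem[OF A] by blast
  have "a \<le> d i \<and> d i \<le> b" if i: "i < n" for i
  proof -
    define x where "x = U *\<^sub>v unit_vec n i"
    have e: "unit_vec n i \<in> carrier_vec n" by simp
    have x: "x \<in> carrier_vec n" unfolding x_def by (rule mult_mat_vec_carrier[OF U(1) e])
    have "x \<bullet> (A *\<^sub>v x) = d i"
      unfolding x_def orthogonal_diag_quadratic_form[OF U Ad e] by (rule sum_mult_unit_vec_square[OF i])
    moreover have "x \<bullet> x = 1" unfolding x_def orthogonal_mult_norm[OF U e] using i by simp
    ultimately show ?thesis using lo[OF x] hi[OF x] by simp
  qed
  then show ?thesis using that[OF U Ad] by blast
qed

text \<open>
The columns of \<open>V\<close> are orthonormal eigenvectors of \<open>Y\<^sup>T Y\<close>, and the \<open>s i\<close> are the square roots of the eigenvalues. The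
characteristic polynomial is the product of the linear factors of the eigenvalues, so these are the
roots counted in \<open>singular_value_list\<close>.
\<close>
lemma right_singular_basis:
  fixes Y :: "real mat"
  assumes Y: "Y \<in> carrier_mat m c"
  obtains V s where "V \<in> carrier_mat c c" "transpose_mat V * V = 1\<^sub>m c" "\<And>i. i < c \<Longrightarrow> 0 \<le> s i"
    "\<And>z. z \<in> carrier_vec c \<Longrightarrow> (Y *\<^sub>v (V *\<^sub>v z)) \<bullet> (Y *\<^sub>v (V *\<^sub>v z)) = (\<Sum>i<c. (s i)\<^sup>2 * (z $ i)\<^sup>2)"
    "mset (singular_value_list Y) = mset (map s [0..<c])"
proof -
  define N where "N = transpose_mat Y * Y"
  have Yt: "transpose_mat Y \<in> carrier_mat c m" using Y by simp
  have N: "N \<in> carrier_mat c c" unfolding N_def by (rule mult_carrier_mat[OF Yt Y])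
  have Ns: "transpose_mat N = N" unfolding N_def transpose_mult[OF Yt Y] by simp
  have quad: "x \<bullet> (N *\<^sub>v x) = (Y *\<^sub>v x) \<bullet> (Y *\<^sub>v x)" if x: "x \<in> carrier_vec c" for x
  proof -
    have "x \<bullet> (N *\<^sub>v x) = x \<bullet> (transpose_mat Y *\<^sub>v (Y *\<^sub>v x))"
      unfolding N_def assoc_mult_mat_vec[OF Yt Y x] ..
    also have "\<dots> = (transpose_mat Y *\<^sub>v (Y *\<^sub>v x)) \<bullet> x"
      using Y x by (intro comm_scalar_prod[of _ c]) auto
    also have "\<dots> = (Y *\<^sub>v x) \<bullet> (Y *\<^sub>v x)"
      using Y x by (intro transpose_vec_mult_scalar[OF Y x]) simp
    finally show ?thesis .
  qed
  obtain U d where U: "U \<in> carrier_mat c c" "transpose_mat U * U = 1\<^sub>m c" and Nd: "N = U * mat_diag c d * transpose_mat U"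
    using real_spectral_theorem[OF N Ns] by blast
  have key: "(Y *\<^sub>v (U *\<^sub>v z)) \<bullet> (Y *\<^sub>v (U *\<^sub>v z)) = (\<Sum>i<c. d i * (z $ i)\<^sup>2)" if z: "z \<in> carrier_vec c" for z
    using quad[OF mult_mat_vec_carrier[OF U(1) z]] orthogonal_diag_quadratic_form[OF U Nd z] by simp
  have dpos: "0 \<le> d i" if i: "i < c" for i
  proof -
    have "d i = (Y *\<^sub>v (U *\<^sub>v unit_vec c i)) \<bullet> (Y *\<^sub>v (U *\<^sub>v unit_vec c i))"
      unfolding key[OF unit_vec_carrier] by (rule sum_mult_unit_vec_square[OF i, symmetric])
    also have "\<dots> \<ge> 0" by (auto simp: scalar_prod_def intro: sum_nonneg)
    finally show ?thesis .
  qed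
  show ?thesis
  proof (rule that[OF U, of "\<lambda>i. sqrt (d i)"])
    show "0 \<le> sqrt (d i)" if "i < c" for i using dpos[OF that] by simp
    show "(Y *\<^sub>v (U *\<^sub>v z)) \<bullet> (Y *\<^sub>v (U *\<^sub>v z)) = (\<Sum>i<c. (sqrt (d i))\<^sup>2 * (z $ i)\<^sup>2)" if "z \<in> carrier_vec c" for z
      unfolding key[OF that] using dpos by (intro sum.cong) auto
    show "mset (singular_value_list Y) = mset (map (\<lambda>i. sqrt (d i)) [0..<c])"
      unfolding singular_value_list_def N_def[symmetric] char_poly_orthogonal_diag[OF U Nd] proots_linear_factors
      by (simp add: image_mset.compositionality o_def)
  qed
qed

lemma singular_value_list_decreasing: "i \<le> j \<Longrightarrow> j < length (singular_value_list Y) \<Longrightarrow>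
    singular_value_list Y ! j \<le> singular_value_list Y ! i"
proof -
  assume ij: "i \<le> j" "j < length (singular_value_list Y)"
  define L where "L = sorted_list_of_multiset (image_mset sqrt (proots (char_poly (transpose_mat Y * Y))))"
  have "sorted L" by (simp add: L_def)
  moreover have "singular_value_list Y = rev L" by (simp add: singular_value_list_def L_def)
  ultimately show ?thesis using ij by (auto simp: rev_nth intro!: sorted_nth_mono)
qed

lemma singular_value_one_bound:
  fixes Y :: "real mat"
  assumes Y: "Y \<in> carrier_mat m c" "0 < m" "0 < c" and x: "x \<in> carrier_vec c"
  shows "(Y *\<^sub>v x) \<bullet> (Y *\<^sub>v x) \<le> (singular_value 1 Y)\<^sup>2 * (x \<bullet> x)" "0 \<le> singular_value 1 Y"
proof -
  obtain V s where V: "V \<in> carrier_mat c c" "transpose_mat V * V = 1\<^sub>m c" and s0: "\<And>i. i < c \<Longrightarrow> 0 \<le> s i"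
    and sq: "\<And>z. z \<in> carrier_vec c \<Longrightarrow> (Y *\<^sub>v (V *\<^sub>v z)) \<bullet> (Y *\<^sub>v (V *\<^sub>v z)) = (\<Sum>i<c. (s i)\<^sup>2 * (z $ i)\<^sup>2)"
    and ms: "mset (singular_value_list Y) = mset (map s [0..<c])"
    using right_singular_basis[OF Y(1)] by blast
  have len: "length (singular_value_list Y) = c" using arg_cong[OF ms, of size] by simp
  have set: "set (singular_value_list Y) = s ` {..<c}" using arg_cong[OF ms, of set_mset] by auto
  have one: "singular_value 1 Y = singular_value_list Y ! 0" using Y by (simp add: singular_value_def)
  have mx: "s i \<le> singular_value 1 Y" if "i < c" for i
  proof -
    have "s i \<in> set (singular_value_list Y)" using that set by auto
    then obtain j where "j < c" "singular_value_list Y ! j = s i" by (auto simp: in_set_conv_nth len)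
    then show ?thesis using singular_value_list_decreasing[of 0 j Y] len one by simp
  qed
  show p: "0 \<le> singular_value 1 Y" using mx[of 0] s0[of 0] Y by simp
  have Vt: "transpose_mat V \<in> carrier_mat c c" using V(1) by simp
  define z where "z = transpose_mat V *\<^sub>v x"
  have z: "z \<in> carrier_vec c" using Vt x by (simp add: z_def)
  have Vz: "V *\<^sub>v z = x"
    unfolding z_def using orthogonal_cancel[of "transpose_mat V" c x] Vt x orthogonal_transpose[OF V]
    unfolding transpose_transpose by blast
  have "(Y *\<^sub>v x) \<bullet> (Y *\<^sub>v x) = (\<Sum>i<c. (s i)\<^sup>2 * (z $ i)\<^sup>2)" using sq[OF z] Vz by simp
  also have "\<dots> \<le> (\<Sum>i<c. (singular_value 1 Y)\<^sup>2 * (z $ i)\<^sup>2)"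
    using mx s0 by (intro sum_mono mult_right_mono power_mono) auto
  also have "\<dots> = (singular_value 1 Y)\<^sup>2 * (x \<bullet> x)"
    using orthogonal_mult_norm[OF V z] unfolding Vz sq_norm_sum[OF z] by (simp add: sum_distrib_left)
  finally show "(Y *\<^sub>v x) \<bullet> (Y *\<^sub>v x) \<le> (singular_value 1 Y)\<^sup>2 * (x \<bullet> x)" .
qed

text \<open>
At least \<open>r + 1\<close> of the right singular vectors have a singular value that is not below \<open>\<sigma> = singular_value (1 + r) Y\<close>. Some
nonzero combination \<open>x\<close> of these is killed by \<open>Y - R\<close>, whose rank is at most \<open>r\<close>. Then
\<open>\<sigma> * |x| \<le> |Y x| = |R x| \<le> \<epsilon> * |x|\<close>.
\<close>
lemma singular_value_le_of_separable_approximation: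
  fixes Y R :: "real mat"
  assumes Y: "Y \<in> carrier_mat m c" and R: "R \<in> carrier_mat m c" and r: "r < m" "r < c"
    and sep: "separable m c r (\<lambda>i j. (Y - R) $$ (i, j))" and eps: "0 \<le> \<epsilon>"
    and bound: "\<And>x. x \<in> carrier_vec c \<Longrightarrow> (R *\<^sub>v x) \<bullet> (R *\<^sub>v x) \<le> \<epsilon>\<^sup>2 * (x \<bullet> x)"
  shows "singular_value (1 + r) Y \<le> \<epsilon>"
proof -
  obtain V s where V: "V \<in> carrier_mat c c" "transpose_mat V * V = 1\<^sub>m c" and s0: "\<And>i. i < c \<Longrightarrow> 0 \<le> s i"
    and sq: "\<And>z. z \<in> carrier_vec c \<Longrightarrow> (Y *\<^sub>v (V *\<^sub>v z)) \<bullet> (Y *\<^sub>v (V *\<^sub>v z)) = (\<Sum>i<c. (s i)\<^sup>2 * (z $ i)\<^sup>2)"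
    and ms: "mset (singular_value_list Y) = mset (map s [0..<c])"
    using right_singular_basis[OF Y] by blast
  define L where "L = singular_value_list Y"
  have len: "length L = c" using arg_cong[OF ms, of size] by (simp add: L_def)
  have set: "set L = s ` {..<c}" using arg_cong[OF ms, of set_mset] by (auto simp: L_def)
  define \<sigma> where "\<sigma> = singular_value (1 + r) Y"
  have \<sigma>: "\<sigma> = L ! r" using Y r by (simp add: \<sigma>_def singular_value_def L_def)
  have "\<sigma> \<in> set L" using \<sigma> len r by simp
  then have \<sigma>0: "0 \<le> \<sigma>" using set s0 by auto
  \<comment> \<open>As \<open>\<sigma>\<close> is entry \<open>r\<close> of the decreasing list, at least \<open>r + 1\<close> entries reach it.\<close>
  define J where "J = {i. i < c \<and> \<sigma> \<le> s i}"
  have "r < card J"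
  proof -
    have "J = {i. i < length (map s [0..<c]) \<and> \<sigma> \<le> map s [0..<c] ! i}" by (auto simp: J_def)
    then have "card J = length (filter ((\<le>) \<sigma>) (map s [0..<c]))" by (simp only: length_filter_conv_card)
    also have "\<dots> = size (filter_mset ((\<le>) \<sigma>) (mset (map s [0..<c])))" by (simp only: mset_filter[symmetric] size_mset)
    also have "\<dots> = length (filter ((\<le>) \<sigma>) L)" unfolding ms[symmetric] L_def by (simp only: mset_filter[symmetric] size_mset)
    also have "\<dots> = card {i. i < length L \<and> \<sigma> \<le> L ! i}" by (rule length_filter_conv_card)
    also have "\<dots> \<ge> card {..r}"
    proof (rule card_mono)
      show "{..r} \<subseteq> {i. i < length L \<and> \<sigma> \<le> L ! i}"
        using singular_value_list_decreasing[of _ r Y] r len unfolding \<sigma> L_def by auto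
    qed simp
    finally show ?thesis by simp
  qed
  obtain u v where uv: "\<And>i j. i < m \<Longrightarrow> j < c \<Longrightarrow> (Y - R) $$ (i, j) = (\<Sum>t<r. u t i * v t j)"
    using sep unfolding separable_def by blast
  obtain z where z: "\<exists>i\<in>J. z i \<noteq> 0" "\<And>t. t < r \<Longrightarrow> (\<Sum>i\<in>J. (\<Sum>j<c. v t j * V $$ (j, i)) * z i) = 0"
    using homogeneous_system_nontrivial[of J r "\<lambda>t i. \<Sum>j<c. v t j * V $$ (j, i)"] \<open>r < card J\<close>
    by (auto simp: J_def)
  define zv where "zv = vec c (\<lambda>i. if i \<in> J then z i else 0)"
  have zv: "zv \<in> carrier_vec c" by (simp add: zv_def)
  define x where "x = V *\<^sub>v zv"
  have x: "x \<in> carrier_vec c" using V(1) zv by (simp add: x_def)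
  have xj: "x $ j = (\<Sum>i\<in>J. V $$ (j, i) * z i)" if "j < c" for j
  proof -
    have "x $ j = (\<Sum>i<c. V $$ (j, i) * (if i \<in> J then z i else 0))"
      using V(1) that by (simp add: x_def zv_def scalar_prod_def atLeast0LessThan)
    also have "\<dots> = (\<Sum>i\<in>J. V $$ (j, i) * z i)"
      by (rule sum.mono_neutral_cong_right) (auto simp: J_def)
    finally show ?thesis .
  qed
  have vx: "(\<Sum>j<c. v t j * x $ j) = 0" if "t < r" for t
  proof -
    have "(\<Sum>j<c. v t j * x $ j) = (\<Sum>j<c. \<Sum>i\<in>J. v t j * V $$ (j, i) * z i)"
      by (intro sum.cong) (auto simp: xj sum_distrib_left mult.assoc)
    also have "\<dots> = (\<Sum>i\<in>J. \<Sum>j<c. v t j * V $$ (j, i) * z i)" by (rule sum.swap)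
    also have "\<dots> = 0" using z(2)[OF that] by (simp add: sum_distrib_right)
    finally show ?thesis .
  qed
  have YR: "Y *\<^sub>v x = R *\<^sub>v x"
  proof (rule eq_vecI)
    fix i assume "i < dim_vec (R *\<^sub>v x)"
    then have i: "i < m" using R by simp
    have "(Y *\<^sub>v x) $ i - (R *\<^sub>v x) $ i = (\<Sum>j<c. (Y - R) $$ (i, j) * x $ j)"
      using Y R x i by (simp add: scalar_prod_def atLeast0LessThan left_diff_distrib sum_subtractf)
    also have "\<dots> = (\<Sum>j<c. \<Sum>t<r. u t i * (v t j * x $ j))"
      using i by (intro sum.cong) (auto simp: uv sum_distrib_right mult.assoc simp del: index_minus_mat)
    also have "\<dots> = (\<Sum>t<r. \<Sum>j<c. u t i * (v t j * x $ j))" by (rule sum.swap)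
    also have "\<dots> = 0" using vx by (simp add: sum_distrib_left[symmetric])
    finally show "(Y *\<^sub>v x) $ i = (R *\<^sub>v x) $ i" by simp
  qed (use Y R in simp)
  have "\<sigma>\<^sup>2 * (x \<bullet> x) = (\<Sum>i<c. \<sigma>\<^sup>2 * (zv $ i)\<^sup>2)"
    using orthogonal_mult_norm[OF V zv] unfolding x_def[symmetric] sq_norm_sum[OF zv] by (simp add: sum_distrib_left)
  also have "\<dots> \<le> (\<Sum>i<c. (s i)\<^sup>2 * (zv $ i)\<^sup>2)"
  proof (rule sum_mono)
    fix i assume "i \<in> {..<c}"
    then show "\<sigma>\<^sup>2 * (zv $ i)\<^sup>2 \<le> (s i)\<^sup>2 * (zv $ i)\<^sup>2"
      using \<sigma>0 by (cases "i \<in> J") (auto simp: zv_def J_def intro!: mult_right_mono power_mono)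
  qed
  also have "\<dots> = (R *\<^sub>v x) \<bullet> (R *\<^sub>v x)" using sq[OF zv] YR by (simp add: x_def)
  also have "\<dots> \<le> \<epsilon>\<^sup>2 * (x \<bullet> x)" by (rule bound[OF x])
  finally have le: "\<sigma>\<^sup>2 * (x \<bullet> x) \<le> \<epsilon>\<^sup>2 * (x \<bullet> x)" .
  have "zv \<noteq> 0\<^sub>v c"
  proof
    assume "zv = 0\<^sub>v c"
    moreover obtain i where i: "i \<in> J" "z i \<noteq> 0" using z(1) by blast
    moreover have "i < c" using i by (simp add: J_def)
    moreover have "zv $ i = z i" using i \<open>i < c\<close> by (simp add: zv_def)
    ultimately show False by simp
  qed
  then have "0 < x \<bullet> x" using sq_norm_pos[OF zv] orthogonal_mult_norm[OF V zv] by (simp add: x_def)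
  with le have "\<sigma>\<^sup>2 \<le> \<epsilon>\<^sup>2" by simp
  then show ?thesis using eps unfolding \<sigma>_def by (rule power2_le_imp_le)
qed

section \<open>Sylvester equations with a right-hand side of low rank\<close>

lemma mult3_index:
  assumes "L \<in> carrier_mat m' m" "M \<in> carrier_mat m c" "K \<in> carrier_mat c c'" "i < m'" "j < c'"
  shows "(L * M * K) $$ (i, j) = (\<Sum>l<c. (\<Sum>k<m. L $$ (i, k) * M $$ (k, l)) * (K $$ (l, j) :: real))"
  using assms by (simp add: scalar_prod_def atLeast0LessThan del: assoc_mult_mat)

lemma separable_mat_mult:
  assumes "L \<in> carrier_mat m' m" "M \<in> carrier_mat m c" "K \<in> carrier_mat c c'"
    and "separable m c r (\<lambda>i j. M $$ (i, j))"
  shows "separable m' c' r (\<lambda>i j. (L * M * K) $$ (i, j))"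
  by (rule separable_cong[OF separable_right_mult[OF separable_left_mult[OF assms(4), of m' "\<lambda>i k. L $$ (i, k)"], of c' "\<lambda>l j. K $$ (l, j)"]])
     (rule mult3_index[OF assms(1-3)])

lemma mat_diag_mult_norm:
  assumes x: "x \<in> carrier_vec n" and f: "\<And>i. i < n \<Longrightarrow> \<bar>f i\<bar> \<le> (\<delta> :: real)"
  shows "(mat_diag n f *\<^sub>v x) \<bullet> (mat_diag n f *\<^sub>v x) \<le> \<delta>\<^sup>2 * (x \<bullet> x)"
proof -
  have D: "mat_diag n f *\<^sub>v x \<in> carrier_vec n" by (rule mult_mat_vec_carrier[OF mat_diag_dim x])
  have "(f i * x $ i)\<^sup>2 \<le> \<delta>\<^sup>2 * (x $ i)\<^sup>2" if "i < n" for i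
  proof -
    have "\<bar>f i\<bar>\<^sup>2 \<le> \<delta>\<^sup>2" using f[OF that] by (intro power_mono) auto
    then show ?thesis by (simp add: power_mult_distrib mult_right_mono)
  qed
  then show ?thesis
    unfolding sq_norm_sum[OF D] sq_norm_sum[OF x] sum_distrib_left
    by (intro sum_mono) (simp add: mat_diag_mult_vec[OF x] del: index_mult_mat_vec)
qed

text \<open>
For a single factor, \<open>1 - (x - q) / (x + q) * ((y - q) / (y + q)) = 2 * q * (x + y) / ((x + q) * (y + q))\<close>. The
numerator \<open>x + y\<close> turns \<open>Y\<close> into \<open>F\<close>, and the other terms only scale rows and columns. Each further
factor thus adds \<open>k\<close> to the rank.
\<close>
lemma separable_rational_residual:
  fixes p :: "nat \<Rightarrow> real"
  assumes sep: "separable m c k F"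
    and F: "\<And>i j. i < m \<Longrightarrow> j < c \<Longrightarrow> F i j = (d i + e j) * Y i j"
    and pos: "\<And>i. i < m \<Longrightarrow> 0 < d i" "\<And>j. j < c \<Longrightarrow> 0 < e j" "\<And>t. 0 < p t"
  defines "\<phi> \<equiv> \<lambda>n x. \<Prod>t<n. (x - p t) / (x + p t)"
  shows "separable m c (k * n) (\<lambda>i j. Y i j * (1 - \<phi> n (d i) * \<phi> n (e j)))"
proof (induction n)
  case 0
  show ?case by (rule separableI[where u = "\<lambda>_ _. 0" and v = "\<lambda>_ _. 0"]) (simp add: \<phi>_def)
next
  case (Suc n)
  have "separable m c (k * n + k) (\<lambda>i j. Y i j * (1 - \<phi> n (d i) * \<phi> n (e j))
      + (\<phi> n (d i) * (2 * p n) / (d i + p n)) * F i j * (\<phi> n (e j) / (e j + p n)))"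
    by (rule separable_add[OF Suc separable_scale[OF sep]])
  then have "separable m c (k * n + k) (\<lambda>i j. Y i j * (1 - \<phi> (Suc n) (d i) * \<phi> (Suc n) (e j)))"
  proof (rule separable_cong)
    fix i j assume ij: "i < m" "j < c"
    define x y q where "x = d i" and "y = e j" and "q = p n"
    have xyq: "0 < x" "0 < y" "0 < q" using pos ij by (auto simp: x_def y_def q_def)
    have "1 - (x - q) / (x + q) * ((y - q) / (y + q)) = ((x + q) * (y + q) - (x - q) * (y - q)) / ((x + q) * (y + q))"
    proof -
      have "1 - u / s * (v / t) = (s * t - u * v) / (s * t)" if "s \<noteq> 0" "t \<noteq> 0" for u v s t :: real
        using that by (simp add: diff_divide_distrib)
      then show ?thesis using xyq by simp
    qed
    also have "(x + q) * (y + q) - (x - q) * (y - q) = 2 * q * (x + y)" by (simp add: algebra_simps)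
    finally have t: "1 - (x - q) / (x + q) * ((y - q) / (y + q)) = 2 * q * (x + y) / ((x + q) * (y + q))" .
    have S: "\<phi> (Suc n) z = \<phi> n z * ((z - q) / (z + q))" for z by (simp add: \<phi>_def q_def)
    have "1 - \<phi> (Suc n) x * \<phi> (Suc n) y
        = (1 - \<phi> n x * \<phi> n y) + \<phi> n x * \<phi> n y * (1 - (x - q) / (x + q) * ((y - q) / (y + q)))"
      unfolding S by (simp add: algebra_simps)
    then have "Y i j * (1 - \<phi> (Suc n) x * \<phi> (Suc n) y)
        = Y i j * (1 - \<phi> n x * \<phi> n y) + (\<phi> n x * (2 * q) / (x + q)) * ((x + y) * Y i j) * (\<phi> n y / (y + q))"
    proof -
      have "Y i j * (P * R * (2 * q * (x + y) / ((x + q) * (y + q))))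
          = (P * (2 * q) / (x + q)) * ((x + y) * Y i j) * (R / (y + q))" for P R
        by (simp add: mult_ac)
      then show ?thesis
        using \<open>1 - \<phi> (Suc n) x * \<phi> (Suc n) y = _\<close> unfolding t by (simp only: distrib_left)
    qed
    then show "Y i j * (1 - \<phi> (Suc n) (d i) * \<phi> (Suc n) (e j)) = Y i j * (1 - \<phi> n (d i) * \<phi> n (e j))
      + (\<phi> n (d i) * (2 * p n) / (d i + p n)) * F i j * (\<phi> n (e j) / (e j + p n))"
      unfolding F[OF ij] x_def y_def q_def .
  qed
  then show ?case by (simp add: add.commute)
qed

text \<open>
In the eigenbases of \<open>A\<close> and \<open>B\<close> the equation reads \<open>F i j = (d i + e j) * Yh i j\<close>, as in
\<open>separable_rational_residual\<close>. So \<open>Y\<close> differs by a matrix of rank at most \<open>k * l\<close> from the matrix \<open>R\<close> that has the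
entries \<open>\<phi> (d i) * Yh i j * \<phi> (e j)\<close> in these bases. The spectral norm of \<open>R\<close> is at most \<open>\<delta>\<^sup>2\<close> times that of \<open>Y\<close>.
\<close>
theorem sylvester_singular_value_decay:
  fixes A B Y :: "real mat" and p :: "nat \<Rightarrow> real"
  assumes A: "A \<in> carrier_mat m m" "transpose_mat A = A"
    and B: "B \<in> carrier_mat c c" "transpose_mat B = B" and Y: "Y \<in> carrier_mat m c"
    and a: "0 < a"
    and Aq: "\<And>x. x \<in> carrier_vec m \<Longrightarrow> a * (x \<bullet> x) \<le> x \<bullet> (A *\<^sub>v x)" "\<And>x. x \<in> carrier_vec m \<Longrightarrow> x \<bullet> (A *\<^sub>v x) \<le> b * (x \<bullet> x)"
    and Bq: "\<And>x. x \<in> carrier_vec c \<Longrightarrow> a * (x \<bullet> x) \<le> x \<bullet> (B *\<^sub>v x)" "\<And>x. x \<in> carrier_vec c \<Longrightarrow> x \<bullet> (B *\<^sub>v x) \<le> b * (x \<bullet> x)"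
    and sep: "separable m c k (\<lambda>i j. (A * Y + Y * B) $$ (i, j))"
    and p: "\<And>t. 0 < p t" and \<delta>: "\<And>x. a \<le> x \<Longrightarrow> x \<le> b \<Longrightarrow> \<bar>\<Prod>t<l. (x - p t) / (x + p t)\<bar> \<le> \<delta>"
    and kl: "k * l < m" "k * l < c"
  shows "singular_value (1 + k * l) Y \<le> \<delta>\<^sup>2 * singular_value 1 Y"
proof -
  obtain U d where U: "U \<in> carrier_mat m m" "transpose_mat U * U = 1\<^sub>m m" and Ad: "A = U * mat_diag m d * transpose_mat U"
    and d: "\<And>i. i < m \<Longrightarrow> a \<le> d i" "\<And>i. i < m \<Longrightarrow> d i \<le> b"
    using symmetric_diagonalization_bounded[OF A Aq] by blast
  obtain V e where V: "V \<in> carrier_mat c c" "transpose_mat V * V = 1\<^sub>m c" and Be: "B = V * mat_diag c e * transpose_mat V"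
    and e: "\<And>i. i < c \<Longrightarrow> a \<le> e i" "\<And>i. i < c \<Longrightarrow> e i \<le> b"
    using symmetric_diagonalization_bounded[OF B Bq] by blast
  define U' V' D E where "U' = transpose_mat U" and "V' = transpose_mat V" and "D = mat_diag m d" and "E = mat_diag c e"
  have cU: "U' \<in> carrier_mat m m" and cV: "V' \<in> carrier_mat c c" using U(1) V(1) by (auto simp: U'_def V'_def)
  have cD: "D \<in> carrier_mat m m" and cE: "E \<in> carrier_mat c c" by (auto simp: D_def E_def)
  have UU: "U' * U = 1\<^sub>m m" "U * U' = 1\<^sub>m m" and VV: "V' * V = 1\<^sub>m c" "V * V' = 1\<^sub>m c"
    unfolding U'_def V'_def using U(2) V(2) orthogonal_transpose[OF U] orthogonal_transpose[OF V] by blast+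
  define Yh where "Yh = U' * Y * V"
  have cYV: "Y * V \<in> carrier_mat m c" by (rule mult_carrier_mat[OF Y V(1)])
  have cUY: "U' * Y \<in> carrier_mat m c" by (rule mult_carrier_mat[OF cU Y])
  have cYh: "Yh \<in> carrier_mat m c" unfolding Yh_def by (rule mult_carrier_mat[OF cUY V(1)])
  have UA: "U' * A = D * U'"
  proof -
    have "U' * A = U' * (U * (D * U'))"
      unfolding Ad U'_def[symmetric] D_def[symmetric] assoc_mult_mat[OF U(1) cD cU] ..
    also have "\<dots> = (U' * U) * (D * U')"
      by (rule assoc_mult_mat[OF cU U(1) mult_carrier_mat[OF cD cU], symmetric])
    finally show ?thesis unfolding UU left_mult_one_mat[OF mult_carrier_mat[OF cD cU]] .
  qed
  have BV: "B * V = V * E"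
  proof -
    have "B * V = (V * E) * (V' * V)"
      unfolding Be V'_def[symmetric] E_def[symmetric]
      by (rule assoc_mult_mat[OF mult_carrier_mat[OF V(1) cE] cV V(1)])
    then show ?thesis unfolding VV right_mult_one_mat[OF mult_carrier_mat[OF V(1) cE]] .
  qed
  have hat: "U' * (A * Y + Y * B) * V = D * Yh + Yh * E"
  proof -
    have "U' * (A * Y + Y * B) * V = U' * (A * Y) * V + U' * (Y * B) * V"
      using mult_add_distrib_mat[OF cU mult_carrier_mat[OF A(1) Y] mult_carrier_mat[OF Y B(1)]]
        add_mult_distrib_mat[OF mult_carrier_mat[OF cU mult_carrier_mat[OF A(1) Y]] mult_carrier_mat[OF cU mult_carrier_mat[OF Y B(1)]] V(1)]
      by simp
    also have "U' * (A * Y) * V = D * Yh"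
      unfolding Yh_def assoc_mult_mat[OF cU A(1) Y, symmetric] UA assoc_mult_mat[OF cD cU Y]
      by (rule assoc_mult_mat[OF cD cUY V(1)])
    also have "U' * (Y * B) * V = Yh * E"
      unfolding Yh_def assoc_mult_mat[OF cU Y B(1), symmetric] assoc_mult_mat[OF cUY B(1) V(1)] BV
      by (rule assoc_mult_mat[OF cUY V(1) cE, symmetric])
    finally show ?thesis .
  qed
  have hat_ent: "(U' * (A * Y + Y * B) * V) $$ (i, j) = (d i + e j) * Yh $$ (i, j)" if "i < m" "j < c" for i j
    unfolding hat D_def E_def mat_diag_mult_left[OF cYh] mat_diag_mult_right[OF cYh]
    using that by (simp add: algebra_simps)
  have cR: "A * Y + Y * B \<in> carrier_mat m c" using A(1) B(1) Y by simp
  define \<phi> where "\<phi> x = (\<Prod>t<l. (x - p t) / (x + p t))" for x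
  have sepW: "separable m c (k * l) (\<lambda>i j. Yh $$ (i, j) * (1 - \<phi> (d i) * \<phi> (e j)))"
    unfolding \<phi>_def
    by (rule separable_rational_residual[OF separable_mat_mult[OF cU cR V(1) sep]])
       (use hat_ent d(1) e(1) a p in \<open>auto intro: less_le_trans\<close>)
  define Fd Fe where "Fd = mat_diag m (\<lambda>i. \<phi> (d i))" and "Fe = mat_diag c (\<lambda>j. \<phi> (e j))"
  have cF: "Fd \<in> carrier_mat m m" "Fe \<in> carrier_mat c c" by (auto simp: Fd_def Fe_def)
  define Z where "Z = Fd * (Yh * Fe)"
  have cYF: "Yh * Fe \<in> carrier_mat m c" by (rule mult_carrier_mat[OF cYh cF(2)])
  have cZ: "Z \<in> carrier_mat m c" unfolding Z_def by (rule mult_carrier_mat[OF cF(1) cYF])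
  have Z: "Z $$ (i, j) = \<phi> (d i) * Yh $$ (i, j) * \<phi> (e j)" if "i < m" "j < c" for i j
  proof -
    have "(Yh * Fe) $$ (i, j) = Yh $$ (i, j) * \<phi> (e j)"
      unfolding Fe_def mat_diag_mult_right[OF cYh] using that by simp
    then show ?thesis unfolding Z_def Fd_def mat_diag_mult_left[OF cYF] using that by simp
  qed
  define R where "R = U * Z * V'"
  have cUZ: "U * Z \<in> carrier_mat m c" by (rule mult_carrier_mat[OF U(1) cZ])
  have cR2: "R \<in> carrier_mat m c" unfolding R_def by (rule mult_carrier_mat[OF cUZ cV])
  have YY: "Y = U * Yh * V'"
  proof -
    have "U * Yh * V' = U * (Yh * V')" by (rule assoc_mult_mat[OF U(1) cYh cV])
    also have "Yh * V' = U' * Y * (V * V')" unfolding Yh_def by (rule assoc_mult_mat[OF cUY V(1) cV])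
    also have "\<dots> = U' * Y" unfolding VV by (rule right_mult_one_mat[OF cUY])
    also have "U * (U' * Y) = (U * U') * Y" by (rule assoc_mult_mat[OF U(1) cU Y, symmetric])
    also have "\<dots> = Y" unfolding UU by (rule left_mult_one_mat[OF Y])
    finally show ?thesis by simp
  qed
  have diff: "Y - R = U * (Yh - Z) * V'"
    unfolding R_def mult_minus_distrib_mat[OF U(1) cYh cZ]
      minus_mult_distrib_mat[OF mult_carrier_mat[OF U(1) cYh] cUZ cV] YY[symmetric] ..
  show ?thesis
  proof (rule singular_value_le_of_separable_approximation[OF Y cR2 kl])
    have "separable m c (k * l) (\<lambda>i j. (Yh - Z) $$ (i, j))"
      by (rule separable_cong[OF sepW]) (use cYh cZ Z in \<open>simp add: algebra_simps\<close>)
    then show "separable m c (k * l) (\<lambda>i j. (Y - R) $$ (i, j))"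
      unfolding diff by (rule separable_mat_mult[OF U(1) minus_carrier_mat[OF cZ] cV])
    have mc: "0 < m" "0 < c" using kl by auto
    show "0 \<le> \<delta>\<^sup>2 * singular_value 1 Y"
      using singular_value_one_bound(2)[OF Y mc, of "0\<^sub>v c"] by simp
    fix x :: "real vec" assume x: "x \<in> carrier_vec c"
    define z w where "z = V' *\<^sub>v x" and "w = Fe *\<^sub>v z"
    have cz: "z \<in> carrier_vec c" unfolding z_def by (rule mult_mat_vec_carrier[OF cV x])
    have cw: "w \<in> carrier_vec c" unfolding w_def by (rule mult_mat_vec_carrier[OF cF(2) cz])
    have Vw: "V *\<^sub>v w \<in> carrier_vec c" by (rule mult_mat_vec_carrier[OF V(1) cw])
    have YVw: "Y *\<^sub>v (V *\<^sub>v w) \<in> carrier_vec m" by (rule mult_mat_vec_carrier[OF Y Vw])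
    have cYw: "Yh *\<^sub>v w \<in> carrier_vec m" by (rule mult_mat_vec_carrier[OF cYh cw])
    have cZz: "Z *\<^sub>v z \<in> carrier_vec m" by (rule mult_mat_vec_carrier[OF cZ cz])
    have tU: "transpose_mat U' * U' = 1\<^sub>m m" and tV: "transpose_mat V' * V' = 1\<^sub>m c"
      unfolding U'_def V'_def transpose_transpose using UU(2) VV(2) unfolding U'_def V'_def by blast+
    have Rx: "R *\<^sub>v x = U *\<^sub>v (Z *\<^sub>v z)"
      unfolding R_def assoc_mult_mat_vec[OF cUZ cV x] z_def[symmetric] by (rule assoc_mult_mat_vec[OF U(1) cZ cz])
    have Zz: "Z *\<^sub>v z = Fd *\<^sub>v (Yh *\<^sub>v w)"
      unfolding Z_def assoc_mult_mat_vec[OF cF(1) cYF cz] assoc_mult_mat_vec[OF cYh cF(2) cz] w_def ..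
    have Yw: "Yh *\<^sub>v w = U' *\<^sub>v (Y *\<^sub>v (V *\<^sub>v w))"
      unfolding Yh_def assoc_mult_mat_vec[OF cUY V(1) cw] by (rule assoc_mult_mat_vec[OF cU Y Vw])
    have "(R *\<^sub>v x) \<bullet> (R *\<^sub>v x) = (Z *\<^sub>v z) \<bullet> (Z *\<^sub>v z)"
      unfolding Rx by (rule orthogonal_mult_norm[OF U cZz])
    also have "\<dots> \<le> \<delta>\<^sup>2 * ((Yh *\<^sub>v w) \<bullet> (Yh *\<^sub>v w))"
      unfolding Zz Fd_def using \<delta> d unfolding \<phi>_def by (intro mat_diag_mult_norm cYw) auto
    also have "(Yh *\<^sub>v w) \<bullet> (Yh *\<^sub>v w) = (Y *\<^sub>v (V *\<^sub>v w)) \<bullet> (Y *\<^sub>v (V *\<^sub>v w))"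
      unfolding Yw by (rule orthogonal_mult_norm[OF cU tU YVw])
    also have "\<delta>\<^sup>2 * \<dots> \<le> \<delta>\<^sup>2 * ((singular_value 1 Y)\<^sup>2 * ((V *\<^sub>v w) \<bullet> (V *\<^sub>v w)))"
      by (intro mult_left_mono singular_value_one_bound(1)[OF Y mc Vw]) simp
    also have "(V *\<^sub>v w) \<bullet> (V *\<^sub>v w) = w \<bullet> w" by (rule orthogonal_mult_norm[OF V cw])
    also have "\<delta>\<^sup>2 * ((singular_value 1 Y)\<^sup>2 * (w \<bullet> w)) \<le> \<delta>\<^sup>2 * ((singular_value 1 Y)\<^sup>2 * (\<delta>\<^sup>2 * (z \<bullet> z)))"
      unfolding w_def Fe_def using \<delta> e unfolding \<phi>_def by (intro mult_left_mono mat_diag_mult_norm cz) auto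
    also have "z \<bullet> z = x \<bullet> x" unfolding z_def by (rule orthogonal_mult_norm[OF cV tV x])
    also have "\<delta>\<^sup>2 * ((singular_value 1 Y)\<^sup>2 * (\<delta>\<^sup>2 * (x \<bullet> x))) = (\<delta>\<^sup>2 * singular_value 1 Y)\<^sup>2 * (x \<bullet> x)"
      by (simp add: power2_eq_square)
    finally show "(R *\<^sub>v x) \<bullet> (R *\<^sub>v x) \<le> (\<delta>\<^sup>2 * singular_value 1 Y)\<^sup>2 * (x \<bullet> x)" .
  qed
qed

section \<open>Off-diagonal blocks\<close>

lemma sum_complementary_windows:
  fixes h :: "nat \<Rightarrow> real"
  assumes "m + c = n" "(r0 = 0 \<and> c0 = m) \<or> (c0 = 0 \<and> r0 = c)"
  shows "(\<Sum>k\<in>{0..<n}. h k) = (\<Sum>k<m. h (r0 + k)) + (\<Sum>k<c. h (c0 + k))"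
  using assms(2) sum_lessThan_add[of h m c] sum_lessThan_add[of h c m] assms(1)
  by (auto simp: atLeast0LessThan add.commute)

lemma principal_window_quadratic_form:
  fixes A :: "real mat"
  assumes A: "A \<in> carrier_mat n n" and mc: "m + c = n" "(r0 = 0 \<and> c0 = m) \<or> (c0 = 0 \<and> r0 = c)"
    and x: "x \<in> carrier_vec m"
  obtains y where "y \<in> carrier_vec n" "y \<bullet> y = x \<bullet> x"
    "y \<bullet> (A *\<^sub>v y) = x \<bullet> (mat m m (\<lambda>(i, j). A $$ (r0 + i, r0 + j)) *\<^sub>v x)"
proof -
  define y where "y = vec n (\<lambda>k. if r0 \<le> k \<and> k < r0 + m then x $ (k - r0) else 0)"
  have y: "y \<in> carrier_vec n" by (simp add: y_def)
  have yr: "y $ (r0 + i) = x $ i" if "i < m" for i using that mc by (auto simp: y_def)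
  have yc: "y $ (c0 + i) = 0" if "i < c" for i using that mc by (auto simp: y_def)
  have red: "(\<Sum>k\<in>{0..<n}. h k * y $ k) = (\<Sum>k<m. h (r0 + k) * x $ k)" for h
    unfolding sum_complementary_windows[OF mc] by (simp add: yr yc)
  have Ay: "(A *\<^sub>v y) $ (r0 + i) = (mat m m (\<lambda>(i, j). A $$ (r0 + i, r0 + j)) *\<^sub>v x) $ i" if i: "i < m" for i
  proof -
    have ri: "r0 + i < n" using mc i by auto
    have "(A *\<^sub>v y) $ (r0 + i) = (\<Sum>k\<in>{0..<n}. A $$ (r0 + i, k) * y $ k)"
      using A ri y by (simp add: scalar_prod_def)
    also have "\<dots> = (\<Sum>k<m. A $$ (r0 + i, r0 + k) * x $ k)" by (rule red)
    finally show ?thesis using i x by (simp add: scalar_prod_def atLeast0LessThan)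
  qed
  have "y \<bullet> y = x \<bullet> x"
    using red[of "\<lambda>k. y $ k"] x y by (simp add: scalar_prod_def yr atLeast0LessThan)
  moreover have "y \<bullet> (A *\<^sub>v y) = x \<bullet> (mat m m (\<lambda>(i, j). A $$ (r0 + i, r0 + j)) *\<^sub>v x)"
  proof -
    have "y \<bullet> (A *\<^sub>v y) = (\<Sum>k\<in>{0..<n}. (A *\<^sub>v y) $ k * y $ k)"
      using A y by (simp add: scalar_prod_def mult.commute)
    also have "\<dots> = (\<Sum>k<m. (A *\<^sub>v y) $ (r0 + k) * x $ k)" by (rule red)
    also have "\<dots> = (\<Sum>k<m. x $ k * (mat m m (\<lambda>(i, j). A $$ (r0 + i, r0 + j)) *\<^sub>v x) $ k)"
      by (intro sum.cong) (auto simp: Ay mult.commute simp del: index_mult_mat_vec)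
    finally show ?thesis by (simp add: scalar_prod_def atLeast0LessThan)
  qed
  ultimately show ?thesis using that y by blast
qed

text \<open>
The two cases for the offsets \<open>r0\<close> and \<open>c0\<close> are the upper right and the lower left block. Splitting the
sums in \<open>A X + X B = C\<close> at the block boundary leaves a Sylvester equation for \<open>Y\<close> with principal submatrices of \<open>A\<close>
and \<open>B\<close>. Its right-hand side is the block of \<open>C\<close> minus the block of \<open>A\<close> times a part of \<open>X\<close> minus a part of \<open>X\<close> times the block of \<open>B\<close>,
and all three blocks occupy the position of \<open>Y\<close>.
\<close>
theorem sylvester_block_singular_value_decay:
  fixes A B C X Y :: "real mat" and a b :: real
  assumes A: "A \<in> carrier_mat n n" "transpose_mat A = A" "spectrum A \<subseteq> {a..b}"
    and B: "B \<in> carrier_mat n n" "transpose_mat B = B" "spectrum B \<subseteq> {a..b}"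
    and C: "C \<in> carrier_mat n n" and X: "X \<in> carrier_mat n n" and eq: "A * X + X * B = C"
    and ab: "0 < a" "a < b"
    and mc: "m + c = n" "(r0 = 0 \<and> c0 = m) \<or> (c0 = 0 \<and> r0 = c)"
    and Y: "Y = mat m c (\<lambda>(i, j). X $$ (r0 + i, c0 + j))" and l: "0 < l"
    and kl: "(quasiseparable_rank A + quasiseparable_rank B + quasiseparable_rank C) * l < min m c"
  shows "singular_value (1 + (quasiseparable_rank A + quasiseparable_rank B + quasiseparable_rank C) * l) Y
    \<le> (2 * exp (- (pi * K_ratio (a / b))) ^ l)\<^sup>2 * singular_value 1 Y"
proof -
  let ?k = "quasiseparable_rank A + quasiseparable_rank B + quasiseparable_rank C"
  obtain p where p: "\<And>j. 0 < p j"
    "\<And>x. a \<le> x \<Longrightarrow> x \<le> b \<Longrightarrow> \<bar>\<Prod>j<l. (x - p j) / (x + p j)\<bar> \<le> 2 * exp (- (pi * K_ratio (a / b))) ^ l"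
    using zolotarev_upper_bound[OF ab l] by blast
  define A' where "A' = mat m m (\<lambda>(i, j). A $$ (r0 + i, r0 + j))"
  define B' where "B' = mat c c (\<lambda>(i, j). B $$ (c0 + i, c0 + j))"
  have mc': "c + m = n" "(c0 = 0 \<and> r0 = c) \<or> (r0 = 0 \<and> c0 = m)" using mc by auto
  have idx: "i < m \<Longrightarrow> r0 + i < n" "j < c \<Longrightarrow> c0 + j < n" for i j using mc by auto
  have win: "r0 + m \<le> n" "c0 + c \<le> n" "r0 + m \<le> c0 \<or> c0 + c \<le> r0" using mc by auto
  have cA: "A' \<in> carrier_mat m m" and cB: "B' \<in> carrier_mat c c" and cY: "Y \<in> carrier_mat m c"
    by (auto simp: A'_def B'_def Y)
  have sA: "transpose_mat A' = A'"
    by (rule eq_matI) (auto simp: A'_def idx intro!: transpose_symD[OF A(2,1)])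
  have sB: "transpose_mat B' = B'"
    by (rule eq_matI) (auto simp: B'_def idx intro!: transpose_symD[OF B(2,1)])
  have sepA: "separable m c (quasiseparable_rank A) (\<lambda>i j. \<Sum>k<c. A $$ (r0 + i, c0 + k) * X $$ (c0 + k, c0 + j))"
    by (rule separable_right_mult[OF quasiseparable_block_separable[OF A(1) win]])
  have sepB: "separable m c (quasiseparable_rank B) (\<lambda>i j. \<Sum>k<m. X $$ (r0 + i, r0 + k) * B $$ (r0 + k, c0 + j))"
    by (rule separable_left_mult[OF quasiseparable_block_separable[OF B(1) win]])
  have sepC: "separable m c (quasiseparable_rank C) (\<lambda>i j. C $$ (r0 + i, c0 + j))"
    by (rule quasiseparable_block_separable[OF C win])
  have "separable m c (quasiseparable_rank C + quasiseparable_rank A + quasiseparable_rank B) (\<lambda>i j. (A' * Y + Y * B') $$ (i, j))"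
  proof (rule separable_cong[OF separable_diff[OF separable_diff[OF sepC sepA] sepB]])
    fix i j assume ij: "i < m" "j < c"
    have AX: "(A * X) $$ (r0 + i, c0 + j) = (\<Sum>k<m. A $$ (r0 + i, r0 + k) * X $$ (r0 + k, c0 + j))
        + (\<Sum>k<c. A $$ (r0 + i, c0 + k) * X $$ (c0 + k, c0 + j))"
      using A(1) X idx(1)[OF ij(1)] idx(2)[OF ij(2)] sum_complementary_windows[OF mc, of "\<lambda>k. A $$ (r0 + i, k) * X $$ (k, c0 + j)"]
      by (simp add: scalar_prod_def)
    have XB: "(X * B) $$ (r0 + i, c0 + j) = (\<Sum>k<m. X $$ (r0 + i, r0 + k) * B $$ (r0 + k, c0 + j))
        + (\<Sum>k<c. X $$ (r0 + i, c0 + k) * B $$ (c0 + k, c0 + j))"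
      using B(1) X idx(1)[OF ij(1)] idx(2)[OF ij(2)] sum_complementary_windows[OF mc, of "\<lambda>k. X $$ (r0 + i, k) * B $$ (k, c0 + j)"]
      by (simp add: scalar_prod_def)
    have "C $$ (r0 + i, c0 + j) = (A * X) $$ (r0 + i, c0 + j) + (X * B) $$ (r0 + i, c0 + j)"
      unfolding eq[symmetric] using A(1) B(1) X idx(1)[OF ij(1)] idx(2)[OF ij(2)] by simp
    moreover have "(A' * Y + Y * B') $$ (i, j) = (\<Sum>k<m. A $$ (r0 + i, r0 + k) * X $$ (r0 + k, c0 + j))
        + (\<Sum>k<c. X $$ (r0 + i, c0 + k) * B $$ (c0 + k, c0 + j))"
      using ij by (simp add: A'_def B'_def Y scalar_prod_def atLeast0LessThan)
    ultimately show "(A' * Y + Y * B') $$ (i, j) = C $$ (r0 + i, c0 + j)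
        - (\<Sum>k<c. A $$ (r0 + i, c0 + k) * X $$ (c0 + k, c0 + j))
        - (\<Sum>k<m. X $$ (r0 + i, r0 + k) * B $$ (r0 + k, c0 + j))"
      unfolding AX XB by simp
  qed
  then have sep: "separable m c ?k (\<lambda>i j. (A' * Y + Y * B') $$ (i, j))" by (simp add: add_ac)
  show ?thesis
  proof (rule sylvester_singular_value_decay[OF cA sA cB sB cY ab(1) _ _ _ _ sep p])
    fix x :: "real vec" assume x: "x \<in> carrier_vec m"
    obtain y where "y \<in> carrier_vec n" "y \<bullet> y = x \<bullet> x" "y \<bullet> (A *\<^sub>v y) = x \<bullet> (A' *\<^sub>v x)"
      using principal_window_quadratic_form[OF A(1) mc x] unfolding A'_def by blast
    then show "a * (x \<bullet> x) \<le> x \<bullet> (A' *\<^sub>v x)" "x \<bullet> (A' *\<^sub>v x) \<le> b * (x \<bullet> x)"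
      using symmetric_spectrum_quadratic_form[OF A, of y] by auto
  next
    fix x :: "real vec" assume x: "x \<in> carrier_vec c"
    obtain y where "y \<in> carrier_vec n" "y \<bullet> y = x \<bullet> x" "y \<bullet> (B *\<^sub>v y) = x \<bullet> (B' *\<^sub>v x)"
      using principal_window_quadratic_form[OF B(1) mc' x] unfolding B'_def by blast
    then show "a * (x \<bullet> x) \<le> x \<bullet> (B' *\<^sub>v x)" "x \<bullet> (B' *\<^sub>v x) \<le> b * (x \<bullet> x)"
      using symmetric_spectrum_quadratic_form[OF B, of y] by auto
  qed (use kl in auto)
qed

theorem theorem2p7:
  fixes A B C X :: "real mat" and n k\<^sub>A k\<^sub>B k\<^sub>C :: nat and a b :: real
  assumes "A \<in> carrier_mat n n" and "B \<in> carrier_mat n n"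
    and "C \<in> carrier_mat n n" and "X \<in> carrier_mat n n"
    and "sym_pos_def A" and "sym_pos_def B"
    and "quasiseparable_rank A = k\<^sub>A" and "quasiseparable_rank B = k\<^sub>B"
    and "quasiseparable_rank C = k\<^sub>C"
    and "0 < a" and "a < b"
    and "spectrum A \<subseteq> {a..b}" and "spectrum B \<subseteq> {a..b}"
    and "A * X + X * B = C"
  shows "let k = k\<^sub>A + k\<^sub>B + k\<^sub>C; \<rho> = exp (pi\<^sup>2 / (2 * groetzsch_mu (a / b))) in
    \<forall>Y. off_diagonal_block X Y \<and> Y \<noteq> 0\<^sub>m (dim_row Y) (dim_col Y) \<longrightarrow>
      (\<forall>l::nat. l \<ge> 1 \<longrightarrow>
        singular_value (1 + k * l) Y / singular_value 1 Y \<le> 4 * \<rho> powi (- 2 * int l))"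
proof -
  define k where "k = k\<^sub>A + k\<^sub>B + k\<^sub>C"
  define \<rho> where "\<rho> = exp (pi\<^sup>2 / (2 * groetzsch_mu (a / b)))"
  have sym: "transpose_mat A = A" "transpose_mat B = B" using assms(5,6) by (auto simp: sym_pos_def_def)
  have "pi\<^sup>2 / (2 * groetzsch_mu (a / b)) = pi * K_ratio (a / b)"
    by (simp add: groetzsch_mu_def K_ratio_def power2_eq_square)
  then have \<rho>: "exp (- (pi * K_ratio (a / b))) = inverse \<rho>" by (simp add: \<rho>_def exp_minus)
  have powi: "(2 * exp (- (pi * K_ratio (a / b))) ^ l)\<^sup>2 = 4 * \<rho> powi (- 2 * int l)" for l
  proof -
    have "\<rho> powi (- 2 * int l) = inverse (\<rho> ^ (2 * l))"
      using power_int_minus[of \<rho> "int (2 * l)"] power_int_of_nat[of \<rho> "2 * l"] by simp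
    then show ?thesis unfolding \<rho> by (simp add: power_mult_distrib power_inverse power_mult[symmetric] mult.commute)
  qed
  have "singular_value (1 + k * l) Y / singular_value 1 Y \<le> 4 * \<rho> powi (- 2 * int l)"
    if Yb: "off_diagonal_block X Y" and l: "1 \<le> l" for Y l
  proof -
    obtain q where q: "1 \<le> q" "q < n" and
      Yq: "Y = mat q (n - q) (\<lambda>(i, j). X $$ (i, j + q)) \<or> Y = mat (n - q) q (\<lambda>(i, j). X $$ (i + q, j))"
      using Yb assms(4) unfolding off_diagonal_block_def split_block_def Let_def by auto
    obtain m c r0 c0 where mc: "m + c = n" "(r0 = 0 \<and> c0 = m) \<or> (c0 = 0 \<and> r0 = c)" "0 < m" "0 < c"
      and Y: "Y = mat m c (\<lambda>(i, j). X $$ (r0 + i, c0 + j))"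
    proof (cases "Y = mat q (n - q) (\<lambda>(i, j). X $$ (i, j + q))")
      case True
      then show ?thesis using that[of q "n - q" 0 q] q by (simp add: add.commute)
    next
      case False
      then show ?thesis using that[of "n - q" q q 0] q Yq by (simp add: add.commute)
    qed
    have cY: "Y \<in> carrier_mat m c" by (simp add: Y)
    have s1: "0 \<le> singular_value 1 Y"
      using singular_value_one_bound(2)[OF cY mc(3,4), of "0\<^sub>v c"] by simp
    have le: "singular_value (1 + k * l) Y \<le> 4 * \<rho> powi (- 2 * int l) * singular_value 1 Y"
    proof (cases "k * l < min m c")
      case True
      then show ?thesis
        using sylvester_block_singular_value_decay[OF assms(1) sym(1) assms(12) assms(2) sym(2) assms(13)
            assms(3,4,14,10,11) mc(1,2) Y, of l] l
        unfolding powi k_def assms(7-9) by simp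
    next
      case False
      then have "singular_value (1 + k * l) Y = 0" using cY by (auto simp: singular_value_def)
      moreover have "0 \<le> \<rho> powi (- 2 * int l)" by (simp add: \<rho>_def)
      ultimately show ?thesis using s1 by simp
    qed
    show ?thesis
    proof (cases "singular_value 1 Y = 0")
      case True
      then show ?thesis by (simp add: \<rho>_def)
    next
      case False
      then show ?thesis using le s1 by (simp add: pos_divide_le_eq)
    qed
  qed
  then show ?thesis unfolding Let_def k_def \<rho>_def by blast
qed

end
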